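(* Let $(Y,\Omega)$ be a closed connected symplectic manifold, let $G$ be its group of Hamiltonian diffeomorphisms, and let $\gamma\in\pi_1(G)$ be a class represented by a smooth strictly ergodic loop. Then the asymptotic Hofer norm of $\gamma$ vanishes: $\|\gamma\|_\infty=0$.
   Context: $S^1=\mathbf{R}/\mathbf{Z}$. The group $G$ of Hamiltonian diffeomorphisms of $(Y,\Omega)$ consists of all symplectomorphisms which can be included into a time-dependent Hamiltonian flow on $Y$; it carries the $C^\infty$-topology. A loop $h:S^1\to G$ is smooth if the map $S^1\times Y\to Y$, $(t,y)\mapsto h(t)y$, is smooth. Since $G$ is a path-connected topological group, every loop (not necessarily based at the identity) determines an element of $\pi_1(G)$, by free homotopy. A homeomorphism $T$ of a compact topological space $X$ is strictly ergodic if it has precisely one invariant Borel probability measure and this measure is positive on non-empty open subsets. A loop $h:S^1\to G$ is strictly ergodic if for some irrational $\alpha$ the skew product map $T_{h,\alpha}:S^1\times Y\to S^1\times Y$, $T_{h,\alpha}(t,y)=(t+\alpha,h(t)y)$, is strictly ergodic. Every smooth loop $h:S^1\to G$ is generated by a unique Hamiltonian function $H:S^1\times Y\to\mathbf{R}$ normalized so that the integral of $H(t,\cdot)$ over $Y$ (with respect to the canonical symplectic volume) vanishes for all $t$; i.e. $\frac{d}{dt}h(t)y$ is the value at $h(t)y$ of the Hamiltonian vector field of $H(t,\cdot)$. Define $\mathrm{length}(h)=\int_0^1\max_{y\in Y}|H(t,y)|\,dt$. For $\gamma\in\pi_1(G)$ set $\|\gamma\|=\inf\mathrm{length}(h)$,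 the infimum being over all smooth loops $h:S^1\to G$ representing $\gamma$, and $\|\gamma\|_\infty=\lim_{k\to\infty}\frac1k\|\gamma^k\|$ (the limit exists by subadditivity). *)

theory Defs
  imports "HOL-Analysis.Analysis" "HOL-Combinatorics.Permutations" "HOL-Algebra.Group"
begin

section \<open>Smooth functions between open subsets of normed spaces\<close>

primrec iter_deriv ::
    "('a::real_normed_vector \<Rightarrow> 'b::real_normed_vector) \<Rightarrow> 'a list \<Rightarrow> 'a \<Rightarrow> 'b" where
  "iter_deriv f [] = f"
| "iter_deriv f (v # vs) = iter_deriv (\<lambda>x. frechet_derivative f (at x) v) vs"

text \<open>Only meaningful for open \<open>S\<close>. Each iterated directional derivative is required to be
  (Frechet) differentiable, hence continuous; in finite dimension this is \<open>C\<close>-infinity.\<close>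

definition smooth_on ::
    "'a::real_normed_vector set \<Rightarrow> ('a \<Rightarrow> 'b::real_normed_vector) \<Rightarrow> bool" where
  "smooth_on S f \<longleftrightarrow> (\<forall>vs. \<forall>x\<in>S. iter_deriv f vs differentiable (at x))"


section \<open>Manifolds and smooth maps\<close>

text \<open>A chart is a pair of an open domain and a coordinate map. The coordinate map is
  irrelevant outside the domain. The dimension of the manifold is \<open>CARD('n)\<close>; the order on
  the finite index type \<open>'n\<close> serves to enumerate the coordinates.\<close>

type_synonym ('y, 'n) chart = "'y set \<times> ('y \<Rightarrow> real ^ 'n)"

definition chart_image :: "('y, 'n) chart \<Rightarrow> (real ^ 'n) set" where
  "chart_image c = snd c ` fst c"

definition chart_inv :: "('y, 'n) chart \<Rightarrow> real ^ 'n \<Rightarrow> 'y" where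
  "chart_inv c = inv_into (fst c) (snd c)"

definition is_chart :: "('y::topological_space, 'n::finite) chart \<Rightarrow> bool" where
  "is_chart c \<longleftrightarrow> open (fst c) \<and> open (chart_image c) \<and>
     homeomorphism (fst c) (chart_image c) (snd c) (chart_inv c)"

text \<open>The expression of a map \<open>f\<close> in the charts \<open>c\<close> and \<open>d\<close>, and the set on which it makes
  sense. For \<open>f = id\<close> this is the transition map.\<close>

definition coord_rep ::
    "('y, 'n) chart \<Rightarrow> ('y, 'n) chart \<Rightarrow> ('y \<Rightarrow> 'y) \<Rightarrow> real ^ 'n \<Rightarrow> real ^ 'n" where
  "coord_rep c d f x = snd d (f (chart_inv c x))"

definition coord_dom :: "('y, 'n) chart \<Rightarrow> ('y, 'n) chart \<Rightarrow> ('y \<Rightarrow> 'y) \<Rightarrow> (real ^ 'n) set" where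
  "coord_dom c d f = {x \<in> chart_image c. f (chart_inv c x) \<in> fst d}"

definition smooth_atlas :: "('y::topological_space, 'n::finite) chart set \<Rightarrow> bool" where
  "smooth_atlas A \<longleftrightarrow> (\<forall>c\<in>A. is_chart c) \<and> (\<Union>c\<in>A. fst c) = UNIV \<and>
     (\<forall>c\<in>A. \<forall>d\<in>A. smooth_on (coord_dom c d id) (coord_rep c d id))"

definition smooth_map ::
    "('y::topological_space, 'n::finite) chart set \<Rightarrow> ('y \<Rightarrow> 'y) \<Rightarrow> bool" where
  "smooth_map A f \<longleftrightarrow> continuous_on UNIV f \<and>
     (\<forall>c\<in>A. \<forall>d\<in>A. smooth_on (coord_dom c d f) (coord_rep c d f))"

text \<open>Smoothness of the map \<open>(t, y) \<mapsto> h t y\<close> from \<open>\<real> \<times> Y\<close> to \<open>Y\<close>, respectively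
  of \<open>(t, y) \<mapsto> H t y\<close> from \<open>\<real> \<times> Y\<close> to \<open>\<real>\<close>. For 1-periodic \<open>h\<close> and \<open>H\<close> this is
  smoothness on \<open>(\<real>/\<int>) \<times> Y\<close>.\<close>

definition smooth_family ::
    "('y::topological_space, 'n::finite) chart set \<Rightarrow> (real \<Rightarrow> 'y \<Rightarrow> 'y) \<Rightarrow> bool" where
  "smooth_family A h \<longleftrightarrow> continuous_on UNIV (\<lambda>(t, y). h t y) \<and>
     (\<forall>c\<in>A. \<forall>d\<in>A. smooth_on {(t, x). x \<in> coord_dom c d (h t)} (\<lambda>(t, x). coord_rep c d (h t) x))"

definition smooth_functions ::
    "('y::topological_space, 'n::finite) chart set \<Rightarrow> (real \<Rightarrow> 'y \<Rightarrow> real) \<Rightarrow> bool" where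
  "smooth_functions A H \<longleftrightarrow>
     (\<forall>c\<in>A. smooth_on (UNIV \<times> chart_image c) (\<lambda>(t, x). H t (chart_inv c x)))"

definition diffeomorphism ::
    "('y::topological_space, 'n::finite) chart set \<Rightarrow> ('y \<Rightarrow> 'y) \<Rightarrow> bool" where
  "diffeomorphism A f \<longleftrightarrow> bij f \<and> smooth_map A f \<and> smooth_map A (inv_into UNIV f)"


section \<open>Symplectic manifolds\<close>

text \<open>A 2-form is given by its coordinate expressions: \<open>\<Omega> c x v w\<close> is its value, in the chart \<open>c\<close>
  at the point with coordinates \<open>x\<close>, on the tangent vectors with coordinates \<open>v\<close> and \<open>w\<close>.\<close>

type_synonym ('y, 'n) two_form =
  "('y, 'n) chart \<Rightarrow> real ^ 'n \<Rightarrow> real ^ 'n \<Rightarrow> real ^ 'n \<Rightarrow> real"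

text \<open>The condition that the pullback of \<open>\<Omega>\<close> under \<open>f\<close> is \<open>\<Omega>\<close>. For \<open>f = id\<close> it says that the
  coordinate expressions of \<open>\<Omega>\<close> are related by the usual change of coordinates.\<close>

definition preserves_form ::
    "('y, 'n::finite) chart set \<Rightarrow> ('y, 'n) two_form \<Rightarrow> ('y \<Rightarrow> 'y) \<Rightarrow> bool" where
  "preserves_form A \<Omega> f \<longleftrightarrow> (\<forall>c\<in>A. \<forall>d\<in>A. \<forall>x\<in>coord_dom c d f. \<forall>v w.
     \<Omega> d (coord_rep c d f x)
         (frechet_derivative (coord_rep c d f) (at x) v)
         (frechet_derivative (coord_rep c d f) (at x) w) = \<Omega> c x v w)"

definition smooth_two_form ::
    "('y, 'n::finite) chart set \<Rightarrow> ('y, 'n) two_form \<Rightarrow> bool" where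
  "smooth_two_form A \<Omega> \<longleftrightarrow>
     (\<forall>c\<in>A. \<forall>x\<in>chart_image c. bilinear (\<Omega> c x) \<and> (\<forall>v. \<Omega> c x v v = 0)) \<and>
     (\<forall>c\<in>A. \<forall>v w. smooth_on (chart_image c) (\<lambda>x. \<Omega> c x v w)) \<and>
     preserves_form A \<Omega> id"

text \<open>Vanishing of \<open>d\<Omega>\<close>, evaluated on constant coordinate vector fields.\<close>

definition closed_form :: "('y, 'n::finite) chart set \<Rightarrow> ('y, 'n) two_form \<Rightarrow> bool" where
  "closed_form A \<Omega> \<longleftrightarrow> (\<forall>c\<in>A. \<forall>x\<in>chart_image c. \<forall>u v w.
     frechet_derivative (\<lambda>z. \<Omega> c z v w) (at x) u
   + frechet_derivative (\<lambda>z. \<Omega> c z w u) (at x) v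
   + frechet_derivative (\<lambda>z. \<Omega> c z u v) (at x) w = 0)"

definition nondegenerate_form :: "('y, 'n::finite) chart set \<Rightarrow> ('y, 'n) two_form \<Rightarrow> bool" where
  "nondegenerate_form A \<Omega> \<longleftrightarrow>
     (\<forall>c\<in>A. \<forall>x\<in>chart_image c. \<forall>v. v \<noteq> 0 \<longrightarrow> (\<exists>w. \<Omega> c x v w \<noteq> 0))"

definition closed_connected_symplectic_manifold ::
    "('y::{t2_space,second_countable_topology}, 'n::finite) chart set
       \<Rightarrow> ('y, 'n) two_form \<Rightarrow> bool" where
  "closed_connected_symplectic_manifold A \<Omega> \<longleftrightarrow>
     compact (UNIV :: 'y set) \<and> connected (UNIV :: 'y set) \<and> smooth_atlas A \<and>
     smooth_two_form A \<Omega> \<and> closed_form A \<Omega> \<and> nondegenerate_form A \<Omega>"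

definition symplectomorphism ::
    "('y::topological_space, 'n::finite) chart set \<Rightarrow> ('y, 'n) two_form \<Rightarrow> ('y \<Rightarrow> 'y) \<Rightarrow> bool" where
  "symplectomorphism A \<Omega> f \<longleftrightarrow> diffeomorphism A f \<and> preserves_form A \<Omega> f"


section \<open>The canonical symplectic volume\<close>

text \<open>The value on \<open>v 0, ..., v (2 * m - 1)\<close> of the \<open>m\<close>-th exterior power of an alternating
  bilinear form.\<close>

definition wedge_power :: "('e \<Rightarrow> 'e \<Rightarrow> real) \<Rightarrow> nat \<Rightarrow> (nat \<Rightarrow> 'e) \<Rightarrow> real" where
  "wedge_power \<omega> m v =
     (\<Sum>p | p permutes {..<2 * m}.
        of_int (sign p) * (\<Prod>i<m. \<omega> (v (p (2 * i))) (v (p (2 * i + 1))))) / 2 ^ m"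

definition coord_frame :: "nat \<Rightarrow> real ^ 'n::{finite,wellorder}" where
  "coord_frame i = axis (sorted_list_of_set UNIV ! i) 1"

text \<open>The density of the measure defined by the top power of \<open>\<Omega>\<close> with respect to Lebesgue
  measure in the chart \<open>c\<close>. The absolute value amounts to orienting the manifold by this power.\<close>

definition symplectic_density ::
    "('y, 'n::{finite,wellorder}) two_form \<Rightarrow> ('y, 'n) chart
       \<Rightarrow> real ^ 'n::{finite,wellorder} \<Rightarrow> real" where
  "symplectic_density \<Omega> c x = \<bar>wedge_power (\<Omega> c x) (CARD('n) div 2) coord_frame\<bar>"

definition symplectic_volume ::
    "('y::topological_space, 'n::{finite,wellorder}) chart set \<Rightarrow> ('y, 'n) two_form
       \<Rightarrow> 'y measure" where
  "symplectic_volume A \<Omega> = (THE \<mu>. sets \<mu> = sets borel \<and>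
     (\<forall>c\<in>A. \<forall>B\<in>sets borel. B \<subseteq> fst c \<longrightarrow>
        emeasure \<mu> B = (\<integral>\<^sup>+x\<in>snd c ` B. ennreal (symplectic_density \<Omega> c x) \<partial>lborel)))"


section \<open>Hamiltonian diffeomorphisms\<close>

text \<open>The coordinates at \<open>x\<close> of the Hamiltonian vector field \<open>X\<close> of \<open>F\<close>, with the sign convention
  \<open>\<Omega> (X, v) = - dF v\<close>.\<close>

definition ham_field ::
    "('y, 'n::finite) two_form \<Rightarrow> ('y \<Rightarrow> real) \<Rightarrow> ('y, 'n) chart \<Rightarrow> real ^ 'n \<Rightarrow> real ^ 'n" where
  "ham_field \<Omega> F c x = (THE X. \<forall>v.
     \<Omega> c x X v = - frechet_derivative (\<lambda>z. F (chart_inv c z)) (at x) v)"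

definition generated_by ::
    "('y::topological_space, 'n::finite) chart set \<Rightarrow> ('y, 'n) two_form
       \<Rightarrow> (real \<Rightarrow> 'y \<Rightarrow> real) \<Rightarrow> (real \<Rightarrow> 'y \<Rightarrow> 'y) \<Rightarrow> bool" where
  "generated_by A \<Omega> H h \<longleftrightarrow> smooth_functions A H \<and>
     (\<forall>t y. \<forall>c\<in>A. h t y \<in> fst c \<longrightarrow>
        ((\<lambda>s. snd c (h s y)) has_vector_derivative ham_field \<Omega> (H t) c (snd c (h t y))) (at t))"

text \<open>On a closed manifold every Hamiltonian flow is automatically a smooth family of
  symplectomorphisms; this is part of the definition here.\<close>

definition hamiltonian_flow ::
    "('y::topological_space, 'n::finite) chart set \<Rightarrow> ('y, 'n) two_form
       \<Rightarrow> (real \<Rightarrow> 'y \<Rightarrow> 'y) \<Rightarrow> bool" where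
  "hamiltonian_flow A \<Omega> \<phi> \<longleftrightarrow> smooth_family A \<phi> \<and> (\<forall>t. symplectomorphism A \<Omega> (\<phi> t)) \<and>
     \<phi> 0 = id \<and> (\<exists>H. generated_by A \<Omega> H \<phi>)"

definition Ham ::
    "('y::topological_space, 'n::finite) chart set \<Rightarrow> ('y, 'n) two_form \<Rightarrow> ('y \<Rightarrow> 'y) set" where
  "Ham A \<Omega> = {f. symplectomorphism A \<Omega> f \<and> (\<exists>\<phi> t. hamiltonian_flow A \<Omega> \<phi> \<and> f = \<phi> t)}"

text \<open>The subbasic neighbourhoods of the \<open>C\<close>-infinity topology: uniform closeness on the compact
  set \<open>K\<close> of all partial derivatives up to order \<open>r\<close>.\<close>

definition smooth_nhd ::
    "('y::topological_space, 'n::finite) chart set \<Rightarrow> ('y \<Rightarrow> 'y) \<Rightarrow> ('y, 'n) chart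
       \<Rightarrow> ('y, 'n) chart \<Rightarrow> 'y set \<Rightarrow> nat \<Rightarrow> real \<Rightarrow> ('y \<Rightarrow> 'y) set" where
  "smooth_nhd A f c d K r \<epsilon> = {g. smooth_map A g \<and> g ` K \<subseteq> fst d \<and>
     (\<forall>vs. set vs \<subseteq> Basis \<and> length vs \<le> r \<longrightarrow> (\<forall>x\<in>snd c ` K.
        norm (iter_deriv (coord_rep c d g) vs x - iter_deriv (coord_rep c d f) vs x) < \<epsilon>))}"

definition smooth_topology ::
    "('y::topological_space, 'n::finite) chart set \<Rightarrow> ('y \<Rightarrow> 'y) topology" where
  "smooth_topology A = topology_generated_by
     {smooth_nhd A f c d K r \<epsilon> | f c d K r \<epsilon>. smooth_map A f \<and> c \<in> A \<and> d \<in> A \<and>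
        compact K \<and> K \<subseteq> fst c \<and> f ` K \<subseteq> fst d \<and> 0 < \<epsilon>}"

definition Ham_topology ::
    "('y::topological_space, 'n::finite) chart set \<Rightarrow> ('y, 'n) two_form
       \<Rightarrow> ('y \<Rightarrow> 'y) topology" where
  "Ham_topology A \<Omega> = subtopology (smooth_topology A) (Ham A \<Omega>)"


section \<open>The fundamental group\<close>

definition based_loops :: "'a topology \<Rightarrow> 'a \<Rightarrow> (real \<Rightarrow> 'a) set" where
  "based_loops X a = {p. pathin X p \<and> p 0 = a \<and> p 1 = a}"

definition loop_class :: "'a topology \<Rightarrow> 'a \<Rightarrow> (real \<Rightarrow> 'a) \<Rightarrow> (real \<Rightarrow> 'a) set" where
  "loop_class X a p =
     {q. homotopic_with (\<lambda>r. r 0 = a \<and> r 1 = a) (top_of_set {0..1}) X p q}"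

definition loop_concat :: "(real \<Rightarrow> 'a) \<Rightarrow> (real \<Rightarrow> 'a) \<Rightarrow> real \<Rightarrow> 'a" where
  "loop_concat p q = (\<lambda>t. if t \<le> 1 / 2 then p (2 * t) else q (2 * t - 1))"

definition fundamental_group :: "'a topology \<Rightarrow> 'a \<Rightarrow> (real \<Rightarrow> 'a) set monoid" where
  "fundamental_group X a =
     \<lparr>carrier = loop_class X a ` based_loops X a,
      mult = (\<lambda>\<alpha> \<beta>. \<Union>p\<in>\<alpha>. \<Union>q\<in>\<beta>. loop_class X a (loop_concat p q)),
      one = loop_class X a (\<lambda>_. a)\<rparr>"

text \<open>A loop, not necessarily based, represents a class of based loops if it is freely homotopic
  to an element of the class.\<close>

definition represents :: "'a topology \<Rightarrow> (real \<Rightarrow> 'a) \<Rightarrow> (real \<Rightarrow> 'a) set \<Rightarrow> bool" where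
  "represents X h \<gamma> \<longleftrightarrow>
     (\<exists>p\<in>\<gamma>. homotopic_with (\<lambda>r. r 0 = r 1) (top_of_set {0..1}) X h p)"

abbreviation Ham_pi1 ::
    "('y::topological_space, 'n::finite) chart set \<Rightarrow> ('y, 'n) two_form
       \<Rightarrow> (real \<Rightarrow> 'y \<Rightarrow> 'y) set monoid" where
  "Ham_pi1 A \<Omega> \<equiv> fundamental_group (Ham_topology A \<Omega>) id"


section \<open>Smooth loops and the Hofer norm\<close>

text \<open>Maps defined on the circle \<open>\<real>/\<int>\<close> are represented by 1-periodic functions on \<open>\<real>\<close>.\<close>

definition smooth_loop ::
    "('y::topological_space, 'n::finite) chart set \<Rightarrow> ('y, 'n) two_form
       \<Rightarrow> (real \<Rightarrow> 'y \<Rightarrow> 'y) \<Rightarrow> bool" where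
  "smooth_loop A \<Omega> h \<longleftrightarrow>
     (\<forall>t. h (t + 1) = h t) \<and> (\<forall>t. h t \<in> Ham A \<Omega>) \<and> smooth_family A h"

definition loop_hamiltonian ::
    "('y::topological_space, 'n::{finite,wellorder}) chart set \<Rightarrow> ('y, 'n) two_form
       \<Rightarrow> (real \<Rightarrow> 'y \<Rightarrow> 'y) \<Rightarrow> real \<Rightarrow> 'y \<Rightarrow> real" where
  "loop_hamiltonian A \<Omega> h = (THE H. generated_by A \<Omega> H h \<and> (\<forall>t. H (t + 1) = H t) \<and>
     (\<forall>t. (\<integral>y. H t y \<partial>symplectic_volume A \<Omega>) = 0))"

definition hofer_length ::
    "('y::topological_space, 'n::{finite,wellorder}) chart set \<Rightarrow> ('y, 'n) two_form
       \<Rightarrow> (real \<Rightarrow> 'y \<Rightarrow> 'y) \<Rightarrow> real" where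
  "hofer_length A \<Omega> h = integral {0..1} (\<lambda>t. SUP y. \<bar>loop_hamiltonian A \<Omega> h t y\<bar>)"

definition hofer_norm ::
    "('y::topological_space, 'n::{finite,wellorder}) chart set \<Rightarrow> ('y, 'n) two_form
       \<Rightarrow> (real \<Rightarrow> 'y \<Rightarrow> 'y) set \<Rightarrow> real" where
  "hofer_norm A \<Omega> \<gamma> =
     Inf {hofer_length A \<Omega> h | h. smooth_loop A \<Omega> h \<and> represents (Ham_topology A \<Omega>) h \<gamma>}"

definition scaled_power_norm ::
    "('y::topological_space, 'n::{finite,wellorder}) chart set \<Rightarrow> ('y, 'n) two_form
       \<Rightarrow> (real \<Rightarrow> 'y \<Rightarrow> 'y) set \<Rightarrow> nat \<Rightarrow> real" where
  "scaled_power_norm A \<Omega> \<gamma> k = hofer_norm A \<Omega> (\<gamma> [^]\<^bsub>Ham_pi1 A \<Omega>\<^esub> k) / real k"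

definition asymptotic_hofer_norm ::
    "('y::topological_space, 'n::{finite,wellorder}) chart set \<Rightarrow> ('y, 'n) two_form
       \<Rightarrow> (real \<Rightarrow> 'y \<Rightarrow> 'y) set \<Rightarrow> real" where
  "asymptotic_hofer_norm A \<Omega> \<gamma> = lim (scaled_power_norm A \<Omega> \<gamma>)"


section \<open>Strict ergodicity\<close>

definition invariant_borel_prob :: "'a topology \<Rightarrow> ('a \<Rightarrow> 'a) \<Rightarrow> 'a measure \<Rightarrow> bool" where
  "invariant_borel_prob X T M \<longleftrightarrow>
     space M = topspace X \<and> sets M = sigma_sets (topspace X) {U. openin X U} \<and>
     emeasure M (space M) = 1 \<and>
     (\<forall>B\<in>sets M. emeasure M (T -` B \<inter> space M) = emeasure M B)"

definition strictly_ergodic :: "'a topology \<Rightarrow> ('a \<Rightarrow> 'a) \<Rightarrow> bool" where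
  "strictly_ergodic X T \<longleftrightarrow> compact_space X \<and> homeomorphic_map X X T \<and>
     (\<exists>!M. invariant_borel_prob X T M) \<and>
     (\<forall>M U. invariant_borel_prob X T M \<longrightarrow> openin X U \<longrightarrow> U \<noteq> {} \<longrightarrow> emeasure M U > 0)"

text \<open>The circle \<open>\<real>/\<int>\<close>: its points are represented by the elements of \<open>{0..<1}\<close>, and it carries
  the quotient topology under \<open>frac\<close>.\<close>

definition circle_topology :: "real topology" where
  "circle_topology = topology (\<lambda>U. U \<subseteq> {0..<1} \<and> open (frac -` U))"

lemma openin_circle_topology:
  "openin circle_topology U \<longleftrightarrow> U \<subseteq> {0..<1} \<and> open (frac -` U :: real set)"
proof -
  have "istopology (\<lambda>U. U \<subseteq> {0..<1} \<and> open (frac -` U :: real set))"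
    unfolding istopology_def by (auto simp: vimage_Union)
  then show ?thesis
    by (simp add: circle_topology_def topology_inverse')
qed

lemma topspace_circle_topology: "topspace circle_topology = {0..<1}"
proof -
  have "frac -` {0..<1} = (UNIV :: real set)"
    by (auto simp: frac_lt_1)
  then show ?thesis
    unfolding topspace_def openin_circle_topology by auto
qed

lemma quotient_map_frac: "quotient_map euclidean circle_topology (frac :: real \<Rightarrow> real)"
proof -
  have "range (frac :: real \<Rightarrow> real) = {0..<1}"
  proof
    show "range (frac :: real \<Rightarrow> real) \<subseteq> {0..<1}"
      by (auto simp: frac_lt_1)
    show "{0..<1} \<subseteq> range (frac :: real \<Rightarrow> real)"
      using frac_eq by (metis atLeastLessThan_iff rangeI subsetI)
  qed
  then show ?thesis
    unfolding quotient_map_def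
    by (auto simp: topspace_circle_topology openin_circle_topology vimage_def)
qed

definition skew_product :: "(real \<Rightarrow> 'y \<Rightarrow> 'y) \<Rightarrow> real \<Rightarrow> real \<times> 'y \<Rightarrow> real \<times> 'y" where
  "skew_product h \<alpha> = (\<lambda>(t, y). (frac (t + \<alpha>), h t y))"

definition strictly_ergodic_loop :: "(real \<Rightarrow> 'y::topological_space \<Rightarrow> 'y) \<Rightarrow> bool" where
  "strictly_ergodic_loop h \<longleftrightarrow>
     (\<exists>\<alpha>. \<alpha> \<notin> \<rat> \<and> strictly_ergodic (prod_topology circle_topology euclidean) (skew_product h \<alpha>))"

end

theory Submission
  imports Defs
begin

text \<open>Let \<open>T\<close> be the skew product of the loop \<open>h\<close> with the rotation by \<open>\<alpha>\<close>. Its iterates have the form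
\<open>T\<^sup>k (t, y) = (t + k \<alpha>, h\<^sub>k t y)\<close>, where \<open>h\<^sub>k t = h (t + (k - 1) \<alpha>) \<circ> \<dots> \<circ> h (t + \<alpha>) \<circ> h t\<close> is again a smooth loop
of Hamiltonian diffeomorphisms. The proof consists in showing that these loops represent the powers
\<open>\<gamma>\<^sup>k\<close> and that their lengths grow slower than \<open>k\<close>.

The Hamiltonian of a composition of two motions is the sum of their Hamiltonians, provided that each
of them is expressed in terms of the starting point (\<open>pulled_back_compose\<close>). If \<open>H\<close> is the normalized
generator of \<open>h\<close>, it follows that the generator of \<open>h\<^sub>k\<close> at the point \<open>h\<^sub>k t y\<close> is the Birkhoff sum of length
\<open>k\<close> of the function \<open>\<Phi> (t, y) = H t (h t y)\<close> along the orbit of \<open>(t, y)\<close> (\<open>skew_iterate_generator\<close>). The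
product of the Lebesgue measure on the circle and the symplectic volume is invariant under \<open>T\<close>
(\<open>skew_product_invariant\<close>), so it is, up to normalization, the only invariant measure; and the integral of
\<open>\<Phi>\<close> with respect to it vanishes, because \<open>H\<close> is normalized and \<open>h t\<close> preserves the volume. For a uniquely
ergodic homeomorphism the time averages of a continuous function converge uniformly to its integral
(\<open>uniform_time_averages\<close>): a failure of the convergence would give rise to a further invariant measure,
which the Riesz representation theorem extracts from the averages. Hence the maximum of the generator
of \<open>h\<^sub>k\<close> is at most \<open>\<epsilon> k\<close> for large \<open>k\<close>.

That \<open>h\<^sub>k\<close> represents \<open>\<gamma>\<^sup>k\<close> is seen by contracting the shifts \<open>j \<alpha>\<close> to zero and by the argument of Eckmann
and Hilton, which identifies pointwise products with concatenations (\<open>skew_iterate_homotopic\<close>). The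
deformations used for this come from smooth families with parameters in the plane, and such families
are continuous in the \<open>C\<close>-infinity topology (\<open>psmooth_continuous_map\<close>). They stay inside the group of
Hamiltonian diffeomorphisms because it is closed under composition (\<open>Ham_compose\<close>).

The symplectic volume is obtained by gluing its expressions in charts (\<open>symplectic_volume_eq\<close>), which
agree on overlaps because the top power of a two-form transforms with the Jacobian determinant
(\<open>wedge_power_linear_image\<close>); the same fact yields the invariance under symplectomorphisms. The volume
is positive because the top power of a nondegenerate form does not vanish (\<open>wedge_power_nonzero\<close>), and
this makes normalized generators unique.

The length of a loop is defined by a definite description. For a smooth loop without a normalized
generator it is a constant \<open>default_length\<close> that is the same for all such loops. Therefore loops of
this kind contribute at most a bounded amount to the norm of a power. In particular, if \<open>h\<close> itself is
of this kind, then so is \<open>t \<mapsto> h (k t)\<close>, which also represents \<open>\<gamma>\<^sup>k\<close>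
(\<open>normalized_generator_slow_down\<close>).\<close>

section \<open>Smooth functions of several variables\<close>

text \<open>Truncating \<open>smooth_on\<close> at finite order makes the closure properties of smooth functions
accessible to induction: the derivative of a sum, product or composition is built from functions
whose order is smaller by one.\<close>

primrec ck ::
    "nat \<Rightarrow> 'a::real_normed_vector set \<Rightarrow> ('a \<Rightarrow> 'b::real_normed_vector) \<Rightarrow> bool" where
  "ck 0 S = (\<lambda>f. \<forall>x\<in>S. f differentiable (at x))"
| "ck (Suc k) S = (\<lambda>f. (\<forall>x\<in>S. f differentiable (at x)) \<and>
     (\<forall>v. ck k S (\<lambda>x. frechet_derivative f (at x) v)))"

lemma ck_iff_iter_deriv:
  "ck k S f \<longleftrightarrow> (\<forall>vs. length vs \<le> k \<longrightarrow> (\<forall>x\<in>S. iter_deriv f vs differentiable (at x)))"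
proof (induction k arbitrary: f)
  case (Suc k)
  show ?case
  proof
    assume l: "ck (Suc k) S f"
    show "\<forall>vs. length vs \<le> Suc k \<longrightarrow> (\<forall>x\<in>S. iter_deriv f vs differentiable (at x))"
    proof (intro allI impI)
      fix vs :: "'a list" assume "length vs \<le> Suc k"
      then show "\<forall>x\<in>S. iter_deriv f vs differentiable (at x)"
        using l Suc by (cases vs) auto
    qed
  next
    assume r: "\<forall>vs. length vs \<le> Suc k \<longrightarrow> (\<forall>x\<in>S. iter_deriv f vs differentiable (at x))"
    have "f differentiable at x" if "x \<in> S" for x using r[rule_format, of "[]" x] that by simp
    moreover have "ck k S (\<lambda>x. frechet_derivative f (at x) v)" for v
      unfolding Suc using r[rule_format, of "v # vs" for vs] by auto
    ultimately show "ck (Suc k) S f" by auto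
  qed
qed simp

lemma smooth_on_iff_ck: "smooth_on S f \<longleftrightarrow> (\<forall>k. ck k S f)"
  unfolding smooth_on_def ck_iff_iter_deriv by blast

lemma smooth_on_pointwise: "smooth_on S f \<longleftrightarrow> (\<forall>x\<in>S. smooth_on {x} f)"
  unfolding smooth_on_def by blast

lemma smooth_on_subset: "smooth_on T f \<Longrightarrow> S \<subseteq> T \<Longrightarrow> smooth_on S f"
  unfolding smooth_on_def by blast

lemma smooth_on_iter_deriv: "smooth_on S f \<Longrightarrow> smooth_on S (iter_deriv f vs)"
proof (induction vs arbitrary: f)
  case (Cons v vs)
  have "smooth_on S (\<lambda>x. frechet_derivative f (at x) v)"
    unfolding smooth_on_def using Cons.prems[unfolded smooth_on_def, rule_format, of _ "v # ws" for ws] by auto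
  then show ?case using Cons.IH by simp
qed simp

lemma smooth_on_imp_differentiable: "smooth_on S f \<Longrightarrow> x \<in> S \<Longrightarrow> f differentiable (at x)"
  unfolding smooth_on_def by (metis iter_deriv.simps(1))

lemma smooth_on_imp_has_derivative:
  "smooth_on S f \<Longrightarrow> x \<in> S \<Longrightarrow> (f has_derivative frechet_derivative f (at x)) (at x)"
  using smooth_on_imp_differentiable frechet_derivative_works by blast

lemma smooth_on_imp_continuous_on: "smooth_on S f \<Longrightarrow> continuous_on S f"
  by (meson smooth_on_imp_differentiable continuous_at_imp_continuous_on differentiable_imp_continuous_within)

lemma frechet_derivative_cong_open:
  assumes "open S" "\<And>x. x \<in> S \<Longrightarrow> f x = g x" "x \<in> S"
  shows "frechet_derivative f (at x) = frechet_derivative g (at x)"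
    and "f differentiable (at x) \<longleftrightarrow> g differentiable (at x)"
proof -
  have e: "(f has_derivative D) (at x) \<longleftrightarrow> (g has_derivative D) (at x)" for D
    using assms has_derivative_transform_within_open[of f D x UNIV S g]
      has_derivative_transform_within_open[of g D x UNIV S f] by auto
  show "frechet_derivative f (at x) = frechet_derivative g (at x)"
    unfolding frechet_derivative_def e ..
  show "f differentiable (at x) \<longleftrightarrow> g differentiable (at x)"
    unfolding differentiable_def e ..
qed

lemma ck_cong:
  assumes "open S" "\<And>x. x \<in> S \<Longrightarrow> f x = g x"
  shows "ck k S f \<longleftrightarrow> ck k S g"
  using assms(2)
proof (induction k arbitrary: f g)
  case 0
  then have "f differentiable (at x) \<longleftrightarrow> g differentiable (at x)" if "x \<in> S" for x
    using frechet_derivative_cong_open(2)[OF assms(1), of f g x] that by blast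
  then show ?case by simp
next
  case (Suc k)
  have "ck k S (\<lambda>x. frechet_derivative f (at x) v) = ck k S (\<lambda>x. frechet_derivative g (at x) v)" for v
    by (rule Suc.IH) (metis assms(1) Suc.prems frechet_derivative_cong_open(1))
  moreover have "(\<forall>x\<in>S. f differentiable (at x)) \<longleftrightarrow> (\<forall>x\<in>S. g differentiable (at x))"
    using frechet_derivative_cong_open(2)[OF assms(1) Suc.prems] by auto
  ultimately show ?case by simp
qed

lemma smooth_on_cong:
  "open S \<Longrightarrow> (\<And>x. x \<in> S \<Longrightarrow> f x = g x) \<Longrightarrow> smooth_on S f \<longleftrightarrow> smooth_on S g"
  unfolding smooth_on_iff_ck using ck_cong[of S f g] by auto

lemma iter_deriv_cong:
  assumes "open S" "\<And>x. x \<in> S \<Longrightarrow> f x = g x" "x \<in> S"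
  shows "iter_deriv f vs x = iter_deriv g vs x"
  using assms(2)
proof (induction vs arbitrary: f g)
  case (Cons v vs)
  show ?case unfolding iter_deriv.simps
    by (rule Cons.IH) (metis assms(1) Cons.prems frechet_derivative_cong_open(1))
qed (use assms in auto)

lemma ck_SucI:
  assumes "open S" "\<And>x. x \<in> S \<Longrightarrow> (f has_derivative D x) (at x)" "\<And>v. ck k S (\<lambda>x. D x v)"
  shows "ck (Suc k) S f"
proof -
  have "frechet_derivative f (at x) = D x" if "x \<in> S" for x
    using frechet_derivative_at[OF assms(2)[OF that]] by simp
  then have "ck k S (\<lambda>x. frechet_derivative f (at x) v)" for v
    using ck_cong[OF assms(1), of "\<lambda>x. frechet_derivative f (at x) v" "\<lambda>x. D x v"] assms(3) by simp
  then show ?thesis using assms(2) by (auto simp: differentiable_def)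
qed

lemma ck_Suc_D: "ck (Suc k) S f \<Longrightarrow> ck k S f"
  unfolding ck_iff_iter_deriv by auto

lemma ck_has_derivative:
  "ck k S f \<Longrightarrow> x \<in> S \<Longrightarrow> (f has_derivative frechet_derivative f (at x)) (at x)"
  by (cases k) (auto simp: frechet_derivative_works)

lemma ck_frechet: "ck (Suc k) S f \<Longrightarrow> ck k S (\<lambda>x. frechet_derivative f (at x) v)"
  by simp

lemma ck_const: "ck k S (\<lambda>x. c)"
proof (induction k arbitrary: c)
  case (Suc k)
  then show ?case by (simp add: frechet_derivative_const)
qed simp

lemma ck_add:
  assumes "open S"
  shows "ck k S f \<Longrightarrow> ck k S g \<Longrightarrow> ck k S (\<lambda>x. f x + g x)"
proof (induction k arbitrary: f g)
  case (Suc k)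
  show ?case
    by (rule ck_SucI[OF assms has_derivative_add[OF ck_has_derivative[OF Suc.prems(1)] ck_has_derivative[OF Suc.prems(2)]]],
        assumption, assumption, rule Suc.IH[OF ck_frechet[OF Suc.prems(1)] ck_frechet[OF Suc.prems(2)]])
qed auto

lemma ck_sum:
  assumes "open S" "finite I" "\<And>i. i \<in> I \<Longrightarrow> ck k S (f i)"
  shows "ck k S (\<lambda>x. \<Sum>i\<in>I. f i x)"
  using assms(2,3) by (induction I) (auto simp: ck_const ck_add[OF assms(1)])

lemma ck_scaleR:
  fixes a :: "'a::real_normed_vector \<Rightarrow> real"
  assumes "open S"
  shows "ck k S a \<Longrightarrow> ck k S f \<Longrightarrow> ck k S (\<lambda>x. a x *\<^sub>R f x)"
proof (induction k arbitrary: a f)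
  case (Suc k)
  show ?case
    by (rule ck_SucI[OF assms has_derivative_scaleR[OF ck_has_derivative[OF Suc.prems(1)] ck_has_derivative[OF Suc.prems(2)]]],
        assumption, assumption, rule ck_add[OF assms Suc.IH[OF ck_Suc_D[OF Suc.prems(1)] ck_frechet[OF Suc.prems(2)]]
          Suc.IH[OF ck_frechet[OF Suc.prems(1)] ck_Suc_D[OF Suc.prems(2)]]])
next
  case 0
  then show ?case by (auto intro!: differentiable_scaleR)
qed

lemma ck_bounded_linear:
  assumes "open S" "bounded_linear L"
  shows "ck k S f \<Longrightarrow> ck k S (\<lambda>x. L (f x))"
proof (induction k arbitrary: f)
  case (Suc k)
  show ?case
    by (rule ck_SucI[OF assms(1) bounded_linear.has_derivative[OF assms(2) ck_has_derivative[OF Suc.prems(1)]]],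
        assumption, rule Suc.IH[OF ck_frechet[OF Suc.prems(1)]])
next
  case 0
  then show ?case
    by (auto simp: differentiable_def intro: bounded_linear.has_derivative[OF assms(2)])
qed

lemma ck_id: "open S \<Longrightarrow> ck k S (\<lambda>x. x)"
proof (cases k)
  case (Suc n)
  assume "open S"
  then show ?thesis unfolding Suc
    by (rule ck_SucI[where D = "\<lambda>x v. v"]) (auto intro!: ck_const)
qed simp

text \<open>Expanding the inner derivative in the standard basis turns the chain rule into a finite sum of
products, and in each product the composition involves a derivative of \<open>g\<close>, to which the induction
hypothesis applies. The expansion needs the intermediate space to be finite-dimensional.\<close>

lemma ck_compose:
  fixes f :: "'a::real_normed_vector \<Rightarrow> 'b::euclidean_space" and g :: "'b \<Rightarrow> 'c::real_normed_vector"
  assumes "open S" "open T" "f ` S \<subseteq> T"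
  shows "ck k S f \<Longrightarrow> ck k T g \<Longrightarrow> ck k S (\<lambda>x. g (f x))"
proof (induction k arbitrary: g)
  case 0
  show ?case
  proof (simp, intro ballI)
    fix x assume "x \<in> S"
    then have "f differentiable at x" "g differentiable at (f x)" using 0 assms(3) by auto
    then show "(\<lambda>x. g (f x)) differentiable at x"
      using differentiable_chain_at[of f x g] by (simp add: o_def)
  qed
next
  case (Suc k)
  have d: "((\<lambda>x. g (f x)) has_derivative
      (\<lambda>v. \<Sum>b\<in>Basis. (frechet_derivative f (at x) v \<bullet> b) *\<^sub>R frechet_derivative g (at (f x)) b)) (at x)"
    if "x \<in> S" for x
  proof -
    have f: "(f has_derivative frechet_derivative f (at x)) (at x)"
      using ck_has_derivative[OF Suc.prems(1) that] .
    have g: "(g has_derivative frechet_derivative g (at (f x))) (at (f x))"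
      using ck_has_derivative[OF Suc.prems(2)] that assms(3) by blast
    interpret lg: linear "frechet_derivative g (at (f x))"
      using g has_derivative_linear by blast
    have e: "frechet_derivative g (at (f x)) w =
        (\<Sum>b\<in>Basis. (w \<bullet> b) *\<^sub>R frechet_derivative g (at (f x)) b)" for w
      by (subst euclidean_representation[of w, symmetric]) (simp only: lg.sum lg.scaleR)
    show ?thesis
      by (rule has_derivative_eq_rhs[OF has_derivative_compose[OF f g]]) (rule ext, rule e)
  qed
  show ?case
  proof (rule ck_SucI[OF assms(1) d])
    show "ck k S (\<lambda>x. \<Sum>b\<in>Basis. (frechet_derivative f (at x) v \<bullet> b) *\<^sub>R frechet_derivative g (at (f x)) b)" for v
      by (intro ck_sum ck_scaleR assms ck_bounded_linear[OF _ bounded_linear_inner_left]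
          ck_frechet[OF Suc.prems(1)] Suc.IH[OF ck_Suc_D[OF Suc.prems(1)] ck_frechet[OF Suc.prems(2)]]) simp
  qed
qed

lemma smooth_on_const: "smooth_on S (\<lambda>x. c)"
  by (simp add: smooth_on_iff_ck ck_const)

lemma smooth_on_id: "open S \<Longrightarrow> smooth_on S (\<lambda>x. x)"
  by (simp add: smooth_on_iff_ck ck_id del: ck.simps)

lemma smooth_on_add:
  "open S \<Longrightarrow> smooth_on S f \<Longrightarrow> smooth_on S g \<Longrightarrow> smooth_on S (\<lambda>x. f x + g x)"
  using ck_add[of S _ f g] unfolding smooth_on_iff_ck by blast

lemma smooth_on_scaleR:
  fixes a :: "'a::real_normed_vector \<Rightarrow> real"
  shows "open S \<Longrightarrow> smooth_on S a \<Longrightarrow> smooth_on S f \<Longrightarrow> smooth_on S (\<lambda>x. a x *\<^sub>R f x)"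
  using ck_scaleR[of S _ a f] unfolding smooth_on_iff_ck by blast

lemma smooth_on_mult:
  fixes a :: "'a::real_normed_vector \<Rightarrow> real"
  shows "open S \<Longrightarrow> smooth_on S a \<Longrightarrow> smooth_on S f \<Longrightarrow> smooth_on S (\<lambda>x. a x * f x)"
  using smooth_on_scaleR[of S a f] by simp

lemma smooth_on_bounded_linear:
  "open S \<Longrightarrow> bounded_linear L \<Longrightarrow> smooth_on S f \<Longrightarrow> smooth_on S (\<lambda>x. L (f x))"
  using ck_bounded_linear[of S L _ f] unfolding smooth_on_iff_ck by blast

lemma smooth_on_linear: "open S \<Longrightarrow> bounded_linear L \<Longrightarrow> smooth_on S L"
  using smooth_on_bounded_linear smooth_on_id by blast

lemma smooth_on_Pair:
  fixes f :: "'a::real_normed_vector \<Rightarrow> 'b::real_normed_vector" and g :: "'a \<Rightarrow> 'c::real_normed_vector"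
  assumes "open S" "smooth_on S f" "smooth_on S g"
  shows "smooth_on S (\<lambda>x. (f x, g x))"
proof -
  have "smooth_on S (\<lambda>x. (f x, 0::'c) + (0::'b, g x))"
    using assms by (intro smooth_on_add smooth_on_bounded_linear[of S "\<lambda>y. (y, 0)"]
       smooth_on_bounded_linear[of S "\<lambda>y. (0, y)"])
      (auto intro!: bounded_linear_Pair bounded_linear_ident bounded_linear_zero)
  then show ?thesis by simp
qed

lemma smooth_on_compose:
  fixes f :: "'a::real_normed_vector \<Rightarrow> 'b::euclidean_space" and g :: "'b \<Rightarrow> 'c::real_normed_vector"
  assumes "open S" "open T" "f ` S \<subseteq> T" "smooth_on S f" "smooth_on T g"
  shows "smooth_on S (\<lambda>x. g (f x))"
  using assms ck_compose unfolding smooth_on_iff_ck by blast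

lemma smooth_on_local:
  assumes "\<And>x. x \<in> S \<Longrightarrow> \<exists>T g. open T \<and> x \<in> T \<and> smooth_on T g \<and> (\<forall>z\<in>T. f z = g z)"
  shows "smooth_on S f"
proof (subst smooth_on_pointwise, intro ballI)
  fix x assume "x \<in> S"
  then obtain T g where "open T" "x \<in> T" "smooth_on T g" "\<forall>z\<in>T. f z = g z" using assms by blast
  then have "smooth_on T f" using smooth_on_cong[of T f g] by blast
  then show "smooth_on {x} f" using \<open>x \<in> T\<close> smooth_on_subset by blast
qed


section \<open>Smooth families of maps of a manifold\<close>

text \<open>The definition of \<open>smooth_family\<close> with an arbitrary parameter space. Families with parameters in
the plane serve as homotopies between loops.\<close>

definition psmooth ::
    "('y::topological_space, 'n::finite) chart set \<Rightarrow> ('p::real_normed_vector \<Rightarrow> 'y \<Rightarrow> 'y) \<Rightarrow> bool" where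
  "psmooth A F \<longleftrightarrow> continuous_on UNIV (\<lambda>(p, y). F p y) \<and>
     (\<forall>c\<in>A. \<forall>d\<in>A. smooth_on {(p, x). x \<in> coord_dom c d (F p)} (\<lambda>(p, x). coord_rep c d (F p) x))"

lemma smooth_family_iff_psmooth: "smooth_family A h \<longleftrightarrow> psmooth A h"
  unfolding smooth_family_def psmooth_def ..

abbreviation coord_deriv ::
    "('y, 'n::finite) chart \<Rightarrow> ('y, 'n) chart \<Rightarrow> ('y \<Rightarrow> 'y) \<Rightarrow> real ^ 'n \<Rightarrow> real ^ 'n \<Rightarrow> real ^ 'n" where
  "coord_deriv c d f x \<equiv> frechet_derivative (coord_rep c d f) (at x)"

locale smooth_manifold =
  fixes A :: "('y::topological_space, 'n::finite) chart set"
  assumes atlas: "smooth_atlas A"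
begin

lemma chart_props:
  assumes "c \<in> A"
  shows open_chart_dom: "open (fst c)" and open_chart_image: "open (chart_image c)"
    and continuous_chart: "continuous_on (fst c) (snd c)"
    and continuous_chart_inv: "continuous_on (chart_image c) (chart_inv c)"
  using atlas assms unfolding smooth_atlas_def is_chart_def homeomorphism_def by auto

lemma chart_inv_chart: "c \<in> A \<Longrightarrow> y \<in> fst c \<Longrightarrow> chart_inv c (snd c y) = y"
  using atlas unfolding smooth_atlas_def is_chart_def homeomorphism_def by auto

lemma chart_chart_inv: "c \<in> A \<Longrightarrow> x \<in> chart_image c \<Longrightarrow> snd c (chart_inv c x) = x"
  using atlas unfolding smooth_atlas_def is_chart_def homeomorphism_def by auto

lemma chart_inv_mem: "c \<in> A \<Longrightarrow> x \<in> chart_image c \<Longrightarrow> chart_inv c x \<in> fst c"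
  unfolding chart_image_def chart_inv_def by (auto simp: inv_into_into)

lemma chart_mem: "y \<in> fst c \<Longrightarrow> snd c y \<in> chart_image c"
  unfolding chart_image_def by auto

lemma chart_at: obtains c where "c \<in> A" "y \<in> fst c"
  using atlas unfolding smooth_atlas_def by blast

lemma inj_on_chart: "c \<in> A \<Longrightarrow> inj_on (snd c) (fst c)"
  by (metis chart_inv_chart inj_onI)

lemma coord_dom_iff:
  "x \<in> coord_dom c d f \<longleftrightarrow> x \<in> chart_image c \<and> f (chart_inv c x) \<in> fst d"
  unfolding coord_dom_def by simp

lemma coord_rep_mem: "x \<in> coord_dom c d f \<Longrightarrow> coord_rep c d f x \<in> chart_image d"
  unfolding coord_dom_iff coord_rep_def by (auto simp: chart_mem)

lemma chart_inv_coord_rep: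
  "d \<in> A \<Longrightarrow> x \<in> coord_dom c d f \<Longrightarrow> chart_inv d (coord_rep c d f x) = f (chart_inv c x)"
  unfolding coord_dom_iff coord_rep_def by (auto simp: chart_inv_chart)

lemma coord_domI: "c \<in> A \<Longrightarrow> y \<in> fst c \<Longrightarrow> f y \<in> fst d \<Longrightarrow> snd c y \<in> coord_dom c d f"
  unfolding coord_dom_iff by (auto simp: chart_inv_chart chart_mem)

lemma open_coord_dom_family:
  fixes F :: "'p::topological_space \<Rightarrow> 'y \<Rightarrow> 'y"
  assumes "continuous_on UNIV (\<lambda>(p, y). F p y)" "c \<in> A" "d \<in> A"
  shows "open {(p, x). x \<in> coord_dom c d (F p)}"
proof -
  have "continuous_on (UNIV \<times> chart_image c) (\<lambda>(p, x). (\<lambda>(p, y). F p y) (p, chart_inv c x))"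
    unfolding case_prod_unfold
    using continuous_chart_inv[OF assms(2)]
    by (intro continuous_on_compose2[OF assms(1)[unfolded case_prod_unfold]] continuous_on_Pair
        continuous_on_compose2[OF continuous_chart_inv[OF assms(2)]] continuous_intros) auto
  moreover have "open (UNIV \<times> chart_image c :: ('p \<times> _) set)"
    by (intro open_Times open_UNIV open_chart_image assms)
  ultimately have "open ((\<lambda>(p, x). (\<lambda>(p, y). F p y) (p, chart_inv c x)) -` fst d \<inter> UNIV \<times> chart_image c)"
    using open_chart_dom[OF assms(3)] by (simp add: continuous_on_open_vimage)
  moreover have "{(p, x). x \<in> coord_dom c d (F p)} =
      (\<lambda>(p, x). (\<lambda>(p, y). F p y) (p, chart_inv c x)) -` fst d \<inter> UNIV \<times> chart_image c"
    by (auto simp: coord_dom_iff)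
  ultimately show ?thesis by simp
qed

lemma open_coord_dom:
  assumes "continuous_on UNIV f" "c \<in> A" "d \<in> A"
  shows "open (coord_dom c d f)"
proof -
  have "continuous_on UNIV (\<lambda>(p::real, y). f y)"
    unfolding case_prod_unfold by (intro continuous_on_compose2[OF assms(1)] continuous_intros) auto
  from open_coord_dom_family[OF this assms(2,3)]
  have "open (Pair 0 -` {(p::real, x). x \<in> coord_dom c d f})"
    by (intro open_vimage) (auto intro!: continuous_intros)
  then show ?thesis by simp
qed

lemma psmooth_continuous: "psmooth A F \<Longrightarrow> continuous_on UNIV (\<lambda>(p, y). F p y)"
  unfolding psmooth_def by simp

lemma psmooth_smooth_on:
  "psmooth A F \<Longrightarrow> c \<in> A \<Longrightarrow> d \<in> A \<Longrightarrow>
     smooth_on {(p, x). x \<in> coord_dom c d (F p)} (\<lambda>(p, x). coord_rep c d (F p) x)"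
  unfolding psmooth_def by simp

text \<open>Near a given point the inner maps take values in a single chart \<open>e\<close>, and there the coordinate
expression of the composition factors through the coordinates of \<open>e\<close>.\<close>

lemma psmooth_compose:
  fixes F G :: "'p::euclidean_space \<Rightarrow> 'y \<Rightarrow> 'y"
  assumes F: "psmooth A F" and G: "psmooth A G"
  shows "psmooth A (\<lambda>p. F p \<circ> G p)"
proof -
  have cont: "continuous_on UNIV (\<lambda>(p, y). (F p \<circ> G p) y)"
    using continuous_on_compose2[OF psmooth_continuous[OF F, unfolded case_prod_unfold]
       continuous_on_Pair[OF continuous_on_fst[OF continuous_on_id] psmooth_continuous[OF G, unfolded case_prod_unfold]]]
    by (simp add: case_prod_unfold)
  have "smooth_on {(p, x). x \<in> coord_dom c d (F p \<circ> G p)} (\<lambda>(p, x). coord_rep c d (F p \<circ> G p) x)"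
    if cd: "c \<in> A" "d \<in> A" for c d
  proof (rule smooth_on_local)
    fix z assume z: "z \<in> {(p, x). x \<in> coord_dom c d (F p \<circ> G p)}"
    obtain p0 x0 where z0: "z = (p0, x0)" by force
    obtain e where e: "e \<in> A" "G p0 (chart_inv c x0) \<in> fst e" using chart_at by blast
    let ?T = "{(p, x). x \<in> coord_dom c e (G p)} \<inter> {(p, x). x \<in> coord_dom c d (F p \<circ> G p)}"
    let ?g = "\<lambda>z. (\<lambda>(p, x). coord_rep e d (F p) x) (fst z, (\<lambda>(p, x). coord_rep c e (G p) x) z)"
    have oT: "open ?T"
      by (intro open_Int open_coord_dom_family[OF cont cd] open_coord_dom_family[OF psmooth_continuous[OF G] cd(1) e(1)])
    have sub: "?T \<subseteq> {(p, x). x \<in> coord_dom c e (G p)}" by blast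
    have "smooth_on ?T ?g"
      by (rule smooth_on_compose[OF oT open_coord_dom_family[OF psmooth_continuous[OF F] e(1) cd(2)] _ _ psmooth_smooth_on[OF F e(1) cd(2)]],
          force simp: coord_dom_iff coord_rep_def chart_inv_chart[OF e(1)] chart_mem,
          intro smooth_on_Pair oT smooth_on_linear bounded_linear_fst smooth_on_subset[OF psmooth_smooth_on[OF G cd(1) e(1)] sub])
    moreover have "\<forall>z\<in>?T. (\<lambda>(p, x). coord_rep c d (F p \<circ> G p) x) z = ?g z"
      by (auto simp: coord_dom_iff coord_rep_def chart_inv_chart[OF e(1)])
    moreover have "z \<in> ?T" using z e unfolding z0 by (auto simp: coord_dom_iff)
    ultimately show "\<exists>T g. open T \<and> z \<in> T \<and> smooth_on T g \<and> (\<forall>z\<in>T. (\<lambda>(p, x). coord_rep c d (F p \<circ> G p) x) z = g z)"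
      using oT by blast
  qed
  then show ?thesis using cont unfolding psmooth_def by blast
qed

lemma psmooth_reparam:
  fixes F :: "'p::euclidean_space \<Rightarrow> 'y \<Rightarrow> 'y" and \<theta> :: "'q::euclidean_space \<Rightarrow> 'p"
  assumes F: "psmooth A F" and \<theta>: "smooth_on UNIV \<theta>"
  shows "psmooth A (\<lambda>q. F (\<theta> q))"
proof -
  have c\<theta>: "continuous_on UNIV \<theta>" using \<theta> smooth_on_imp_continuous_on by blast
  have cont: "continuous_on UNIV (\<lambda>(q, y). F (\<theta> q) y)"
    using continuous_on_compose2[OF psmooth_continuous[OF F, unfolded case_prod_unfold], of UNIV "\<lambda>(q, y). (\<theta> q, y)"]
    by (simp add: case_prod_unfold continuous_on_Pair continuous_on_snd continuous_on_id continuous_on_compose2[OF c\<theta>] continuous_on_fst)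
  have "smooth_on {(q, x). x \<in> coord_dom c d (F (\<theta> q))} (\<lambda>(q, x). coord_rep c d (F (\<theta> q)) x)"
    if cd: "c \<in> A" "d \<in> A" for c d
  proof -
    have o: "open {(q, x). x \<in> coord_dom c d (F (\<theta> q))}" by (rule open_coord_dom_family[OF cont cd])
    have "smooth_on {(q, x). x \<in> coord_dom c d (F (\<theta> q))} (\<lambda>z. \<theta> (fst z))"
      by (rule smooth_on_compose[OF o open_UNIV _ smooth_on_linear[OF o bounded_linear_fst] \<theta>]) simp
    then have "smooth_on {(q, x). x \<in> coord_dom c d (F (\<theta> q))} (\<lambda>z. (\<theta> (fst z), snd z))"
      by (rule smooth_on_Pair[OF o _ smooth_on_linear[OF o bounded_linear_snd]])
    then have "smooth_on {(q, x). x \<in> coord_dom c d (F (\<theta> q))}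
        (\<lambda>z. (\<lambda>(p, x). coord_rep c d (F p) x) (\<theta> (fst z), snd z))"
      by (rule smooth_on_compose[OF o open_coord_dom_family[OF psmooth_continuous[OF F] cd] _ _ psmooth_smooth_on[OF F cd], rotated]) force
    then show ?thesis by (simp add: case_prod_unfold)
  qed
  then show ?thesis using cont unfolding psmooth_def by blast
qed

lemma psmooth_const:
  fixes f :: "'y \<Rightarrow> 'y"
  assumes f: "smooth_map A f"
  shows "psmooth A (\<lambda>p::'p::real_normed_vector. f)"
proof -
  have cf: "continuous_on UNIV f" using f unfolding smooth_map_def by blast
  have cont: "continuous_on UNIV (\<lambda>(p::'p, y). f y)"
    unfolding case_prod_unfold by (intro continuous_on_compose2[OF cf] continuous_intros) auto
  have "smooth_on {(p::'p, x). x \<in> coord_dom c d f} (\<lambda>(p, x). coord_rep c d f x)"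
    if cd: "c \<in> A" "d \<in> A" for c d
  proof -
    have o: "open {(p::'p, x). x \<in> coord_dom c d f}" by (rule open_coord_dom_family[OF cont cd])
    have "smooth_on (coord_dom c d f) (coord_rep c d f)" using f cd unfolding smooth_map_def by blast
    then have "smooth_on {(p::'p, x). x \<in> coord_dom c d f} (\<lambda>z. coord_rep c d f (snd z))"
      by (rule smooth_on_compose[OF o open_coord_dom[OF cf cd] _ smooth_on_linear[OF o bounded_linear_snd], rotated]) force
    then show ?thesis by (simp add: case_prod_unfold)
  qed
  then show ?thesis using cont unfolding psmooth_def by blast
qed

lemma psmooth_slice:
  fixes F :: "'p::euclidean_space \<Rightarrow> 'y \<Rightarrow> 'y"
  assumes F: "psmooth A F"
  shows "smooth_map A (F p)"
proof -
  have cont: "continuous_on UNIV (F p)"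
    using continuous_on_compose2[OF psmooth_continuous[OF F], of UNIV "Pair p"]
    by (simp add: continuous_on_Pair continuous_on_const continuous_on_id)
  have "smooth_on (coord_dom c d (F p)) (coord_rep c d (F p))" if cd: "c \<in> A" "d \<in> A" for c d
  proof -
    have o: "open (coord_dom c d (F p))" by (rule open_coord_dom[OF cont cd])
    have "smooth_on (coord_dom c d (F p)) (\<lambda>z. (\<lambda>(p, x). coord_rep c d (F p) x) (p, z))"
      by (rule smooth_on_compose[OF o open_coord_dom_family[OF psmooth_continuous[OF F] cd] _ _ psmooth_smooth_on[OF F cd]],
          force, intro smooth_on_Pair o smooth_on_const smooth_on_id)
    then show ?thesis by simp
  qed
  then show ?thesis using cont unfolding smooth_map_def by blast
qed

lemma smooth_map_compose: "smooth_map A f \<Longrightarrow> smooth_map A g \<Longrightarrow> smooth_map A (f \<circ> g)"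
  using psmooth_slice[OF psmooth_compose[of "\<lambda>p::real. f" "\<lambda>p. g"]] psmooth_const by blast

lemma smooth_map_id: "smooth_map A id"
  using atlas unfolding smooth_map_def smooth_atlas_def by (auto simp: continuous_on_id id_def)

lemma smooth_map_continuous: "smooth_map A f \<Longrightarrow> continuous_on UNIV f"
  unfolding smooth_map_def by blast

lemma coord_rep_has_derivative:
  "smooth_map A f \<Longrightarrow> c \<in> A \<Longrightarrow> d \<in> A \<Longrightarrow> x \<in> coord_dom c d f \<Longrightarrow>
     (coord_rep c d f has_derivative coord_deriv c d f x) (at x)"
  unfolding smooth_map_def by (meson smooth_on_imp_has_derivative)

lemma coord_rep_compose:
  "e \<in> A \<Longrightarrow> x \<in> coord_dom c e g \<Longrightarrow> coord_rep c d (f \<circ> g) x = coord_rep e d f (coord_rep c e g x)"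
  unfolding coord_rep_def coord_dom_iff by (simp add: chart_inv_chart)

lemma coord_deriv_compose:
  assumes "smooth_map A f" "smooth_map A g" "c \<in> A" "d \<in> A" "e \<in> A"
    "x \<in> coord_dom c e g" "coord_rep c e g x \<in> coord_dom e d f"
  shows "coord_deriv c d (f \<circ> g) x v = coord_deriv e d f (coord_rep c e g x) (coord_deriv c e g x v)"
proof -
  have "((\<lambda>z. coord_rep e d f (coord_rep c e g z)) has_derivative
      (\<lambda>v. coord_deriv e d f (coord_rep c e g x) (coord_deriv c e g x v))) (at x)"
    by (rule has_derivative_compose[OF coord_rep_has_derivative[OF assms(2,3,5,6)]
        coord_rep_has_derivative[OF assms(1,5,4,7)]])
  then have "(coord_rep c d (f \<circ> g) has_derivative
      (\<lambda>v. coord_deriv e d f (coord_rep c e g x) (coord_deriv c e g x v))) (at x)"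
    by (rule has_derivative_transform_within_open[OF _ open_coord_dom[OF smooth_map_continuous[OF assms(2)] assms(3,5)] assms(6)])
      (rule coord_rep_compose[OF assms(5), symmetric])
  from frechet_derivative_at[OF this] show ?thesis by metis
qed

lemma coord_deriv_id:
  assumes "c \<in> A" "x \<in> chart_image c"
  shows "coord_deriv c c id x v = v"
proof -
  have "((\<lambda>z. z) has_derivative (\<lambda>v. v)) (at x)" by simp
  then have "(coord_rep c c id has_derivative (\<lambda>v. v)) (at x)"
    by (rule has_derivative_transform_within_open[OF _ open_chart_image[OF assms(1)] assms(2)])
      (simp add: coord_rep_def chart_chart_inv assms)
  from frechet_derivative_at[OF this] show ?thesis by metis
qed

lemma preserves_form_compose:
  assumes "smooth_map A f" "smooth_map A g" "preserves_form A \<Omega> f" "preserves_form A \<Omega> g"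
  shows "preserves_form A \<Omega> (f \<circ> g)"
  unfolding preserves_form_def
proof (intro ballI allI)
  fix c d x v w assume cd: "c \<in> A" "d \<in> A" and x: "x \<in> coord_dom c d (f \<circ> g)"
  obtain e where e: "e \<in> A" "g (chart_inv c x) \<in> fst e" using chart_at by blast
  have xe: "x \<in> coord_dom c e g" and xz: "coord_rep c e g x \<in> coord_dom e d f"
    using x e by (auto simp: coord_dom_iff coord_rep_def chart_inv_chart chart_mem)
  show "\<Omega> d (coord_rep c d (f \<circ> g) x) (coord_deriv c d (f \<circ> g) x v) (coord_deriv c d (f \<circ> g) x w) = \<Omega> c x v w"
    using assms(3,4) cd e xe xz unfolding preserves_form_def
    by (simp add: coord_deriv_compose[OF assms(1,2) cd e(1) xe xz] coord_rep_compose[OF e(1) xe] )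
qed

text \<open>The coordinate derivative of \<open>f\<close> is a left inverse of that of the inverse map, so the invariance
of the form under \<open>f\<close> can be read backwards.\<close>

lemma preserves_form_inverse:
  assumes "bij f" "smooth_map A f" "smooth_map A (inv_into UNIV f)" "preserves_form A \<Omega> f"
  shows "preserves_form A \<Omega> (inv_into UNIV f)"
  unfolding preserves_form_def
proof (intro ballI allI)
  fix c d x v w assume cd: "c \<in> A" "d \<in> A" and x: "x \<in> coord_dom c d (inv_into UNIV f)"
  have fi: "f \<circ> inv_into UNIV f = id" "f (inv_into UNIV f y) = y" for y using assms(1) by (auto simp: fun_eq_iff bij_is_surj surj_f_inv_f)
  let ?z = "coord_rep c d (inv_into UNIV f) x"
  have z: "?z \<in> coord_dom d c f" "coord_rep d c f ?z = x" "x \<in> chart_image c"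
    using x cd by (auto simp: coord_dom_iff coord_rep_def chart_inv_chart chart_mem fi chart_inv_mem chart_chart_inv)
  have "coord_deriv d c f ?z (coord_deriv c d (inv_into UNIV f) x u) = u" for u
    using coord_deriv_compose[OF assms(2,3) cd(1) cd(1) cd(2) x z(1), of u] coord_deriv_id[OF cd(1) z(3)]
    by (simp add: fi)
  moreover have "\<Omega> c (coord_rep d c f ?z) (coord_deriv d c f ?z a) (coord_deriv d c f ?z b) = \<Omega> d ?z a b" for a b
    using assms(4) cd z(1) unfolding preserves_form_def by blast
  ultimately show "\<Omega> d ?z (coord_deriv c d (inv_into UNIV f) x v) (coord_deriv c d (inv_into UNIV f) x w) = \<Omega> c x v w"
    by (metis z(2))
qed

lemma symplectomorphism_compose:
  assumes "symplectomorphism A \<Omega> f" "symplectomorphism A \<Omega> g"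
  shows "symplectomorphism A \<Omega> (f \<circ> g)"
  using assms unfolding symplectomorphism_def diffeomorphism_def
  by (auto simp: bij_comp o_inv_distrib smooth_map_compose preserves_form_compose)

lemma symplectomorphism_inverse:
  "symplectomorphism A \<Omega> f \<Longrightarrow> symplectomorphism A \<Omega> (inv_into UNIV f)"
  unfolding symplectomorphism_def diffeomorphism_def
  by (auto simp: bij_imp_bij_inv inv_inv_eq preserves_form_inverse)

lemma smooth_functions_continuous:
  assumes "smooth_functions A H"
  shows "continuous_on UNIV (\<lambda>(t, y). H t y)"
proof -
  have "continuous_on (UNIV \<times> fst c) (\<lambda>(t, y). H t y)" if c: "c \<in> A" for c
  proof -
    have "continuous_on (UNIV \<times> chart_image c) (\<lambda>(t, x). H t (chart_inv c x))"
      using assms c unfolding smooth_functions_def by (blast intro: smooth_on_imp_continuous_on)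
    then have "continuous_on (UNIV \<times> fst c) (\<lambda>z. (\<lambda>(t, x). H t (chart_inv c x)) (fst z, snd c (snd z)))"
      by (rule continuous_on_compose2)
        (auto intro!: continuous_intros continuous_on_compose2[OF continuous_chart[OF c]] simp: chart_mem)
    then show ?thesis
      by (rule continuous_on_eq) (auto simp: chart_inv_chart[OF c])
  qed
  then have "continuous_on (\<Union>c\<in>A. UNIV \<times> fst c) (\<lambda>(t, y). H t y)"
    by (intro continuous_on_open_UN open_Times open_UNIV open_chart_dom)
  moreover have "(\<Union>c\<in>A. UNIV \<times> fst c) = (UNIV :: (real \<times> 'y) set)"
    using atlas unfolding smooth_atlas_def by fastforce
  ultimately show ?thesis by simp
qed

lemma smooth_functions_slice:
  assumes "smooth_functions A H" "c \<in> A" "x \<in> chart_image c"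
  shows "(\<lambda>z. H t (chart_inv c z)) differentiable (at x)"
proof -
  have "(\<lambda>(t, x). H t (chart_inv c x)) differentiable (at (t, x))"
    using assms smooth_on_imp_differentiable unfolding smooth_functions_def by blast
  then have "((\<lambda>(t, x). H t (chart_inv c x)) \<circ> Pair t) differentiable (at x)"
    by (intro differentiable_chain_at) (auto intro!: derivative_intros simp: differentiable_def exI[of _ "\<lambda>v. (0, v)"])
  then show ?thesis by (simp add: o_def)
qed

lemma smooth_functions_reparam:
  assumes "smooth_functions A H" "smooth_on UNIV (\<theta> :: real \<Rightarrow> real)" "smooth_on UNIV (r :: real \<Rightarrow> real)"
  shows "smooth_functions A (\<lambda>t y. r t * H (\<theta> t) y)"
  unfolding smooth_functions_def
proof
  fix c assume c: "c \<in> A"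
  have o: "open (UNIV \<times> chart_image c :: (real \<times> _) set)" by (intro open_Times open_UNIV open_chart_image c)
  have fs: "smooth_on (UNIV \<times> chart_image c) (\<lambda>z. s (fst z))" if "smooth_on UNIV s" for s :: "real \<Rightarrow> real"
    by (rule smooth_on_compose[OF o open_UNIV _ smooth_on_linear[OF o bounded_linear_fst] that]) simp
  have "smooth_on (UNIV \<times> chart_image c) (\<lambda>z. (\<lambda>(t, x). H t (chart_inv c x)) (\<theta> (fst z), snd z))"
    by (rule smooth_on_compose[OF o o _ smooth_on_Pair[OF o fs[OF assms(2)] smooth_on_linear[OF o bounded_linear_snd]]])
      (use assms(1) c in \<open>auto simp: smooth_functions_def\<close>)
  then have "smooth_on (UNIV \<times> chart_image c) (\<lambda>z. r (fst z) * (\<lambda>(t, x). H t (chart_inv c x)) (\<theta> (fst z), snd z))"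
    by (rule smooth_on_mult[OF o fs[OF assms(3)]])
  then show "smooth_on (UNIV \<times> chart_image c) (\<lambda>(t, x). r t * H (\<theta> t) (chart_inv c x))"
    by (simp add: case_prod_unfold)
qed

lemma smooth_functions_add:
  assumes "smooth_functions A H" "smooth_functions A K"
  shows "smooth_functions A (\<lambda>t y. H t y + K t y)"
  unfolding smooth_functions_def
proof
  fix c assume c: "c \<in> A"
  have o: "open (UNIV \<times> chart_image c :: (real \<times> _) set)" by (intro open_Times open_UNIV open_chart_image c)
  show "smooth_on (UNIV \<times> chart_image c) (\<lambda>(t, x). H t (chart_inv c x) + K t (chart_inv c x))"
    using smooth_on_add[OF o, of "\<lambda>(t, x). H t (chart_inv c x)" "\<lambda>(t, x). K t (chart_inv c x)"] assms c
    unfolding smooth_functions_def by (simp add: case_prod_unfold)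
qed

end


section \<open>Symplectic linear algebra\<close>

text \<open>The values of a symplectic form on a symplectic basis, ordered in such a way that the vectors number
\<open>2 i\<close> and \<open>2 i + 1\<close> form a conjugate pair.\<close>

definition standard_form :: "nat \<Rightarrow> nat \<Rightarrow> real" where
  "standard_form i j = (if even i \<and> j = Suc i then 1 else if even j \<and> i = Suc j then - 1 else 0)"

lemma standard_form_swap: "standard_form i j = - standard_form j i"
  unfolding standard_form_def by auto

lemma sum_standard_form:
  assumes "j < 2 * k"
  shows "(\<Sum>i<2 * k. c i * standard_form j i) = (if even j then c (Suc j) else - c (j - 1))"
proof (cases "even j")
  case True
  then have "Suc j < 2 * k" using assms by presburger
  moreover have "(\<Sum>i<2 * k. c i * standard_form j i) = (\<Sum>i<2 * k. if i = Suc j then c i else 0)"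
    using True by (intro sum.cong) (auto simp: standard_form_def)
  ultimately show ?thesis using True by simp
next
  case False
  then have "j - 1 < 2 * k" "even (j - 1)" "j = Suc (j - 1)" using assms by auto
  moreover have "(\<Sum>i<2 * k. c i * standard_form j i) = (\<Sum>i<2 * k. if i = j - 1 then - c i else 0)"
    using False by (intro sum.cong) (auto simp: standard_form_def)
  ultimately show ?thesis using False by simp
qed

text \<open>A summand of \<open>wedge_power\<close> for the standard form can only be nonzero if the permutation maps the
last pair \<open>{2 m, 2 m + 1}\<close> to some pair. Exchanging the two members of a pair changes the sign of
the permutation and the sign of one factor; exchanging two pairs is an even permutation that
preserves the standard form. Such exchanges do not change the summand, and they reduce the claim to
permutations that fix the last pair, hence to \<open>m - 1\<close>.\<close>

lemma standard_form_term_nonneg: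
  assumes "p permutes {..<2 * m}"
  shows "of_int (sign p) * (\<Prod>i<m. standard_form (p (2 * i)) (p (Suc (2 * i)))) \<ge> 0"
  using assms
proof (induction m arbitrary: p)
  case (Suc m)
  let ?t = "\<lambda>p. of_int (sign p) * (\<Prod>i<Suc m. standard_form (p (2 * i)) (p (Suc (2 * i))))"
  have perm: "permutation p" if "p permutes {..<2 * Suc m}" for p
    using that permutation_permutes by blast
  have fixed: "?t q \<ge> 0" if q: "q permutes {..<2 * Suc m}" "q (2 * m) = 2 * m" "q (Suc (2 * m)) = Suc (2 * m)" for q
  proof -
    have "q permutes {..<2 * m}"
    proof (rule permutes_superset[OF q(1)])
      fix x assume "x \<in> {..<2 * Suc m} - {..<2 * m}"
      then have "x = 2 * m \<or> x = Suc (2 * m)" by auto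
      then show "q x = x" using q by auto
    qed
    from Suc.IH[OF this] show ?thesis using q by (simp add: standard_form_def)
  qed
  have even_start: "?t q \<ge> 0"
    if q: "q permutes {..<2 * Suc m}" "even (q (2 * m))" "q (Suc (2 * m)) = Suc (q (2 * m))" for q
  proof (cases "q (2 * m) = 2 * m")
    case True
    then show ?thesis using fixed q by auto
  next
    case False
    define k where "k = q (2 * m)"
    have kb: "k < 2 * Suc m" "even k" "k \<noteq> 2 * m" using permutes_in_image[OF q(1), of "2 * m"] q(2) False by (auto simp: k_def)
    then have kb': "k < 2 * m" "Suc k < 2 * m" by presburger+
    \<comment> \<open>This exchanges the pair \<open>{k, k + 1}\<close> with the last pair.\<close>
    define \<tau> where "\<tau> = Transposition.transpose k (2 * m) \<circ> Transposition.transpose (Suc k) (Suc (2 * m))"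
    have \<tau>p: "\<tau> permutes {..<2 * Suc m}"
      unfolding \<tau>_def using kb kb' by (intro permutes_compose permutes_swap_id) auto
    have \<tau>s: "sign \<tau> = 1"
      unfolding \<tau>_def using kb kb' by (subst sign_compose) (auto simp: sign_swap_id permutation_swap_id)
    have odd: "x \<noteq> Suc k" "x \<noteq> Suc (2 * m)" if "even x" for x using that kb by auto
    have \<tau>e: "\<tau> x = (if x = k then 2 * m else if x = 2 * m then k else x)" if "even x" for x
      using odd[OF that] kb unfolding \<tau>_def Transposition.transpose_def by auto
    have \<tau>Suc: "\<tau> (Suc x) = Suc (\<tau> x)" if "even x" for x
      unfolding \<tau>e[OF that] using odd[of "Suc x"] that kb odd[of k] odd[of "2 * m"]
      unfolding \<tau>_def Transposition.transpose_def by auto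
    have \<tau>even: "even (\<tau> x) \<longleftrightarrow> even x" for x
    proof (cases "even x")
      case True
      then show ?thesis using \<tau>e[OF True] kb by simp
    next
      case False
      then obtain y where "x = Suc y" "even y" by (metis even_Suc not0_implies_Suc even_zero)
      then show ?thesis using \<tau>Suc[of y] \<tau>e[of y] kb by simp
    qed
    have \<tau>inj: "\<tau> x = \<tau> y \<longleftrightarrow> x = y" for x y using permutes_inj[OF \<tau>p] by (auto simp: inj_def)
    have \<tau>f: "standard_form (\<tau> a) (\<tau> b) = standard_form a b" for a b
    proof -
      have *: "(even a \<and> \<tau> b = Suc (\<tau> a)) = (even a \<and> b = Suc a)" for a b by (metis \<tau>Suc \<tau>inj)
      show ?thesis unfolding standard_form_def \<tau>even * by (rule refl)
    qed
    have "?t (\<tau> \<circ> q) \<ge> 0"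
      using kb kb' q(3) by (intro fixed permutes_compose[OF q(1) \<tau>p]) (auto simp: k_def[symmetric] \<tau>_def Transposition.transpose_def)
    moreover have "sign (\<tau> \<circ> q) = sign q" using sign_compose[OF perm[OF \<tau>p] perm[OF q(1)]] \<tau>s by simp
    ultimately show ?thesis by (simp add: \<tau>f)
  qed
  show ?case
  proof (cases "standard_form (p (2 * m)) (p (Suc (2 * m))) = 0")
    case True
    then show ?thesis by simp
  next
    case False
    then consider "even (p (2 * m)) \<and> p (Suc (2 * m)) = Suc (p (2 * m))"
      | "even (p (Suc (2 * m))) \<and> p (2 * m) = Suc (p (Suc (2 * m)))"
      unfolding standard_form_def by (auto split: if_splits)
    then show ?thesis
    proof cases
      case 1
      then show ?thesis using even_start Suc.prems by blast
    next
      case 2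
      define q where "q = p \<circ> Transposition.transpose (2 * m) (Suc (2 * m))"
      have tp: "Transposition.transpose (2 * m) (Suc (2 * m)) permutes {..<2 * Suc m}" by (rule permutes_swap_id) auto
      have qp: "q permutes {..<2 * Suc m}" unfolding q_def by (rule permutes_compose[OF tp Suc.prems])
      have qv: "q (2 * m) = p (Suc (2 * m))" "q (Suc (2 * m)) = p (2 * m)" by (auto simp: q_def)
      have qs: "sign q = - sign p" unfolding q_def
        by (subst sign_compose) (auto simp: perm[OF Suc.prems] permutation_swap_id sign_swap_id)
      have qi: "q (2 * i) = p (2 * i)" "q (Suc (2 * i)) = p (Suc (2 * i))" if "i < m" for i
        using that by (auto simp: q_def Transposition.transpose_def)
      have "(\<Prod>i<m. standard_form (q (2 * i)) (q (Suc (2 * i)))) = (\<Prod>i<m. standard_form (p (2 * i)) (p (Suc (2 * i))))"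
        by (rule prod.cong) (auto simp: qi)
      then have "?t q = ?t p"
        using qs qv standard_form_swap[of "p (2 * m)" "p (Suc (2 * m))"] by simp
      moreover have "?t q \<ge> 0" using even_start[OF qp] 2 qv by metis
      ultimately show ?thesis by simp
    qed
  qed
qed simp

text \<open>No cancellation is possible in the defining sum, and the identity contributes \<open>1\<close>.\<close>

lemma wedge_power_standard_form_pos:
  assumes "\<And>i j. i < 2 * m \<Longrightarrow> j < 2 * m \<Longrightarrow> \<omega> (v i) (v j) = standard_form i j"
  shows "wedge_power \<omega> m v > 0"
proof -
  have fin: "finite {p. p permutes {..<2 * m}}" by (rule finite_permutations) simp
  have eq: "(\<Prod>i<m. \<omega> (v (p (2 * i))) (v (p (2 * i + 1)))) = (\<Prod>i<m. standard_form (p (2 * i)) (p (Suc (2 * i))))"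
    if "p permutes {..<2 * m}" for p
  proof (rule prod.cong)
    fix i assume "i \<in> {..<m}"
    then have "p (2 * i) < 2 * m" "p (Suc (2 * i)) < 2 * m"
      using permutes_in_image[OF that, of "2 * i"] permutes_in_image[OF that, of "Suc (2 * i)"] by auto
    then show "\<omega> (v (p (2 * i))) (v (p (2 * i + 1))) = standard_form (p (2 * i)) (p (Suc (2 * i)))"
      using assms by simp
  qed simp
  have "0 < (\<Sum>p | p permutes {..<2 * m}. of_int (sign p) * (\<Prod>i<m. standard_form (p (2 * i)) (p (Suc (2 * i)))))"
    by (rule sum_pos2[OF fin, of id])
      (auto simp: permutes_id standard_form_def[of "2 * i" for i] standard_form_term_nonneg)
  also have "\<dots> = (\<Sum>p | p permutes {..<2 * m}. of_int (sign p) * (\<Prod>i<m. \<omega> (v (p (2 * i))) (v (p (2 * i + 1)))))"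
    by (rule sum.cong) (use eq in auto)
  finally show ?thesis unfolding wedge_power_def by simp
qed

lemma bilinear_sum_left: "bilinear \<omega> \<Longrightarrow> \<omega> (sum f S) y = (\<Sum>i\<in>S. \<omega> (f i) y)"
  using linear_sum[of "\<lambda>x. \<omega> x y"] unfolding bilinear_def by (simp add: o_def)

lemma bilinear_sum_right: "bilinear \<omega> \<Longrightarrow> \<omega> x (sum f S) = (\<Sum>i\<in>S. \<omega> x (f i))"
  using linear_sum[of "\<omega> x"] unfolding bilinear_def by (simp add: o_def)

lemma alternating_swap:
  fixes \<omega> :: "'a::real_vector \<Rightarrow> 'a \<Rightarrow> real"
  assumes "bilinear \<omega>" "\<And>x. \<omega> x x = 0"
  shows "\<omega> x y = - \<omega> y x"
  using assms(2)[of "x + y"] assms(2)[of x] assms(2)[of y]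
  by (simp add: bilinear_ladd[OF assms(1)] bilinear_radd[OF assms(1)])

lemma functional_inner:
  fixes l :: "'a::euclidean_space \<Rightarrow> real"
  assumes "linear l"
  shows "l x = (\<Sum>e\<in>Basis. l e *\<^sub>R e) \<bullet> x"
proof -
  have "l x = l (\<Sum>e\<in>Basis. (x \<bullet> e) *\<^sub>R e)" by (simp add: euclidean_representation)
  also have "\<dots> = (\<Sum>e\<in>Basis. (x \<bullet> e) * l e)" by (simp add: linear_sum[OF assms] linear_scale[OF assms])
  finally show ?thesis by (simp add: inner_sum_right inner_commute[of _ x] mult.commute)
qed

lemma functionals_common_zero:
  fixes l :: "nat \<Rightarrow> 'a::euclidean_space \<Rightarrow> real"
  assumes "\<And>i. i < k \<Longrightarrow> linear (l i)" "k < DIM('a)"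
  obtains u where "u \<noteq> 0" "\<And>i. i < k \<Longrightarrow> l i u = 0"
proof -
  let ?b = "\<lambda>i. \<Sum>e\<in>Basis. l i e *\<^sub>R e"
  have "dim (?b ` {..<k}) \<le> card (?b ` {..<k})" by (intro dim_le_card') simp
  also have "\<dots> \<le> k" using card_image_le[of "{..<k}" ?b] by simp
  finally have "dim (?b ` {..<k}) < DIM('a)" using assms(2) by simp
  then obtain u where u: "u \<noteq> 0" "\<And>y. y \<in> span (?b ` {..<k}) \<Longrightarrow> orthogonal u y"
    using orthogonal_to_subspace_exists by blast
  have "l i u = 0" if "i < k" for i
    using functional_inner[OF assms(1)[OF that], of u] u(2)[of "?b i"] that
    by (simp add: span_base orthogonal_def inner_commute)
  with u(1) that show thesis by blast
qed

locale symplectic_form =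
  fixes \<omega> :: "'a::euclidean_space \<Rightarrow> 'a \<Rightarrow> real"
  assumes bil: "bilinear \<omega>" and alt: "\<omega> x x = 0" and nondeg: "x \<noteq> 0 \<Longrightarrow> \<exists>y. \<omega> x y \<noteq> 0"
begin

text \<open>A partial symplectic basis \<open>v\<close> with fewer than \<open>DIM('a)\<close> members is extended by a vector \<open>u \<noteq> 0\<close> that
is orthogonal to it with respect to \<open>\<omega>\<close>, and by a vector \<open>w\<close> with \<open>\<omega> u w = 1\<close>, from which a combination
of \<open>v\<close> is subtracted in order to make it orthogonal to \<open>v\<close> as well. The bound on \<open>k\<close> exceeds the
dimension, so that together with the next lemma the dimension is seen to be even.\<close>

lemma symplectic_system_exists:
  "2 * k < DIM('a) + 2 \<Longrightarrow> \<exists>v. \<forall>i<2 * k. \<forall>j<2 * k. \<omega> (v i) (v j) = standard_form i j"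
proof (induction k)
  case (Suc k)
  then obtain v where v: "\<And>i j. i < 2 * k \<Longrightarrow> j < 2 * k \<Longrightarrow> \<omega> (v i) (v j) = standard_form i j" by auto
  have "linear (\<omega> (v i))" for i using bil unfolding bilinear_def by blast
  then obtain u where u: "u \<noteq> 0" "\<And>i. i < 2 * k \<Longrightarrow> \<omega> (v i) u = 0"
    using functionals_common_zero[of "2 * k" "\<lambda>i. \<omega> (v i)"] Suc.prems by auto
  obtain w0 where "\<omega> u w0 \<noteq> 0" using nondeg u(1) by blast
  then obtain w where w: "\<omega> u w = 1"
    using bilinear_rmul[OF bil, of u "1 / \<omega> u w0" w0] by auto
  \<comment> \<open>The coefficients for which \<open>w'\<close> below is orthogonal to all \<open>v j\<close>.\<close>
  define c where "c i = (if odd i then \<omega> (v (i - 1)) w else - \<omega> (v (Suc i)) w)" for i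
  define w' where "w' = w - (\<Sum>i<2 * k. c i *\<^sub>R v i)"
  have su: "\<omega> u (v i) = 0" if "i < 2 * k" for i
    using u(2)[OF that] alternating_swap[OF bil alt, of u "v i"] by simp
  have uw: "\<omega> u w' = 1"
    unfolding w'_def using w su by (simp add: bilinear_rsub[OF bil] bilinear_sum_right[OF bil] bilinear_rmul[OF bil])
  have vw: "\<omega> (v j) w' = 0" if "j < 2 * k" for j
  proof -
    have "\<omega> (v j) w' = \<omega> (v j) w - (\<Sum>i<2 * k. c i * standard_form j i)"
      unfolding w'_def using v that by (simp add: bilinear_rsub[OF bil] bilinear_sum_right[OF bil] bilinear_rmul[OF bil])
    then show ?thesis unfolding sum_standard_form[OF that] c_def by auto
  qed
  define v' where "v' = v(2 * k := u, Suc (2 * k) := w')"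
  have sw: "\<omega> w' (v j) = 0" if "j < 2 * k" for j using vw[OF that] alternating_swap[OF bil alt, of w' "v j"] by simp
  have wu: "\<omega> w' u = -1" using uw alternating_swap[OF bil alt, of w' u] by simp
  have "\<omega> (v' i) (v' j) = standard_form i j" if ij: "i < 2 * Suc k" "j < 2 * Suc k" for i j
  proof -
    have "i < 2 * k \<or> i = 2 * k \<or> i = Suc (2 * k)" "j < 2 * k \<or> j = 2 * k \<or> j = Suc (2 * k)" using ij by auto
    moreover have "standard_form i j = 0" if "i < 2 * k" "j \<ge> 2 * k" using that unfolding standard_form_def by (auto; presburger)
    moreover have "standard_form i j = 0" if "j < 2 * k" "i \<ge> 2 * k" using that unfolding standard_form_def by (auto; presburger)
    ultimately show ?thesis
      using v u su uw vw sw wu alt by (auto simp: v'_def standard_form_def)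
  qed
  then show ?case by blast
qed simp

text \<open>The members of a partial symplectic basis are linearly independent, because pairing a linear
combination with the conjugate of a member isolates the coefficient of that member.\<close>

lemma symplectic_system_bound:
  assumes v: "\<And>i j. i < 2 * k \<Longrightarrow> j < 2 * k \<Longrightarrow> \<omega> (v i) (v j) = standard_form i j"
  shows "2 * k \<le> DIM('a)"
proof -
  have inj: "inj_on v {..<2 * k}"
  proof (rule inj_onI)
    fix i j assume ij: "i \<in> {..<2 * k}" "j \<in> {..<2 * k}" "v i = v j"
    define n where "n = (if even i then Suc i else i - 1)"
    have n: "n < 2 * k" using ij unfolding n_def by (auto; presburger)
    have "standard_form i n \<noteq> 0" unfolding n_def standard_form_def by auto
    then have "standard_form j n \<noteq> 0" using v[of i n] v[of j n] n ij by auto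
    moreover have "i = j" if "even i" "standard_form j (Suc i) \<noteq> 0" using that unfolding standard_form_def by (auto split: if_splits)
    moreover have "i = j" if "odd i" "standard_form j (i - 1) \<noteq> 0"
      using that by (cases i) (auto simp: standard_form_def split: if_splits)
    ultimately show "i = j" unfolding n_def by (auto split: if_splits)
  qed
  have "independent (v ` {..<2 * k})"
  proof (rule independent_if_scalars_zero)
    fix f x assume s: "(\<Sum>x\<in>v ` {..<2 * k}. f x *\<^sub>R x) = 0" and x: "x \<in> v ` {..<2 * k}"
    obtain i where i: "i < 2 * k" "x = v i" using x by auto
    define n where "n = (if even i then Suc i else i - 1)"
    have n: "n < 2 * k" using i unfolding n_def by (auto; presburger)
    have "0 = \<omega> (v n) (\<Sum>i<2 * k. f (v i) *\<^sub>R v i)"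
      using s sum.reindex[OF inj, of "\<lambda>x. f x *\<^sub>R x"] by (simp add: bilinear_rzero[OF bil])
    also have "\<dots> = (\<Sum>i<2 * k. f (v i) * standard_form n i)"
      using v n by (simp add: bilinear_sum_right[OF bil] bilinear_rmul[OF bil])
    also have "\<dots> = (if even n then f (v (Suc n)) else - f (v (n - 1)))"
      by (rule sum_standard_form[OF n])
    finally show "f x = 0" unfolding n_def i(2) by (auto split: if_splits)
  qed simp
  then have "card (v ` {..<2 * k}) \<le> DIM('a)" using independent_bound by blast
  then show ?thesis by (simp add: card_image[OF inj])
qed

lemma symplectic_basis:
  obtains v where "DIM('a) = 2 * (DIM('a) div 2)"
    "\<And>i j. i < DIM('a) \<Longrightarrow> j < DIM('a) \<Longrightarrow> \<omega> (v i) (v j) = standard_form i j"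
proof -
  let ?n = "DIM('a)"
  let ?k = "(?n + 1) div 2"
  have k: "2 * ?k < ?n + 2" by presburger
  obtain v where v: "\<And>i j. i < 2 * ?k \<Longrightarrow> j < 2 * ?k \<Longrightarrow> \<omega> (v i) (v j) = standard_form i j"
    using symplectic_system_exists[of ?k] k by blast
  have "2 * ?k \<le> ?n" by (rule symplectic_system_bound) (rule v)
  then have "?n = 2 * (?n div 2)" "2 * ?k = ?n" by presburger+
  with v that show thesis by metis
qed

lemma represent_functional:
  assumes "linear l"
  shows "\<exists>!X. \<forall>v. \<omega> X v = l v"
proof -
  have lin: "linear (\<lambda>X. \<Sum>e\<in>Basis. \<omega> X e *\<^sub>R e)"
    by (intro linearI) (simp_all add: bilinear_ladd[OF bil] bilinear_lmul[OF bil] scaleR_left_distrib sum.distrib scaleR_sum_right)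
  have r: "\<omega> X v = (\<Sum>e\<in>Basis. \<omega> X e *\<^sub>R e) \<bullet> v" for X v
    using functional_inner[of "\<omega> X" v] bil unfolding bilinear_def by blast
  have "inj (\<lambda>X. \<Sum>e\<in>Basis. \<omega> X e *\<^sub>R e)"
    unfolding linear_injective_0[OF lin] using nondeg r by (metis inner_zero_left)
  then have "surj (\<lambda>X. \<Sum>e\<in>Basis. \<omega> X e *\<^sub>R e)" by (rule linear_injective_imp_surjective[OF lin _ refl])
  then obtain X where "(\<Sum>e\<in>Basis. l e *\<^sub>R e) = (\<Sum>e\<in>Basis. \<omega> X e *\<^sub>R e)" unfolding surj_def by blast
  then have X: "\<omega> X v = l v" for v using r[of X v] functional_inner[OF assms, of v] by simp
  have "Y = X" if "\<forall>v. \<omega> Y v = l v" for Y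
    using nondeg[of "Y - X"] X that by (auto simp: bilinear_lsub[OF bil])
  with X show ?thesis by blast
qed

end

lemma coord_frame_bij: "bij_betw (\<lambda>i. sorted_list_of_set (UNIV::'n set) ! i) {..<CARD('n::{finite,wellorder})} UNIV"
  using bij_betw_nth[of "sorted_list_of_set (UNIV::'n set)" "{..<CARD('n)}" UNIV] by auto

lemma prod_pairs:
  fixes f :: "nat \<Rightarrow> 'a::comm_monoid_mult"
  shows "(\<Prod>j<2 * m. f j) = (\<Prod>i<m. f (2 * i) * f (Suc (2 * i)))"
  by (induction m) (auto simp: algebra_simps)

text \<open>The determinant of a matrix indexed by a finite type, computed from an enumeration \<open>b\<close> of the indices.\<close>

lemma det_reindex:
  fixes X :: "real ^ 'n ^ 'n" and b :: "nat \<Rightarrow> 'n"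
  assumes b: "bij_betw b {..<n} UNIV"
  shows "(\<Sum>p | p permutes {..<n}. of_int (sign p) * (\<Prod>j<n. X $ b j $ b (p j))) = det X"
proof -
  have inj: "inj_on b {..<n}" using b bij_betw_def by blast
  have inv: "inv_into {..<n} b (b j) = j" if "j < n" for j using inv_into_f_f[OF inj] that by auto
  have eq: "(\<lambda>x. if x \<in> UNIV then b (p (inv_into {..<n} b x)) else x) = map_permutation {..<n} b p" for p
    using b unfolding map_permutation_def bij_betw_def restrict_id_def by auto
  have mp: "map_permutation {..<n} b p i = b (p (inv_into {..<n} b i))" for p i by (simp add: eq[symmetric])
  have "det X = (\<Sum>p | p permutes {..<n}. of_int (sign (map_permutation {..<n} b p)) *
      (\<Prod>i\<in>UNIV. X $ i $ (map_permutation {..<n} b p i)))"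
    unfolding det_def using sum.reindex_bij_betw[OF bij_betw_permutations[OF b], of "\<lambda>p. of_int (sign p) * (\<Prod>i\<in>UNIV. X $ i $ p i)"]
    unfolding eq by (simp add: mp)
  also have "\<dots> = (\<Sum>p | p permutes {..<n}. of_int (sign p) * (\<Prod>j<n. X $ b j $ b (p j)))"
  proof (rule sum.cong, rule refl)
    fix p assume "p \<in> {p. p permutes {..<n}}"
    then have p: "p permutes {..<n}" by simp
    have "(\<Prod>i\<in>UNIV. X $ i $ (map_permutation {..<n} b p i)) = (\<Prod>j<n. X $ b j $ (map_permutation {..<n} b p (b j)))"
      using prod.reindex_bij_betw[OF b, of "\<lambda>i. X $ i $ (map_permutation {..<n} b p i)"] by simp
    also have "\<dots> = (\<Prod>j<n. X $ b j $ b (p j))"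
      by (rule prod.cong) (auto simp: eq[symmetric] inv)
    finally show "of_int (sign (map_permutation {..<n} b p)) * (\<Prod>i\<in>UNIV. X $ i $ (map_permutation {..<n} b p i))
      = of_int (sign p) * (\<Prod>j<n. X $ b j $ b (p j))"
      using sign_map_permutation[OF inj p] by simp
  qed
  finally show ?thesis by simp
qed

text \<open>A Cauchy-Binet argument. Multilinear expansion of \<open>wedge_power\<close> leads to a sum over all choices \<open>r\<close>
of matrix rows, in which each choice contributes the determinant of the matrix formed from the chosen
rows. It vanishes if a row is repeated, and otherwise it is the determinant of \<open>T\<close> up to the sign
\<open>\<epsilon>\<close> of the choice. The remaining factor \<open>K\<close> does not depend on \<open>T\<close>, and \<open>T = id\<close> identifies it.\<close>

lemma wedge_power_linear_image:
  fixes \<omega> :: "real ^ 'n::{finite,wellorder} \<Rightarrow> real ^ 'n::{finite,wellorder} \<Rightarrow> real" and L :: "real ^ 'n::{finite,wellorder} \<Rightarrow> real ^ 'n::{finite,wellorder}"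
  assumes bil: "bilinear \<omega>" and L: "linear L" and n: "CARD('n) = 2 * m"
  shows "wedge_power \<omega> m (\<lambda>i. L (coord_frame i)) = det (matrix L) * wedge_power \<omega> m coord_frame"
proof -
  define b :: "nat \<Rightarrow> 'n" where "b i = sorted_list_of_set UNIV ! i" for i
  have b: "bij_betw b {..<2 * m} UNIV" using coord_frame_bij[where 'n='n] unfolding b_def n .
  have inj: "inj_on b {..<2 * m}" using b bij_betw_def by blast
  have cf: "coord_frame j = axis (b j) 1" for j unfolding coord_frame_def b_def ..
  define B :: "'n \<Rightarrow> 'n \<Rightarrow> real" where "B a c = \<omega> (axis a 1) (axis c 1)" for a c
  define s :: "(nat \<Rightarrow> 'n \<times> 'n) \<Rightarrow> nat \<Rightarrow> 'n" where "s r j = (if even j then fst (r (j div 2)) else snd (r (j div 2)))" for r j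
  define \<tau> where "\<tau> r k = s r (inv_into {..<2 * m} b k)" for r k
  define \<epsilon> :: "('n \<Rightarrow> 'n) \<Rightarrow> real" where "\<epsilon> t = (if t permutes UNIV then of_int (sign t) else 0)" for t
  define R where "R = Pi\<^sub>E {..<m} (\<lambda>_. UNIV :: ('n \<times> 'n) set)"
  define K where "K = (\<Sum>r\<in>R. (\<Prod>i<m. B (fst (r i)) (snd (r i))) * \<epsilon> (\<tau> r))"
  have main: "wedge_power \<omega> m (\<lambda>i. T (coord_frame i)) = det (matrix T) * K / 2 ^ m" if T: "linear T" for T
  proof -
    define M where "M a j = T (coord_frame j) $ a" for a j
    have Tc: "T (coord_frame j) = (\<Sum>a\<in>UNIV. M a j *\<^sub>R axis a 1)" for j
      unfolding M_def using basis_expansion[of "T (coord_frame j)"] by (simp add: scalar_mult_eq_scaleR)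
    have wM: "\<omega> (T (coord_frame x)) (T (coord_frame y)) = (\<Sum>z\<in>UNIV. M (fst z) x * M (snd z) y * B (fst z) (snd z))" for x y
    proof -
      have "\<omega> (T (coord_frame x)) (T (coord_frame y)) = (\<Sum>c\<in>UNIV. \<Sum>a\<in>UNIV. M a x * M c y * B a c)"
        unfolding Tc bilinear_sum_left[OF bil] bilinear_sum_right[OF bil] bilinear_lmul[OF bil] bilinear_rmul[OF bil]
        by (simp add: B_def sum_distrib_left algebra_simps)
      also have "\<dots> = (\<Sum>z\<in>UNIV \<times> UNIV. M (fst z) x * M (snd z) y * B (fst z) (snd z))"
        by (subst sum.swap) (simp add: sum.cartesian_product case_prod_unfold)
      finally show ?thesis by simp
    qed
    have e: "(\<Prod>i<m. \<omega> (T (coord_frame (p (2 * i)))) (T (coord_frame (p (2 * i + 1))))) =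
        (\<Sum>r\<in>R. (\<Prod>i<m. B (fst (r i)) (snd (r i))) * (\<Prod>j<2 * m. M (s r j) (p j)))" for p
    proof -
      have "(\<Prod>i<m. \<omega> (T (coord_frame (p (2 * i)))) (T (coord_frame (p (2 * i + 1))))) =
        (\<Sum>r\<in>R. \<Prod>i<m. M (fst (r i)) (p (2 * i)) * M (snd (r i)) (p (2 * i + 1)) * B (fst (r i)) (snd (r i)))"
        unfolding wM R_def by (rule prod_sum_PiE) simp_all
      also have "\<dots> = (\<Sum>r\<in>R. (\<Prod>i<m. B (fst (r i)) (snd (r i))) * (\<Prod>j<2 * m. M (s r j) (p j)))"
        unfolding prod_pairs by (simp add: s_def prod.distrib mult.commute)
      finally show ?thesis .
    qed
    have D: "(\<Sum>p | p permutes {..<2 * m}. of_int (sign p) * (\<Prod>j<2 * m. M (s r j) (p j))) = det (matrix T) * \<epsilon> (\<tau> r)" for r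
    proof -
      have "(\<Sum>p | p permutes {..<2 * m}. of_int (sign p) * (\<Prod>j<2 * m. M (s r j) (p j))) =
        (\<Sum>p | p permutes {..<2 * m}. of_int (sign p) * (\<Prod>j<2 * m. (\<chi> k. matrix T $ \<tau> r k) $ b j $ b (p j)))"
        by (intro sum.cong refl arg_cong2[of _ _ _ _ "(*)"] prod.cong)
          (auto simp: \<tau>_def inv_into_f_f[OF inj] M_def matrix_def cf)
      also have "\<dots> = det (\<chi> k. matrix T $ \<tau> r k)" by (rule det_reindex[OF b])
      also have "\<dots> = det (matrix T) * \<epsilon> (\<tau> r)"
      proof (cases "\<tau> r permutes UNIV")
        case True
        then show ?thesis using det_permute_rows[OF True, of "matrix T"] by (simp add: \<epsilon>_def)
      next
        case False
        then have "\<not> inj (\<tau> r)"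
          using permutes_bij bij_imp_permutes[of "\<tau> r" UNIV] finite_UNIV_inj_surj[of "\<tau> r"] by (auto simp: bij_def)
        then obtain i j where "i \<noteq> j" "\<tau> r i = \<tau> r j" by (auto simp: inj_def)
        then have "det (\<chi> k. matrix T $ \<tau> r k) = 0"
          by (intro det_identical_rows[of i j]) (auto simp: row_def)
        then show ?thesis using False by (simp add: \<epsilon>_def)
      qed
      finally show ?thesis .
    qed
    have "(\<Sum>p | p permutes {..<2 * m}. of_int (sign p) * (\<Prod>i<m. \<omega> (T (coord_frame (p (2 * i)))) (T (coord_frame (p (2 * i + 1))))))
      = (\<Sum>r\<in>R. \<Sum>p | p permutes {..<2 * m}. (\<Prod>i<m. B (fst (r i)) (snd (r i))) * (of_int (sign p) * (\<Prod>j<2 * m. M (s r j) (p j))))"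
      unfolding e sum_distrib_left by (subst sum.swap) (simp add: algebra_simps)
    also have "\<dots> = det (matrix T) * K"
      unfolding sum_distrib_left[symmetric] D K_def by (simp add: sum_distrib_left algebra_simps)
    finally show ?thesis unfolding wedge_power_def by simp
  qed
  have "matrix (\<lambda>x::real^'n::{finite,wellorder}. x) = mat 1" by (rule matrix_id_mat_1[unfolded id_def])
  then have "wedge_power \<omega> m coord_frame = K / 2 ^ m" using main[of "\<lambda>x. x"] linear_id by (simp add: id_def)
  then show ?thesis using main[OF L] by simp
qed

text \<open>The linear map that takes the standard basis to a symplectic basis transforms the number in question
into a positive one.\<close>

lemma wedge_power_nonzero:
  fixes \<omega> :: "real ^ 'n::{finite,wellorder} \<Rightarrow> real ^ 'n::{finite,wellorder} \<Rightarrow> real"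
  assumes "symplectic_form \<omega>"
  shows "CARD('n) = 2 * (CARD('n) div 2)" and "wedge_power \<omega> (CARD('n) div 2) coord_frame \<noteq> 0"
proof -
  interpret symplectic_form \<omega> by fact
  define m where "m = CARD('n) div 2"
  obtain v where n: "CARD('n) = 2 * m"
    and v: "\<And>i j. i < CARD('n) \<Longrightarrow> j < CARD('n) \<Longrightarrow> \<omega> (v i) (v j) = standard_form i j"
    using symplectic_basis unfolding m_def by auto
  define b :: "nat \<Rightarrow> 'n" where "b i = sorted_list_of_set UNIV ! i" for i
  have b: "bij_betw b {..<2 * m} UNIV" using coord_frame_bij[where 'n='n] unfolding b_def n .
  have inj: "inj_on b {..<2 * m}" using b bij_betw_def by blast
  define L where "L x = (\<Sum>c\<in>UNIV. x $ c *\<^sub>R v (inv_into {..<2 * m} b c))" for x :: "real ^ 'n::{finite,wellorder}"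
  have L: "linear L" unfolding L_def
    by (intro linearI) (simp_all add: scaleR_left_distrib sum.distrib scaleR_sum_right)
  have Lv: "L (coord_frame i) = v i" if "i < 2 * m" for i
  proof -
    have "L (coord_frame i) = (\<Sum>c\<in>UNIV. if c = b i then v (inv_into {..<2 * m} b c) else 0)"
      unfolding L_def coord_frame_def b_def[symmetric] by (rule sum.cong) (auto simp: axis_def)
    then show ?thesis using that by (simp add: inv_into_f_f[OF inj])
  qed
  have "wedge_power \<omega> m (\<lambda>i. L (coord_frame i)) > 0"
    by (rule wedge_power_standard_form_pos) (simp add: Lv v n)
  then show "wedge_power \<omega> (CARD('n) div 2) coord_frame \<noteq> 0"
    unfolding wedge_power_linear_image[OF bil L n] m_def[symmetric] by auto
  show "CARD('n) = 2 * (CARD('n) div 2)" using n by simp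
qed


section \<open>The symplectic volume\<close>

text \<open>The change of variables theorem for absolutely integrable functions says that one of the two integrals
has the finite value \<open>b\<close> if and only if the other one has. Since this holds for all \<open>b\<close>, the two
integrals agree even when they are infinite.\<close>

lemma nn_integral_change_of_variables:
  fixes g :: "real ^ 'n::{finite,wellorder} \<Rightarrow> real ^ 'n::{finite,wellorder}" and \<rho>1 \<rho>2 :: "real ^ 'n::{finite,wellorder} \<Rightarrow> real"
  assumes S: "S \<in> sets borel"
    and der: "\<And>x. x \<in> S \<Longrightarrow> (g has_derivative g' x) (at x)" and inj: "inj_on g S"
    and m1: "(\<lambda>x. \<rho>1 x * indicator S x) \<in> borel_measurable borel"
    and m2: "(\<lambda>x. \<rho>2 x * indicator (g ` S) x) \<in> borel_measurable borel"
    and nn: "\<And>x. 0 \<le> \<rho>1 x" "\<And>x. 0 \<le> \<rho>2 x"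
    and eq: "\<And>x. x \<in> S \<Longrightarrow> \<rho>1 x = \<bar>det (matrix (g' x))\<bar> * \<rho>2 (g x)"
  shows "(\<integral>\<^sup>+x\<in>S. ennreal (\<rho>1 x) \<partial>lborel) = (\<integral>\<^sup>+x\<in>g ` S. ennreal (\<rho>2 x) \<partial>lborel)"
proof -
  have fin: "(\<integral>\<^sup>+x\<in>T. ennreal (\<phi> x) \<partial>lborel) = ennreal b \<longleftrightarrow> \<phi> absolutely_integrable_on T \<and> integral T \<phi> = b"
    if m: "(\<lambda>x. \<phi> x * indicator T x) \<in> borel_measurable borel" and nn: "\<And>x. 0 \<le> \<phi> x" and b: "0 \<le> b"
    for \<phi> :: "real ^ 'n::{finite,wellorder} \<Rightarrow> real" and T b
  proof -
    have e: "(\<integral>\<^sup>+x\<in>T. ennreal (\<phi> x) \<partial>lborel) = (\<integral>\<^sup>+x. ennreal (\<phi> x * indicator T x) \<partial>lborel)"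
      by (rule nn_integral_cong) (auto simp: indicator_def)
    have "(\<phi> absolutely_integrable_on T \<and> integral T \<phi> = b) \<longleftrightarrow> (\<phi> has_integral b) T"
      using absolutely_integrable_on_iff_nonneg[of T \<phi>] nn by (auto simp: has_integral_iff)
    also have "\<dots> \<longleftrightarrow> ((\<lambda>x. \<phi> x * indicator T x) has_integral b) UNIV"
      unfolding has_integral_restrict_UNIV[of T \<phi>, symmetric] indicator_def
      by (intro iffI; elim has_integral_eq[rotated]) auto
    also have "\<dots> \<longleftrightarrow> (\<integral>\<^sup>+x. ennreal (\<phi> x * indicator T x) \<partial>lborel) = ennreal b"
      using nn_integral_has_integral[OF m _ _ b] nn_integral_has_integral_lborel[OF m] nn by auto
    finally show ?thesis unfolding e by blast
  qed
  have der': "(g has_derivative g' x) (at x within S)" if "x \<in> S" for x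
    using der[OF that] by (rule has_derivative_at_withinI)
  have *: "(\<integral>\<^sup>+x\<in>S. ennreal (\<rho>1 x) \<partial>lborel) = ennreal b \<longleftrightarrow> (\<integral>\<^sup>+x\<in>g ` S. ennreal (\<rho>2 x) \<partial>lborel) = ennreal b"
    if b: "0 \<le> b" for b
  proof -
    have "(\<rho>1 absolutely_integrable_on S \<and> integral S \<rho>1 = b) \<longleftrightarrow>
      ((\<lambda>x. \<bar>det (matrix (g' x))\<bar> * \<rho>2 (g x)) absolutely_integrable_on S \<and>
        integral S (\<lambda>x. \<bar>det (matrix (g' x))\<bar> * \<rho>2 (g x)) = b)"
      by (intro conj_cong arg_cong2[where f="(=)"] integral_cong set_integrable_cong refl)
        (auto simp: eq)
    also have "\<dots> \<longleftrightarrow> (\<rho>2 absolutely_integrable_on g ` S \<and> integral (g ` S) \<rho>2 = b)"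
      using has_absolute_integral_change_of_variables[of S g g' "\<lambda>x. vec (\<rho>2 x) :: real ^ 1" "vec b"]
        S der' inj
      unfolding absolutely_integrable_on_1_iff integral_on_1_eq
      by (auto simp: vec_eq_iff)
    finally show ?thesis using fin[OF m1 nn(1) b] fin[OF m2 nn(2) b] by simp
  qed
  show ?thesis
    by (cases "\<integral>\<^sup>+x\<in>S. ennreal (\<rho>1 x) \<partial>lborel" rule: ennreal_cases;
        cases "\<integral>\<^sup>+x\<in>g ` S. ennreal (\<rho>2 x) \<partial>lborel" rule: ennreal_cases)
      (metis * ennreal_neq_top)+
qed

locale symplectic_manifold =
  fixes A :: "('y::{t2_space,second_countable_topology}, 'n::{finite,wellorder}) chart set"
    and \<Omega> :: "('y, 'n) two_form"
  assumes csm: "closed_connected_symplectic_manifold A \<Omega>"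
begin

sublocale smooth_manifold A
  using csm unfolding closed_connected_symplectic_manifold_def by unfold_locales blast

lemma compact_manifold: "compact (UNIV :: 'y set)" and connected_manifold: "connected (UNIV :: 'y set)"
  and form_smooth: "c \<in> A \<Longrightarrow> smooth_on (chart_image c) (\<lambda>x. \<Omega> c x v w)"
  and form_id: "preserves_form A \<Omega> id"
  using csm unfolding closed_connected_symplectic_manifold_def smooth_two_form_def by blast+

lemma symplectic_form_at: "c \<in> A \<Longrightarrow> x \<in> chart_image c \<Longrightarrow> symplectic_form (\<Omega> c x)"
  using csm unfolding closed_connected_symplectic_manifold_def smooth_two_form_def nondegenerate_form_def
  symplectic_form_def by blast

abbreviation \<rho> :: "('y, 'n) chart \<Rightarrow> real ^ 'n::{finite,wellorder} \<Rightarrow> real" where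
  "\<rho> \<equiv> symplectic_density \<Omega>"

lemma density_pos: "c \<in> A \<Longrightarrow> x \<in> chart_image c \<Longrightarrow> \<rho> c x > 0"
  unfolding symplectic_density_def using wedge_power_nonzero(2)[OF symplectic_form_at] by simp

lemma density_nonneg: "\<rho> c x \<ge> 0"
  unfolding symplectic_density_def by simp

lemma density_continuous: "c \<in> A \<Longrightarrow> continuous_on (chart_image c) (\<rho> c)"
  unfolding symplectic_density_def wedge_power_def
  by (intro continuous_intros smooth_on_imp_continuous_on[OF form_smooth]) auto

text \<open>The top power of a two-form is a volume form, hence it transforms with the Jacobian determinant.\<close>

lemma density_transform:
  assumes f: "smooth_map A f" "preserves_form A \<Omega> f" and cd: "c \<in> A" "d \<in> A" and x: "x \<in> coord_dom c d f"
  shows "\<rho> c x = \<bar>det (matrix (coord_deriv c d f x))\<bar> * \<rho> d (coord_rep c d f x)"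
proof -
  let ?m = "CARD('n) div 2" let ?D = "coord_deriv c d f x" let ?z = "coord_rep c d f x"
  have z: "symplectic_form (\<Omega> d ?z)" using symplectic_form_at[OF cd(2)] coord_rep_mem[OF x] .
  then have bil: "bilinear (\<Omega> d ?z)" unfolding symplectic_form_def by blast
  have D: "linear ?D" using coord_rep_has_derivative[OF f(1) cd x] has_derivative_linear by blast
  have "\<Omega> c x v w = \<Omega> d ?z (?D v) (?D w)" for v w
    using f(2) cd x unfolding preserves_form_def by metis
  then have "wedge_power (\<Omega> c x) ?m coord_frame = wedge_power (\<Omega> d ?z) ?m (\<lambda>i. ?D (coord_frame i))"
    unfolding wedge_power_def by simp
  also have "\<dots> = det (matrix ?D) * wedge_power (\<Omega> d ?z) ?m coord_frame"
    by (rule wedge_power_linear_image[OF bil D wedge_power_nonzero(1)[OF z]])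
  finally show ?thesis unfolding symplectic_density_def by (simp add: abs_mult)
qed

lemma density_measurable:
  assumes c: "c \<in> A"
  shows "(\<lambda>x. \<rho> c x * indicator (chart_image c) x) \<in> borel_measurable borel"
  using borel_measurable_continuous_on_indicator[OF _ density_continuous[OF c]] open_chart_image[OF c]
  by (simp add: mult.commute)

lemma chart_borel_image:
  assumes c: "c \<in> A" and B: "B \<in> sets borel" "B \<subseteq> fst c"
  shows "snd c ` B \<in> sets borel"
proof -
  have "chart_inv c \<in> borel_measurable (restrict_space borel (chart_image c))"
    by (rule borel_measurable_continuous_on_restrict[OF continuous_chart_inv[OF c]])
  from measurable_sets[OF this B(1)]
  have "chart_inv c -` B \<inter> chart_image c \<in> sets (restrict_space borel (chart_image c))"
    by (simp add: space_restrict_space)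
  then have "chart_inv c -` B \<inter> chart_image c \<in> sets borel"
    by (subst (asm) sets_restrict_space_iff) (use open_chart_image[OF c] in auto)
  moreover have "chart_inv c -` B \<inter> chart_image c = snd c ` B"
  proof (intro equalityI subsetI)
    fix x assume "x \<in> chart_inv c -` B \<inter> chart_image c"
    then have "chart_inv c x \<in> B" "snd c (chart_inv c x) = x" using chart_chart_inv[OF c] by auto
    then show "x \<in> snd c ` B" by (metis imageI)
  next
    fix x assume "x \<in> snd c ` B"
    then obtain y where y: "y \<in> B" "x = snd c y" by blast
    then have "y \<in> fst c" using B(2) by blast
    then show "x \<in> chart_inv c -` B \<inter> chart_image c"
      using y chart_inv_chart[OF c] chart_mem[of y c] by simp
  qed
  ultimately show ?thesis by simp
qed

definition chart_volume :: "('y, 'n) chart \<Rightarrow> 'y set \<Rightarrow> ennreal" where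
  "chart_volume c B = (\<integral>\<^sup>+x\<in>snd c ` B. ennreal (\<rho> c x) \<partial>lborel)"

lemma chart_volume_eq_emeasure:
  assumes c: "c \<in> A" and B: "B \<in> sets borel" "B \<subseteq> fst c"
  shows "chart_volume c B = emeasure (density lborel (\<lambda>x. ennreal (\<rho> c x * indicator (chart_image c) x))) (snd c ` B)"
proof -
  have "snd c ` B \<subseteq> chart_image c" using B(2) unfolding chart_image_def by blast
  then show ?thesis
    unfolding chart_volume_def using chart_borel_image[OF assms] density_measurable[OF c]
    by (subst emeasure_density) (auto intro!: nn_integral_cong simp: indicator_def subset_iff)
qed

lemma chart_volume_empty: "chart_volume c {} = 0"
  unfolding chart_volume_def by simp

lemma chart_volume_suminf:
  assumes c: "c \<in> A" and B: "\<And>i. B i \<in> sets borel" "\<And>i. B i \<subseteq> fst c" "disjoint_family B"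
  shows "(\<Sum>i. chart_volume c (B i)) = chart_volume c (\<Union>i. B i)"
proof -
  have "disjoint_family (\<lambda>i. snd c ` B i)"
    unfolding disjoint_family_on_def
    using B(2,3) inj_onD[OF inj_on_chart[OF c]] unfolding disjoint_family_on_def by (auto; blast)
  then have "(\<Sum>i. emeasure (density lborel (\<lambda>x. ennreal (\<rho> c x * indicator (chart_image c) x))) (snd c ` B i))
      = emeasure (density lborel (\<lambda>x. ennreal (\<rho> c x * indicator (chart_image c) x))) (\<Union>i. snd c ` B i)"
    using chart_borel_image[OF c B(1,2)] by (intro suminf_emeasure) auto
  also have "(\<Union>i. snd c ` B i) = snd c ` (\<Union>i. B i)" by blast
  finally show ?thesis
    using chart_volume_eq_emeasure[OF c B(1,2)] chart_volume_eq_emeasure[OF c, of "\<Union>i. B i"] B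
    by (simp add: UN_least)
qed

lemma chart_volume_sum:
  fixes k :: nat
  assumes c: "c \<in> A" and B: "\<And>i. i < k \<Longrightarrow> B i \<in> sets borel" "\<And>i. i < k \<Longrightarrow> B i \<subseteq> fst c" "disjoint_family_on B {..<k}"
  shows "(\<Sum>i<k. chart_volume c (B i)) = chart_volume c (\<Union>i<k. B i)"
proof -
  let ?B = "\<lambda>i. if i < k then B i else {}"
  have "(\<Sum>i. chart_volume c (?B i)) = chart_volume c (\<Union>i. ?B i)"
    using B by (intro chart_volume_suminf[OF c]) (auto simp: disjoint_family_on_def)
  moreover have "(\<Sum>i. chart_volume c (?B i)) = (\<Sum>i<k. chart_volume c (?B i))"
    by (rule suminf_finite) (auto simp: chart_volume_empty)
  moreover have "(\<Union>i. ?B i) = (\<Union>i<k. B i)" by (auto split: if_splits)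
  ultimately show ?thesis by simp
qed

text \<open>With \<open>f = id\<close> this says that overlapping charts assign the same volume to a set, which makes the
gluing below possible; with general \<open>f\<close> it is the local form of Liouville's theorem.\<close>

lemma chart_volume_image:
  assumes f: "inj f" "smooth_map A f" "preserves_form A \<Omega> f" and cd: "c \<in> A" "d \<in> A"
    and B: "B \<in> sets borel" "B \<subseteq> fst c" "f ` B \<in> sets borel" "f ` B \<subseteq> fst d"
  shows "chart_volume c B = chart_volume d (f ` B)"
proof -
  let ?S = "snd c ` B" let ?g = "coord_rep c d f"
  have S: "?S \<subseteq> coord_dom c d f" using B coord_domI[OF cd(1)] by blast
  have g: "?g (snd c y) = snd d (f y)" if "y \<in> B" for y
    using that B(2) unfolding coord_rep_def by (auto simp: chart_inv_chart[OF cd(1)])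
  then have im: "?g ` ?S = snd d ` f ` B" by (auto simp: image_image)
  have inj: "inj_on ?g ?S"
  proof (rule inj_onI)
    fix x x' assume x: "x \<in> ?S" "x' \<in> ?S" "?g x = ?g x'"
    then obtain y y' where y: "y \<in> B" "y' \<in> B" "x = snd c y" "x' = snd c y'" by blast
    then have "snd d (f y) = snd d (f y')" using x g by simp
    then have "f y = f y'" using inj_onD[OF inj_on_chart[OF cd(2)]] y B(4) by blast
    then show "x = x'" using f(1) y by (simp add: inj_eq)
  qed
  have sub: "?S \<subseteq> chart_image c" "snd d ` f ` B \<subseteq> chart_image d" using B unfolding chart_image_def by blast+
  have ms: "(\<lambda>x. \<rho> e x * indicator T x) \<in> borel_measurable borel"
    if e: "e \<in> A" and T: "T \<in> sets borel" "T \<subseteq> chart_image e" for e T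
  proof -
    have "(\<lambda>x. (\<rho> e x * indicator (chart_image e) x) * indicator T x) \<in> borel_measurable borel"
      using T(1) by (intro borel_measurable_times density_measurable[OF e]) auto
    moreover have "(\<lambda>x. (\<rho> e x * indicator (chart_image e) x) * indicator T x) = (\<lambda>x. \<rho> e x * indicator T x)"
      using T(2) by (auto simp: indicator_def fun_eq_iff subset_iff)
    ultimately show ?thesis by simp
  qed
  have bS: "?S \<in> sets borel" and bT: "snd d ` f ` B \<in> sets borel"
    using chart_borel_image cd B by blast+
  show ?thesis
    unfolding chart_volume_def im[symmetric]
  proof (rule nn_integral_change_of_variables[where g' = "coord_deriv c d f"])
    show "(?g has_derivative coord_deriv c d f x) (at x)" if "x \<in> ?S" for x
      using coord_rep_has_derivative[OF f(2) cd] S that by blast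
    show "\<rho> c x = \<bar>det (matrix (coord_deriv c d f x))\<bar> * \<rho> d (?g x)" if "x \<in> ?S" for x
      using density_transform[OF f(2,3) cd] S that by blast
    show "?S \<in> sets borel" by (rule bS)
    show "inj_on ?g ?S" by (rule inj)
    show "(\<lambda>x. \<rho> c x * indicator ?S x) \<in> borel_measurable borel" by (rule ms[OF cd(1) bS sub(1)])
    show "(\<lambda>x. \<rho> d x * indicator (?g ` ?S) x) \<in> borel_measurable borel" unfolding im by (rule ms[OF cd(2) bT sub(2)])
  qed (rule density_nonneg)+
qed

section \<open>Gluing the volumes of the charts\<close>

text \<open>By compactness finitely many charts cover the manifold. Removing from each of them the preceding ones
cuts the manifold into finitely many Borel cells, each of which lies in one chart.\<close>

definition cover :: "('y, 'n) chart list" where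
  "cover = (SOME cs. set cs \<subseteq> A \<and> (\<Union>c\<in>set cs. fst c) = UNIV)"

lemma cover: "set cover \<subseteq> A" "(\<Union>c\<in>set cover. fst c) = UNIV"
proof -
  have "UNIV \<subseteq> (\<Union>c\<in>A. fst c)" using atlas unfolding smooth_atlas_def by simp
  then obtain C where "C \<subseteq> A" "finite C" "UNIV \<subseteq> (\<Union>c\<in>C. fst c)"
    by (rule compactE_image[OF compact_manifold open_chart_dom, rotated]) auto
  moreover obtain cs where "set cs = C" using \<open>finite C\<close> finite_list by blast
  ultimately have "\<exists>cs. set cs \<subseteq> A \<and> (\<Union>c\<in>set cs. fst c) = UNIV" by blast
  from someI_ex[OF this] show "set cover \<subseteq> A" "(\<Union>c\<in>set cover. fst c) = UNIV"
    unfolding cover_def by blast+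
qed

abbreviation ncov :: nat where "ncov \<equiv> length cover"

definition cell :: "nat \<Rightarrow> 'y set" where
  "cell i = fst (cover ! i) - (\<Union>j<i. fst (cover ! j))"

lemma cover_mem: "i < ncov \<Longrightarrow> cover ! i \<in> A"
  using cover(1) nth_mem by blast

lemma cell_borel: "i < ncov \<Longrightarrow> cell i \<in> sets borel"
  unfolding cell_def using open_chart_dom[OF cover_mem] by (intro sets.Diff sets.finite_UN) auto

lemma cell_subset: "cell i \<subseteq> fst (cover ! i)"
  unfolding cell_def by blast

lemma cell_disjoint: "m \<noteq> n \<Longrightarrow> cell m \<inter> cell n = {}"
  unfolding cell_def by (cases m n rule: linorder_cases) auto

lemma disjoint_family_cells: "disjoint_family_on (\<lambda>i. B \<inter> cell i) I"
  unfolding disjoint_family_on_def using cell_disjoint by blast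

lemma cell_Un: "(\<Union>i<ncov. cell i) = UNIV"
proof -
  have "y \<in> (\<Union>i<ncov. cell i)" for y
  proof -
    have "\<exists>i. i < ncov \<and> y \<in> fst (cover ! i)" using cover(2) by (metis UNIV_I UN_iff in_set_conv_nth)
    then obtain i where "i < ncov" "y \<in> fst (cover ! i)" "\<forall>j<i. \<not> (j < ncov \<and> y \<in> fst (cover ! j))"
      using exists_least_iff[of "\<lambda>i. i < ncov \<and> y \<in> fst (cover ! i)"] by blast
    then show ?thesis unfolding cell_def by auto
  qed
  then show ?thesis by blast
qed

definition vol :: "'y measure" where
  "vol = measure_of UNIV (sets borel) (\<lambda>B. \<Sum>i<ncov. chart_volume (cover ! i) (B \<inter> cell i))"

lemma sets_vol: "sets vol = sets borel"
  unfolding vol_def using sets.sigma_sets_eq[of borel] by (simp add: sets_measure_of_conv)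

lemma space_vol: "space vol = UNIV"
  using sets_eq_imp_space_eq[OF sets_vol] by simp

lemma emeasure_vol:
  assumes "B \<in> sets borel"
  shows "emeasure vol B = (\<Sum>i<ncov. chart_volume (cover ! i) (B \<inter> cell i))"
  unfolding vol_def
proof (rule emeasure_measure_of_sigma)
  show "sigma_algebra UNIV (sets (borel :: 'y measure))" using sets.sigma_algebra_axioms[of "borel :: 'y measure"] by simp
  show "positive (sets borel) (\<lambda>B. \<Sum>i<ncov. chart_volume (cover ! i) (B \<inter> cell i))"
    unfolding positive_def by (simp add: chart_volume_empty)
  show "countably_additive (sets borel) (\<lambda>B. \<Sum>i<ncov. chart_volume (cover ! i) (B \<inter> cell i))"
  proof (rule countably_additiveI)
    fix B :: "nat \<Rightarrow> 'y set" assume B: "range B \<subseteq> sets borel" "disjoint_family B"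
    have "(\<Sum>n. \<Sum>i<ncov. chart_volume (cover ! i) (B n \<inter> cell i)) = (\<Sum>i<ncov. \<Sum>n. chart_volume (cover ! i) (B n \<inter> cell i))"
      by (rule suminf_sum) simp
    also have "\<dots> = (\<Sum>i<ncov. chart_volume (cover ! i) (\<Union>n. B n \<inter> cell i))"
    proof (intro sum.cong refl chart_volume_suminf)
      fix i n assume "i \<in> {..<ncov}"
      then have i: "i < ncov" by simp
      show "cover ! i \<in> A" by (rule cover_mem[OF i])
      show "B n \<inter> cell i \<in> sets borel" using B(1) cell_borel[OF i] by blast
      show "B n \<inter> cell i \<subseteq> fst (cover ! i)" using cell_subset[of i] by blast
      show "disjoint_family (\<lambda>n. B n \<inter> cell i)" using B(2) unfolding disjoint_family_on_def by blast
    qed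
    also have "\<dots> = (\<Sum>i<ncov. chart_volume (cover ! i) ((\<Union>n. B n) \<inter> cell i))" by simp
    finally show "(\<Sum>n. \<Sum>i<ncov. chart_volume (cover ! i) (B n \<inter> cell i)) = \<dots>" .
  qed
qed (rule assms)

lemma cell_split: "B = (\<Union>i<ncov. B \<inter> cell i)"
  using cell_Un by blast

lemma measure_cell_split:
  assumes "sets M = sets borel" "B \<in> sets borel"
  shows "emeasure M B = (\<Sum>i<ncov. emeasure M (B \<inter> cell i))"
proof -
  have "(\<Sum>i<ncov. emeasure M (B \<inter> cell i)) = emeasure M (\<Union>i<ncov. B \<inter> cell i)"
    using assms cell_borel
    by (intro sum_emeasure disjoint_family_cells) auto
  then show ?thesis using cell_split[of B] by simp
qed

lemma vol_chart:
  assumes c: "c \<in> A" and B: "B \<in> sets borel" "B \<subseteq> fst c"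
  shows "emeasure vol B = chart_volume c B"
proof -
  have "chart_volume (cover ! i) (B \<inter> cell i) = chart_volume c (B \<inter> cell i)" if i: "i < ncov" for i
    using chart_volume_image[OF _ smooth_map_id form_id cover_mem[OF i] c, of "B \<inter> cell i"] cell_borel[OF i] cell_subset[of i] B
    by auto
  then have "emeasure vol B = (\<Sum>i<ncov. chart_volume c (B \<inter> cell i))" unfolding emeasure_vol[OF B(1)] by simp
  also have "\<dots> = chart_volume c (\<Union>i<ncov. B \<inter> cell i)"
    using B cell_borel by (intro chart_volume_sum[OF c] disjoint_family_cells) auto
  finally show ?thesis using cell_split[of B] by simp
qed

text \<open>A measure is determined by its values on the Borel subsets of the cells, and those lie in charts.\<close>

lemma vol_unique:
  assumes "sets M = sets borel" "\<And>c B. c \<in> A \<Longrightarrow> B \<in> sets borel \<Longrightarrow> B \<subseteq> fst c \<Longrightarrow> emeasure M B = chart_volume c B"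
  shows "M = vol"
proof (rule measure_eqI)
  show "sets M = sets vol" using assms(1) sets_vol by simp
  fix B assume "B \<in> sets M"
  then have B: "B \<in> sets borel" using assms(1) by simp
  have "emeasure M (B \<inter> cell i) = emeasure vol (B \<inter> cell i)" if "i < ncov" for i
    using assms(2)[OF cover_mem[OF that]] vol_chart[OF cover_mem[OF that]] cell_borel[OF that] cell_subset[of i] B
    by (metis inf.coboundedI2 sets.Int)
  then show "emeasure M B = emeasure vol B"
    using measure_cell_split[OF assms(1) B] measure_cell_split[OF sets_vol B] by simp
qed

lemma symplectic_volume_eq: "symplectic_volume A \<Omega> = vol"
  unfolding symplectic_volume_def
proof (rule the_equality)
  show "sets vol = sets borel \<and> (\<forall>c\<in>A. \<forall>B\<in>sets borel. B \<subseteq> fst c \<longrightarrow>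
      emeasure vol B = (\<integral>\<^sup>+x\<in>snd c ` B. ennreal (\<rho> c x) \<partial>lborel))"
    using sets_vol vol_chart unfolding chart_volume_def by blast
next
  fix \<mu> :: "'y measure"
  assume "sets \<mu> = sets borel \<and> (\<forall>c\<in>A. \<forall>B\<in>sets borel. B \<subseteq> fst c \<longrightarrow>
      emeasure \<mu> B = (\<integral>\<^sup>+x\<in>snd c ` B. ennreal (\<rho> c x) \<partial>lborel))"
  then show "\<mu> = vol" by (intro vol_unique) (auto simp: chart_volume_def)
qed

lemma continuous_borel: "continuous_on UNIV f \<Longrightarrow> f \<in> borel_measurable borel"
  by (rule borel_measurable_continuous_onI)

text \<open>The image measure has the property that characterizes the volume: the preimage of a set inside a
chart is cut by the cells into pieces to which \<open>chart_volume_image\<close> applies.\<close>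

lemma vol_invariant:
  assumes f: "symplectomorphism A \<Omega> f"
  shows "distr vol borel f = vol"
proof (rule vol_unique)
  show "sets (distr vol borel f) = sets borel" by simp
  have f': "bij f" "smooth_map A f" "smooth_map A (inv_into UNIV f)" "preserves_form A \<Omega> f"
    using f unfolding symplectomorphism_def diffeomorphism_def by auto
  have fm: "f \<in> borel_measurable borel" and gm: "inv_into UNIV f \<in> borel_measurable borel"
    using f' smooth_map_continuous continuous_borel by blast+
  have im: "f ` B = inv_into UNIV f -` B" for B using bij_vimage_eq_inv_image[OF bij_imp_bij_inv[OF f'(1)]] inv_inv_eq[OF f'(1)] by metis
  have imb: "f ` B \<in> sets borel" if "B \<in> sets borel" for B
    unfolding im using measurable_sets[OF gm that] by simp
  fix c B assume c: "c \<in> A" and B: "B \<in> sets borel" "B \<subseteq> fst c"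
  have pre: "f -` B \<in> sets borel" using measurable_sets[OF fm B(1)] by simp
  have "emeasure (distr vol borel f) B = emeasure vol (f -` B)"
    using fm B by (subst emeasure_distr) (auto simp: sets_vol space_vol measurable_cong_sets[OF sets_vol refl])
  also have "\<dots> = (\<Sum>i<ncov. chart_volume (cover ! i) (f -` B \<inter> cell i))" by (rule emeasure_vol[OF pre])
  also have "\<dots> = (\<Sum>i<ncov. chart_volume c (f ` (f -` B \<inter> cell i)))"
  proof (intro sum.cong refl)
    fix i assume "i \<in> {..<ncov}"
    then have i: "i < ncov" by simp
    show "chart_volume (cover ! i) (f -` B \<inter> cell i) = chart_volume c (f ` (f -` B \<inter> cell i))"
      using pre cell_borel[OF i] cell_subset[of i] B imb[of "f -` B \<inter> cell i"]
      by (intro chart_volume_image[OF bij_is_inj[OF f'(1)] f'(2,4) cover_mem[OF i] c]) auto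
  qed
  also have "\<dots> = chart_volume c (\<Union>i<ncov. f ` (f -` B \<inter> cell i))"
  proof (rule chart_volume_sum[OF c])
    show "f ` (f -` B \<inter> cell i) \<in> sets borel" if "i < ncov" for i
      using imb pre cell_borel[OF that] by blast
    show "disjoint_family_on (\<lambda>i. f ` (f -` B \<inter> cell i)) {..<ncov}"
      unfolding disjoint_family_on_def
    proof (intro ballI impI)
      fix m n :: nat assume "m \<noteq> n"
      then have "f ` cell m \<inter> f ` cell n = {}"
        using image_Int[OF bij_is_inj[OF f'(1)], of "cell m" "cell n"] cell_disjoint by simp
      then show "f ` (f -` B \<inter> cell m) \<inter> f ` (f -` B \<inter> cell n) = {}" by blast
    qed
  qed (use B in auto)
  also have "(\<Union>i<ncov. f ` (f -` B \<inter> cell i)) = f ` (f -` B)" using cell_split[of "f -` B"] by blast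
  also have "\<dots> = B" using bij_is_surj[OF f'(1)] by (rule surj_image_vimage_eq)
  finally show "emeasure (distr vol borel f) B = chart_volume c B" .
qed

lemma vol_finite: "finite_measure vol"
proof
  have "\<exists>N. open N \<and> y \<in> N \<and> emeasure vol N < \<infinity>" for y
  proof -
    obtain c where c: "c \<in> A" "y \<in> fst c" using chart_at by blast
    let ?x = "snd c y"
    have x: "?x \<in> chart_image c" by (rule chart_mem[OF c(2)])
    obtain e where e: "e > 0" "cball ?x e \<subseteq> chart_image c"
      using open_contains_cball[of "chart_image c"] open_chart_image[OF c(1)] x by blast
    have "compact (\<rho> c ` cball ?x e)"
      by (intro compact_continuous_image continuous_on_subset[OF density_continuous[OF c(1)] e(2)]) simp
    then obtain K where K: "\<And>z. z \<in> cball ?x e \<Longrightarrow> norm (\<rho> c z) \<le> K"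
      using compact_imp_bounded bounded_iff by (metis imageI)
    define N where "N = fst c \<inter> snd c -` ball ?x e"
    have oN: "open N"
      using continuous_open_preimage[OF continuous_chart[OF c(1)] open_chart_dom[OF c(1)] open_ball] unfolding N_def .
    have "emeasure vol N = chart_volume c N"
      by (rule vol_chart[OF c(1)]) (use oN in \<open>auto simp: N_def\<close>)
    also have "\<dots> \<le> (\<integral>\<^sup>+x. ennreal K * indicator (cball ?x e) x \<partial>lborel)"
      unfolding chart_volume_def
    proof (rule nn_integral_mono)
      fix z
      show "ennreal (\<rho> c z) * indicator (snd c ` N) z \<le> ennreal K * indicator (cball ?x e) z"
        using K[of z] by (auto simp: N_def indicator_def intro!: ennreal_leI split: if_splits)
    qed
    also have "\<dots> = ennreal K * emeasure lborel (cball ?x e)"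
      by (subst nn_integral_cmult_indicator) auto
    also have "\<dots> < \<infinity>" using emeasure_bounded_finite[OF bounded_cball, of ?x e] by (simp add: ennreal_mult_less_top)
    finally have "emeasure vol N < \<infinity>" .
    moreover have "y \<in> N" unfolding N_def using c e by simp
    ultimately show ?thesis using oN by blast
  qed
  then obtain N where N: "\<And>y. open (N y)" "\<And>y. y \<in> N y" "\<And>y. emeasure vol (N y) < \<infinity>" by metis
  have "UNIV \<subseteq> (\<Union>y\<in>UNIV. N y)" using N(2) by blast
  then obtain D where D: "finite D" "UNIV \<subseteq> (\<Union>y\<in>D. N y)"
    using compactE_image[OF compact_manifold, of UNIV N] N(1) by metis
  have "emeasure vol UNIV \<le> emeasure vol (\<Union>y\<in>D. N y)" using D by (simp add: top.extremum_unique)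
  also have "\<dots> \<le> (\<Sum>y\<in>D. emeasure vol (N y))"
    using N(1) by (intro emeasure_subadditive_finite D) (auto simp: sets_vol)
  also have "\<dots> < \<infinity>" using N(3) D(1) by simp
  finally show "emeasure vol (space vol) \<noteq> \<infinity>" by (simp add: space_vol)
qed

lemma vol_pos: "emeasure vol UNIV > 0"
proof (rule ccontr)
  assume "\<not> emeasure vol UNIV > 0"
  then have z: "emeasure vol UNIV = 0" by simp
  obtain c where c: "c \<in> A" "undefined \<in> fst c" using chart_at by blast
  have "emeasure vol (fst c) \<le> emeasure vol UNIV" by (rule emeasure_mono) (auto simp: sets_vol)
  then have "chart_volume c (fst c) = 0" using z vol_chart[OF c(1), of "fst c"] open_chart_dom[OF c(1)] by simp
  then have "(\<integral>\<^sup>+x. ennreal (\<rho> c x * indicator (chart_image c) x) \<partial>lborel) = 0"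
    unfolding chart_volume_def chart_image_def[symmetric]
    by (simp add: ennreal_mult' density_nonneg ennreal_indicator)
  then have "AE x in lborel. ennreal (\<rho> c x * indicator (chart_image c) x) = 0"
    using nn_integral_0_iff_AE[of "\<lambda>x. ennreal (\<rho> c x * indicator (chart_image c) x)" lborel] density_measurable[OF c(1)] by simp
  then have "AE x in lborel. x \<notin> chart_image c"
  proof eventually_elim
    fix x assume "ennreal (\<rho> c x * indicator (chart_image c) x) = 0"
    then show "x \<notin> chart_image c" using density_pos[OF c(1), of x] by (cases "x \<in> chart_image c") (auto simp: ennreal_eq_0_iff)
  qed
  then have "chart_image c \<in> null_sets lborel"
    using open_chart_image[OF c(1)] by (subst (asm) AE_iff_null_sets[symmetric]) auto
  then have "negligible (chart_image c)"
    using negligible_iff_null_sets null_sets_completionI by blast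
  then show False using open_not_negligible[OF open_chart_image[OF c(1)]] chart_mem[OF c(2)] by blast
qed

end


section \<open>A smooth step function\<close>

lemma ck_inverse: "ck k {0<..} (\<lambda>x::real. inverse x)"
proof (induction k)
  case (Suc k)
  show ?case
  proof (rule ck_SucI[where D = "\<lambda>x v. - (inverse x * v * inverse x)"])
    show "((\<lambda>x. inverse x) has_derivative (\<lambda>v. - (inverse x * v * inverse x))) (at x)" if "x \<in> {0<..}" for x :: real
      using has_derivative_inverse'[of x UNIV] that by simp
    show "ck k {0<..} (\<lambda>x::real. - (inverse x * v * inverse x))" for v
      using ck_bounded_linear[OF _ bounded_linear_scaleR_right[of "- v"] ck_scaleR[OF _ Suc Suc]]
      by (simp add: mult_ac)
  qed simp
qed auto

text \<open>The derivatives of \<open>exp (- 1 / x)\<close>, extended by zero, are linear combinations of these functions.\<close>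

definition flat :: "nat \<Rightarrow> real \<Rightarrow> real" where
  "flat n x = (if x > 0 then inverse x ^ n * exp (- inverse x) else 0)"

text \<open>With \<open>m = n + 2\<close>, the inequality \<open>u \<le> exp u\<close> for \<open>u = 1 / (m x)\<close>, raised to the power \<open>m\<close>, shows that
the exponential outweighs the pole; the quadratic bound makes the derivative at \<open>0\<close> vanish.\<close>

lemma flat_bound: "\<bar>flat n x\<bar> \<le> real (n + 2) ^ (n + 2) * x\<^sup>2"
proof (cases "x > 0")
  case True
  define m where "m = n + 2"
  have m: "real m > 0" by (simp add: m_def)
  have "inverse x / m \<le> exp (inverse x / m)"
    using exp_ge_add_one_self[of "inverse x / m"] by linarith
  then have "(inverse x / m) ^ m \<le> exp (inverse x / m) ^ m" using True m by (intro power_mono) auto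
  also have "\<dots> = exp (inverse x)" using m by (simp add: exp_of_nat_mult[symmetric])
  finally have "inverse x ^ m \<le> exp (inverse x) * real m ^ m"
    using m by (simp add: power_divide pos_divide_le_eq)
  then have "inverse x ^ m * exp (- inverse x) \<le> (exp (inverse x) * real m ^ m) * exp (- inverse x)"
    by (rule mult_right_mono) simp
  also have "\<dots> = real m ^ m" by (simp add: exp_minus)
  finally have "inverse x ^ m * exp (- inverse x) \<le> real m ^ m" .
  then have "inverse x ^ m * exp (- inverse x) * x\<^sup>2 \<le> real m ^ m * x\<^sup>2" by (rule mult_right_mono) simp
  moreover have "inverse x ^ m * exp (- inverse x) * x\<^sup>2 = flat n x"
    using True by (simp add: m_def flat_def power_add power2_eq_square field_simps)
  ultimately have "flat n x \<le> real m ^ m * x\<^sup>2" by metis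
  moreover have "flat n x \<ge> 0" by (simp add: flat_def)
  ultimately show ?thesis unfolding m_def[symmetric] by (metis abs_of_nonneg)
qed (simp add: flat_def)

lemma flat_has_derivative:
  "(flat n has_real_derivative flat (n + 2) x - real n * flat (n + 1) x) (at x)"
proof -
  consider "x > 0" | "x < 0" | "x = 0" by linarith
  then show ?thesis
  proof cases
    case 1
    have "((\<lambda>x. inverse x ^ n * exp (- inverse x)) has_real_derivative
        flat (n + 2) x - real n * flat (n + 1) x) (at x)"
    proof -
      have "((\<lambda>x. inverse x ^ n) has_real_derivative - real n * inverse x ^ (n + 1)) (at x)"
        using DERIV_power[OF DERIV_inverse[of x], of n UNIV] 1 by (cases n) (simp_all add: algebra_simps)
      moreover have "((\<lambda>x. exp (- inverse x)) has_real_derivative inverse x ^ 2 * exp (- inverse x)) (at x)"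
        using 1 by (auto intro!: derivative_eq_intros simp: power2_eq_square)
      ultimately have "((\<lambda>x. inverse x ^ n * exp (- inverse x)) has_real_derivative
          - real n * inverse x ^ (n + 1) * exp (- inverse x) + inverse x ^ 2 * exp (- inverse x) * inverse x ^ n) (at x)"
        by (rule DERIV_mult)
      moreover have "- real n * inverse x ^ (n + 1) * exp (- inverse x) + inverse x ^ 2 * exp (- inverse x) * inverse x ^ n =
          flat (n + 2) x - real n * flat (n + 1) x"
        using 1 by (simp add: flat_def power_add power2_eq_square algebra_simps)
      ultimately show ?thesis by simp
    qed
    then show ?thesis
      by (rule has_field_derivative_transform_within_open[where S = "{0<..}"]) (use 1 in \<open>auto simp: flat_def\<close>)
  next
    case 2
    have "((\<lambda>x. 0) has_real_derivative 0) (at x)" by simp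
    then have "(flat n has_real_derivative 0) (at x)"
      by (rule has_field_derivative_transform_within_open[where S = "{..<0}"]) (use 2 in \<open>auto simp: flat_def\<close>)
    then show ?thesis using 2 by (simp add: flat_def)
  next
    case 3
    let ?C = "real (n + 2) ^ (n + 2)"
    have "((\<lambda>y. (flat n y - flat n 0) / (y - 0)) \<longlongrightarrow> 0) (at 0)"
    proof (rule Lim_null_comparison)
      show "\<forall>\<^sub>F y in at 0. norm ((flat n y - flat n 0) / (y - 0)) \<le> ?C * \<bar>y\<bar>"
      proof (intro always_eventually allI)
        fix y :: real
        have "\<bar>flat n y\<bar> / \<bar>y\<bar> \<le> ?C * y\<^sup>2 / \<bar>y\<bar>" by (rule divide_right_mono[OF flat_bound]) simp
        also have "\<dots> = ?C * \<bar>y\<bar>" by (cases "y = 0") (auto simp: power2_eq_square abs_if)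
        finally show "norm ((flat n y - flat n 0) / (y - 0)) \<le> ?C * \<bar>y\<bar>" by (simp add: flat_def)
      qed
      show "((\<lambda>y::real. ?C * \<bar>y\<bar>) \<longlongrightarrow> 0) (at 0)" by (auto intro!: tendsto_eq_intros)
    qed
    then have "(flat n has_real_derivative 0) (at 0)" unfolding has_field_derivative_iff by simp
    then show ?thesis using 3 by (simp add: flat_def)
  qed
qed

lemma ck_flat: "ck k UNIV (flat n)"
proof (induction k arbitrary: n)
  case 0
  have "flat n differentiable (at x)" for x
    using flat_has_derivative[of n x] unfolding real_differentiable_def by blast
  then show ?case by simp
next
  case (Suc k)
  show ?case
  proof (rule ck_SucI[where D = "\<lambda>x v. (flat (n + 2) x - real n * flat (n + 1) x) * v"])
    show "(flat n has_derivative (\<lambda>v. (flat (n + 2) x - real n * flat (n + 1) x) * v)) (at x)" for x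
      using flat_has_derivative[of n x] unfolding has_field_derivative_def .
    show "ck k UNIV (\<lambda>x. (flat (n + 2) x - real n * flat (n + 1) x) * v)" for v
      using ck_bounded_linear[OF _ bounded_linear_scaleR_right[of v]
          ck_add[OF _ Suc[of "n + 2"] ck_bounded_linear[OF _ bounded_linear_scaleR_right[of "- real n"] Suc[of "n + 1"]]]]
      by (simp add: mult.commute)
  qed simp
qed

lemma smooth_on_affine: "smooth_on UNIV (\<lambda>t::real. a + b * t)"
  using smooth_on_add[OF open_UNIV smooth_on_const smooth_on_linear[OF open_UNIV bounded_linear_mult_right]] .

text \<open>The classical choice is \<open>f x / (f x + f (1 - x))\<close> for the flat function \<open>f = flat 0\<close>, whose denominator
never vanishes.\<close>

lemma smooth_step_exists:
  obtains \<sigma> \<sigma>' :: "real \<Rightarrow> real"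
  where "smooth_on UNIV \<sigma>" "smooth_on UNIV \<sigma>'" "\<And>x. (\<sigma> has_real_derivative \<sigma>' x) (at x)"
    "\<And>x. x \<le> 0 \<Longrightarrow> \<sigma> x = 0" "\<And>x. x \<ge> 1 \<Longrightarrow> \<sigma> x = 1"
    "\<And>x. x < 0 \<Longrightarrow> \<sigma>' x = 0" "\<And>x. x > 1 \<Longrightarrow> \<sigma>' x = 0"
proof -
  have fl: "smooth_on UNIV (flat 0)" using ck_flat unfolding smooth_on_iff_ck by blast
  have inv: "smooth_on {0<..} (\<lambda>x::real. inverse x)" using ck_inverse unfolding smooth_on_iff_ck by blast
  have "smooth_on UNIV (\<lambda>x. flat 0 (1 + (-1) * x))"
    by (rule smooth_on_compose[OF open_UNIV open_UNIV _ smooth_on_affine fl]) simp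
  then have fl': "smooth_on UNIV (\<lambda>x. flat 0 (1 - x))" by simp
  have pos: "flat 0 x + flat 0 (1 - x) > 0" for x
    by (cases "x > 0") (auto simp: flat_def add_pos_nonneg)
  \<comment> \<open>The numerator vanishes for \<open>x \<le> 0\<close>, and numerator and denominator agree for \<open>x \<ge> 1\<close>.\<close>
  define \<sigma> where "\<sigma> x = flat 0 x * inverse (flat 0 x + flat 0 (1 - x))" for x
  have s: "smooth_on UNIV \<sigma>"
    unfolding \<sigma>_def
    by (rule smooth_on_mult[OF open_UNIV fl smooth_on_compose[OF open_UNIV _ _ smooth_on_add[OF open_UNIV fl fl'] inv]])
      (use pos in auto)
  define \<sigma>' where "\<sigma>' x = frechet_derivative \<sigma> (at x) 1" for x
  have "smooth_on UNIV (iter_deriv \<sigma> [1])" by (rule smooth_on_iter_deriv[OF s])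
  then have s': "smooth_on UNIV \<sigma>'" unfolding \<sigma>'_def by (simp add: \<sigma>'_def[abs_def])
  have d: "(\<sigma> has_real_derivative \<sigma>' x) (at x)" for x
  proof -
    have h: "(\<sigma> has_derivative frechet_derivative \<sigma> (at x)) (at x)" using smooth_on_imp_has_derivative[OF s] by simp
    then interpret linear "frechet_derivative \<sigma> (at x)" by (rule has_derivative_linear)
    have "frechet_derivative \<sigma> (at x) v = \<sigma>' x * v" for v
      using scale[of v 1] by (simp add: \<sigma>'_def mult.commute)
    then have "frechet_derivative \<sigma> (at x) = (*) (\<sigma>' x)" by (rule ext)
    with h show ?thesis unfolding has_field_derivative_def by simp
  qed
  have z: "\<sigma> x = 0" if "x \<le> 0" for x using that by (simp add: \<sigma>_def flat_def)
  have o: "\<sigma> x = 1" if "x \<ge> 1" for x using that pos[of x] by (simp add: \<sigma>_def flat_def)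
  have zd: "\<sigma>' x = 0" if "x < 0" for x
  proof -
    have "((\<lambda>x. 0) has_real_derivative 0) (at x)" by simp
    then have "(\<sigma> has_real_derivative 0) (at x)"
      by (rule has_field_derivative_transform_within_open[where S = "{..<0}"]) (use that z in auto)
    then show ?thesis using d DERIV_unique by blast
  qed
  have od: "\<sigma>' x = 0" if "x > 1" for x
  proof -
    have "((\<lambda>x. 1) has_real_derivative 0) (at x)" by simp
    then have "(\<sigma> has_real_derivative 0) (at x)"
      by (rule has_field_derivative_transform_within_open[where S = "{1<..}"]) (use that o in auto)
    then show ?thesis using d DERIV_unique by blast
  qed
  show thesis by (rule that[OF s s' d z o zd od])
qed

section \<open>Hamiltonian vector fields and flows\<close>

text \<open>The condition of \<open>generated_by\<close> at a single time. It is local in time, so generators may be pieced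
together, and it makes sense for a function on the manifold that is not part of a family.\<close>

definition generated_at ::
    "('y::topological_space, 'n::finite) chart set \<Rightarrow> ('y, 'n) two_form
       \<Rightarrow> ('y \<Rightarrow> real) \<Rightarrow> (real \<Rightarrow> 'y \<Rightarrow> 'y) \<Rightarrow> real \<Rightarrow> bool" where
  "generated_at A \<Omega> F h t \<longleftrightarrow> (\<forall>y. \<forall>c\<in>A. h t y \<in> fst c \<longrightarrow>
        ((\<lambda>s. snd c (h s y)) has_vector_derivative ham_field \<Omega> F c (snd c (h t y))) (at t))"

lemma generated_by_iff:
  "generated_by A \<Omega> H h \<longleftrightarrow> smooth_functions A H \<and> (\<forall>t. generated_at A \<Omega> (H t) h t)"
  unfolding generated_by_def generated_at_def by blast

lemma generated_at_cong_near:
  assumes "open S" "t \<in> S" "\<And>s. s \<in> S \<Longrightarrow> h s = h' s" "generated_at A \<Omega> F h t"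
  shows "generated_at A \<Omega> F h' t"
  unfolding generated_at_def
proof (intro allI ballI impI)
  fix y c assume c: "c \<in> A" "h' t y \<in> fst c"
  have "((\<lambda>s. snd c (h s y)) has_vector_derivative ham_field \<Omega> F c (snd c (h t y))) (at t)"
    using assms c unfolding generated_at_def by metis
  then have "((\<lambda>s. snd c (h' s y)) has_vector_derivative ham_field \<Omega> F c (snd c (h t y))) (at t)"
    by (rule has_vector_derivative_transform_within_open[OF _ assms(1,2)]) (simp add: assms(3))
  then show "((\<lambda>s. snd c (h' s y)) has_vector_derivative ham_field \<Omega> F c (snd c (h' t y))) (at t)"
    using assms(2,3) by simp
qed

lemma generated_at_right: "generated_at A \<Omega> F h t \<Longrightarrow> generated_at A \<Omega> F (\<lambda>s. h s \<circ> g) t"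
  unfolding generated_at_def by simp

context symplectic_manifold
begin

lemma ham_field_ex1:
  assumes "c \<in> A" "x \<in> chart_image c" "(\<lambda>z. F (chart_inv c z)) differentiable (at x)"
  shows "\<exists>!X. \<forall>v. \<Omega> c x X v = - frechet_derivative (\<lambda>z. F (chart_inv c z)) (at x) v"
proof -
  have "linear (\<lambda>v. - frechet_derivative (\<lambda>z. F (chart_inv c z)) (at x) v)"
    using assms(3) linear_frechet_derivative by (intro linear_compose_neg)
  then show ?thesis by (rule symplectic_form.represent_functional[OF symplectic_form_at[OF assms(1,2)]])
qed

lemma ham_field:
  assumes "c \<in> A" "x \<in> chart_image c" "(\<lambda>z. F (chart_inv c z)) differentiable (at x)"
  shows "\<Omega> c x (ham_field \<Omega> F c x) v = - frechet_derivative (\<lambda>z. F (chart_inv c z)) (at x) v"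
  using theI'[OF ham_field_ex1[OF assms]] unfolding ham_field_def by blast

lemma ham_field_eqI:
  assumes "c \<in> A" "x \<in> chart_image c" "(\<lambda>z. F (chart_inv c z)) differentiable (at x)"
    "\<And>v. \<Omega> c x X v = - frechet_derivative (\<lambda>z. F (chart_inv c z)) (at x) v"
  shows "ham_field \<Omega> F c x = X"
  using the1_equality[OF ham_field_ex1[OF assms(1-3)]] assms(4) unfolding ham_field_def by blast

lemma form_bilinear: "c \<in> A \<Longrightarrow> x \<in> chart_image c \<Longrightarrow> bilinear (\<Omega> c x)"
  using symplectic_form_at unfolding symplectic_form_def by blast

lemma ham_field_scale:
  assumes "c \<in> A" "x \<in> chart_image c" "(\<lambda>z. F (chart_inv c z)) differentiable (at x)"
  shows "ham_field \<Omega> (\<lambda>y. r * F y) c x = r *\<^sub>R ham_field \<Omega> F c x"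
proof (rule ham_field_eqI[OF assms(1,2)])
  let ?f = "\<lambda>z. F (chart_inv c z)"
  have d: "((\<lambda>z. r * ?f z) has_derivative (\<lambda>v. r * frechet_derivative ?f (at x) v)) (at x)"
    using assms(3) by (intro has_derivative_mult_right) (simp add: frechet_derivative_works)
  then show "(\<lambda>z. r * ?f z) differentiable (at x)" unfolding differentiable_def by blast
  show "\<Omega> c x (r *\<^sub>R ham_field \<Omega> F c x) v = - frechet_derivative (\<lambda>z. r * ?f z) (at x) v" for v
    unfolding frechet_derivative_at[OF d, symmetric]
    by (simp add: bilinear_lmul[OF form_bilinear[OF assms(1,2)]] ham_field[OF assms])
qed

lemma generated_at_reparam:
  assumes g: "generated_at A \<Omega> F h (\<theta> t)" and \<theta>: "(\<theta> has_real_derivative r) (at t)"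
    and F: "\<And>c x. c \<in> A \<Longrightarrow> x \<in> chart_image c \<Longrightarrow> (\<lambda>z. F (chart_inv c z)) differentiable (at x)"
  shows "generated_at A \<Omega> (\<lambda>y. r * F y) (\<lambda>s. h (\<theta> s)) t"
  unfolding generated_at_def
proof (intro allI ballI impI)
  fix y c assume c: "c \<in> A" "h (\<theta> t) y \<in> fst c"
  have "((\<lambda>s. snd c (h s y)) has_vector_derivative ham_field \<Omega> F c (snd c (h (\<theta> t) y))) (at (\<theta> t))"
    using g c unfolding generated_at_def by blast
  from vector_diff_chain_at[where f = \<theta> and x = t and f' = r, OF _ this] \<theta>
  have "((\<lambda>s. snd c (h (\<theta> s) y)) has_vector_derivative r *\<^sub>R ham_field \<Omega> F c (snd c (h (\<theta> t) y))) (at t)"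
    by (simp add: o_def has_real_derivative_iff_has_vector_derivative)
  then show "((\<lambda>s. snd c (h (\<theta> s) y)) has_vector_derivative ham_field \<Omega> (\<lambda>y. r * F y) c (snd c (h (\<theta> t) y))) (at t)"
    using ham_field_scale[OF c(1) chart_mem[OF c(2)] F[OF c(1) chart_mem[OF c(2)]]] by simp
qed

lemma generated_by_reparam:
  assumes "generated_by A \<Omega> H h" "smooth_on UNIV \<theta>" "smooth_on UNIV \<theta>'" "\<And>t. (\<theta> has_real_derivative \<theta>' t) (at t)"
  shows "generated_by A \<Omega> (\<lambda>t y. \<theta>' t * H (\<theta> t) y) (\<lambda>t. h (\<theta> t))"
  using assms smooth_functions_reparam[of H \<theta> \<theta>'] smooth_functions_slice
  by (auto simp: generated_by_iff intro!: generated_at_reparam)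

lemma flow_in_Ham: "hamiltonian_flow A \<Omega> \<phi> \<Longrightarrow> \<phi> t \<in> Ham A \<Omega>"
  unfolding Ham_def hamiltonian_flow_def by blast

lemma Ham_symplectomorphism: "f \<in> Ham A \<Omega> \<Longrightarrow> symplectomorphism A \<Omega> f"
  unfolding Ham_def by blast

lemma symplectomorphism_props:
  assumes "symplectomorphism A \<Omega> f"
  shows "bij f" "smooth_map A f" "smooth_map A (inv_into UNIV f)" "preserves_form A \<Omega> f"
  using assms unfolding symplectomorphism_def diffeomorphism_def by auto

text \<open>The composition is reached by first running the flow that ends at \<open>g\<close> while the other flow rests at
the identity, and then the flow that ends at \<open>f\<close>. A smooth step function provides a time change for
which this is a smooth family. At each time at most one of the two flows moves, and therefore the sum
of the two rescaled generators is a generator.\<close>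

lemma Ham_compose:
  assumes "f \<in> Ham A \<Omega>" "g \<in> Ham A \<Omega>"
  shows "f \<circ> g \<in> Ham A \<Omega>"
proof -
  obtain \<phi> T where \<phi>: "hamiltonian_flow A \<Omega> \<phi>" "f = \<phi> T" using assms(1) unfolding Ham_def by blast
  obtain \<psi> S where \<psi>: "hamiltonian_flow A \<Omega> \<psi>" "g = \<psi> S" using assms(2) unfolding Ham_def by blast
  obtain H where H: "generated_by A \<Omega> H \<phi>" using \<phi> unfolding hamiltonian_flow_def by blast
  obtain K where K: "generated_by A \<Omega> K \<psi>" using \<psi> unfolding hamiltonian_flow_def by blast
  obtain \<sigma> \<sigma>' :: "real \<Rightarrow> real" where
    \<sigma>: "smooth_on UNIV \<sigma>" "smooth_on UNIV \<sigma>'" "\<And>x. (\<sigma> has_real_derivative \<sigma>' x) (at x)"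
    "\<And>x. x \<le> 0 \<Longrightarrow> \<sigma> x = 0" "\<And>x. x \<ge> 1 \<Longrightarrow> \<sigma> x = 1"
    "\<And>x. x < 0 \<Longrightarrow> \<sigma>' x = 0" "\<And>x. x > 1 \<Longrightarrow> \<sigma>' x = 0"
    using smooth_step_exists by blast
  \<comment> \<open>The second time change starts at time 2 and the first one ends at time 1, so that around every time one of them is constant.\<close>
  define a a' b b' where "a t = T * \<sigma> (t - 2)" and "a' t = T * \<sigma>' (t - 2)"
    and "b t = S * \<sigma> t" and "b' t = S * \<sigma>' t" for t
  have sh: "smooth_on UNIV (\<lambda>t::real. s (t - 2))" if "smooth_on UNIV s" for s :: "real \<Rightarrow> real"
    using smooth_on_compose[OF open_UNIV open_UNIV _ smooth_on_affine[of "-2" 1] that] by simp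
  have sm: "smooth_on UNIV a" "smooth_on UNIV a'" "smooth_on UNIV b" "smooth_on UNIV b'"
    unfolding a_def a'_def b_def b'_def
    by (intro smooth_on_bounded_linear[OF open_UNIV bounded_linear_mult_right] sh \<sigma>(1,2))+
  have da: "(a has_real_derivative a' t) (at t)" for t
    unfolding a_def a'_def
    using \<sigma>(3)[of "t - 2"] DERIV_shift[of \<sigma> "\<sigma>' (t - 2)" t "- 2"] by (intro DERIV_cmult) simp
  have db: "(b has_real_derivative b' t) (at t)" for t
    unfolding b_def b'_def by (rule DERIV_cmult[OF \<sigma>(3)])
  define \<eta> where "\<eta> t = \<phi> (a t) \<circ> \<psi> (b t)" for t
  have fam: "psmooth A \<phi>" "psmooth A \<psi>" using \<phi> \<psi> unfolding hamiltonian_flow_def smooth_family_iff_psmooth by auto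
  have 1: "smooth_family A \<eta>"
    unfolding smooth_family_iff_psmooth \<eta>_def
    by (rule psmooth_compose[OF psmooth_reparam[OF fam(1) sm(1)] psmooth_reparam[OF fam(2) sm(3)]])
  have 2: "symplectomorphism A \<Omega> (\<eta> t)" for t
    using \<phi> \<psi> unfolding \<eta>_def hamiltonian_flow_def by (blast intro: symplectomorphism_compose)
  have 0: "\<phi> 0 = id" "\<psi> 0 = id" using \<phi> \<psi> unfolding hamiltonian_flow_def by auto
  have 3: "\<eta> 0 = id" unfolding \<eta>_def a_def b_def using \<sigma>(4) 0 by simp
  define H' where "H' t y = a' t * H (a t) y + b' t * K (b t) y" for t y
  have Ha: "generated_by A \<Omega> (\<lambda>t y. a' t * H (a t) y) (\<lambda>t. \<phi> (a t))" by (rule generated_by_reparam[OF H sm(1,2) da])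
  have Kb: "generated_by A \<Omega> (\<lambda>t y. b' t * K (b t) y) (\<lambda>t. \<psi> (b t))" by (rule generated_by_reparam[OF K sm(3,4) db])
  have "generated_at A \<Omega> (H' t) \<eta> t" for t
  proof (cases "t < 2")
    case True
    have "H' t = (\<lambda>y. b' t * K (b t) y)" using True \<sigma>(6) by (simp add: fun_eq_iff H'_def a'_def)
    moreover have "generated_at A \<Omega> (\<lambda>y. b' t * K (b t) y) \<eta> t"
      by (rule generated_at_cong_near[of "{..<2}" _ "\<lambda>t. \<psi> (b t)"])
        (use True Kb \<sigma>(4) 0 in \<open>auto simp: generated_by_iff \<eta>_def a_def\<close>)
    ultimately show ?thesis by simp
  next
    case False
    have "H' t = (\<lambda>y. a' t * H (a t) y)" using False \<sigma>(7) by (simp add: fun_eq_iff H'_def b'_def)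
    moreover have "generated_at A \<Omega> (\<lambda>y. a' t * H (a t) y) \<eta> t"
    proof (rule generated_at_cong_near[of "{1<..}" _ "\<lambda>t. \<phi> (a t) \<circ> g"])
      show "generated_at A \<Omega> (\<lambda>y. a' t * H (a t) y) (\<lambda>t. \<phi> (a t) \<circ> g) t"
        by (rule generated_at_right) (use Ha in \<open>simp add: generated_by_iff\<close>)
    qed (use False \<sigma>(5) \<psi>(2) in \<open>auto simp: \<eta>_def b_def\<close>)
    ultimately show ?thesis by simp
  qed
  moreover have "smooth_functions A H'"
    unfolding H'_def using Ha Kb by (intro smooth_functions_add) (auto simp: generated_by_iff)
  ultimately have "generated_by A \<Omega> H' \<eta>" unfolding generated_by_iff by blast
  then have "hamiltonian_flow A \<Omega> \<eta>" using 1 2 3 unfolding hamiltonian_flow_def by blast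
  then have "\<eta> 3 \<in> Ham A \<Omega>" by (rule flow_in_Ham)
  moreover have "\<eta> 3 = f \<circ> g" unfolding \<eta>_def a_def b_def using \<sigma>(5) \<phi>(2) \<psi>(2) by simp
  ultimately show ?thesis by simp
qed

text \<open>The flow that ends at \<open>f\<close> is run backwards from there and composed with the inverse of \<open>f\<close>.\<close>

lemma Ham_inverse_path:
  assumes "f \<in> Ham A \<Omega>"
  obtains \<eta> where "psmooth A \<eta>" "\<eta> (0::real) = id" "f \<circ> \<eta> 1 = id" "\<And>s. \<eta> s \<in> Ham A \<Omega>"
proof -
  obtain \<phi> T where \<phi>: "hamiltonian_flow A \<Omega> \<phi>" "f = \<phi> T" using assms unfolding Ham_def by blast
  obtain H where H: "generated_by A \<Omega> H \<phi>" using \<phi> unfolding hamiltonian_flow_def by blast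
  have f: "bij f" "smooth_map A (inv_into UNIV f)" "symplectomorphism A \<Omega> (inv_into UNIV f)"
    using Ham_symplectomorphism[OF assms] symplectomorphism_props symplectomorphism_inverse by blast+
  define \<eta> where "\<eta> s = \<phi> (T + (- T) * s) \<circ> inv_into UNIV f" for s
  have ps: "psmooth A \<eta>"
    unfolding \<eta>_def using \<phi>(1) unfolding hamiltonian_flow_def smooth_family_iff_psmooth
    by (intro psmooth_compose[OF psmooth_reparam[OF _ smooth_on_affine] psmooth_const[OF f(2)]]) blast
  have z: "\<eta> 0 = id" unfolding \<eta>_def mult_zero_right add_0_right \<phi>(2)[symmetric] using f(1) by (auto simp: fun_eq_iff bij_is_surj surj_f_inv_f)
  have sy: "symplectomorphism A \<Omega> (\<eta> s)" for s
    unfolding \<eta>_def using \<phi>(1) f(3) unfolding hamiltonian_flow_def by (blast intro: symplectomorphism_compose)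
  have "generated_by A \<Omega> (\<lambda>t y. - T * H (T + (- T) * t) y) (\<lambda>t. \<phi> (T + (- T) * t))"
    by (rule generated_by_reparam[OF H smooth_on_affine smooth_on_const]) (auto intro!: derivative_eq_intros)
  then have "generated_by A \<Omega> (\<lambda>t y. - T * H (T + (- T) * t) y) \<eta>"
    unfolding generated_by_iff \<eta>_def using generated_at_right by blast
  then have fl: "hamiltonian_flow A \<Omega> \<eta>"
    using ps z sy unfolding hamiltonian_flow_def smooth_family_iff_psmooth by blast
  have "\<phi> 0 = id" using \<phi>(1) unfolding hamiltonian_flow_def by blast
  then have o: "f \<circ> \<eta> 1 = id" unfolding \<eta>_def using f(1) by (auto simp: fun_eq_iff bij_is_surj surj_f_inv_f)
  show thesis by (rule that[OF ps z o flow_in_Ham[OF fl]])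
qed

lemma id_in_Ham: "id \<in> Ham A \<Omega>" if "f \<in> Ham A \<Omega>"
  using that unfolding Ham_def hamiltonian_flow_def by (auto; metis)

end


section \<open>The Hamiltonian of a composition\<close>

text \<open>The function \<open>E\<close> is the Hamiltonian of the motion \<open>f\<close> at the time \<open>t\<close>, expressed in terms of the
starting point \<open>y\<close> rather than the current position \<open>f t y\<close>; here \<open>V\<close> is the velocity. In this form
the Hamiltonian of a composition is a sum in which no inverse maps occur.\<close>

definition pulled_back ::
    "('y::topological_space, 'n::finite) chart set \<Rightarrow> ('y, 'n) two_form
       \<Rightarrow> ('y \<Rightarrow> real) \<Rightarrow> (real \<Rightarrow> 'y \<Rightarrow> 'y) \<Rightarrow> real \<Rightarrow> bool" where
  "pulled_back A \<Omega> E f t \<longleftrightarrow> (\<forall>y. \<forall>c\<in>A. \<forall>d\<in>A. y \<in> fst c \<longrightarrow> f t y \<in> fst d \<longrightarrow>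
     (\<exists>V. ((\<lambda>s. snd d (f s y)) has_vector_derivative V) (at t) \<and>
       ((\<lambda>z. E (chart_inv c z)) has_derivative
          (\<lambda>v. - \<Omega> d (snd d (f t y)) V (coord_deriv c d (f t) (snd c y) v))) (at (snd c y))))"

text \<open>The second component of the \<open>k\<close>-th iterate of the skew product, as a loop of maps: its value is
\<open>h (t + (k - 1) \<alpha>) \<circ> \<dots> \<circ> h (t + \<alpha>) \<circ> h t\<close>.\<close>

primrec skew_iterate :: "(real \<Rightarrow> 'y \<Rightarrow> 'y) \<Rightarrow> real \<Rightarrow> nat \<Rightarrow> real \<Rightarrow> 'y \<Rightarrow> 'y" where
  "skew_iterate h \<alpha> 0 t = id"
| "skew_iterate h \<alpha> (Suc k) t = h (t + real k * \<alpha>) \<circ> skew_iterate h \<alpha> k t"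

context symplectic_manifold
begin

lemma pulled_back_generated:
  assumes g: "generated_at A \<Omega> F h t" and h: "smooth_map A (h t)"
    and F: "\<And>c x. c \<in> A \<Longrightarrow> x \<in> chart_image c \<Longrightarrow> (\<lambda>z. F (chart_inv c z)) differentiable (at x)"
  shows "pulled_back A \<Omega> (\<lambda>z. F (h t z)) h t"
  unfolding pulled_back_def
proof (intro allI ballI impI)
  fix y c d assume c: "c \<in> A" and d: "d \<in> A" and y: "y \<in> fst c" "h t y \<in> fst d"
  let ?xd = "snd d (h t y)" let ?X = "ham_field \<Omega> F d ?xd"
  have dom: "snd c y \<in> coord_dom c d (h t)" by (rule coord_domI[OF c]) (rule y)+
  have r: "coord_rep c d (h t) (snd c y) = ?xd" unfolding coord_rep_def by (simp add: chart_inv_chart[OF c y(1)])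
  have xd: "?xd \<in> chart_image d" by (rule chart_mem[OF y(2)])
  have "((\<lambda>z. F (chart_inv d (coord_rep c d (h t) z))) has_derivative
      (\<lambda>v. frechet_derivative (\<lambda>z. F (chart_inv d z)) (at ?xd) (coord_deriv c d (h t) (snd c y) v))) (at (snd c y))"
    by (rule has_derivative_compose[OF coord_rep_has_derivative[OF h c d dom], where g = "\<lambda>z. F (chart_inv d z)"])
      (use F[OF d xd] in \<open>simp add: r frechet_derivative_works\<close>)
  moreover have "frechet_derivative (\<lambda>z. F (chart_inv d z)) (at ?xd) w = - \<Omega> d ?xd ?X w" for w
    using ham_field[OF d xd F[OF d xd], of w] by simp
  ultimately have "((\<lambda>z. F (chart_inv d (coord_rep c d (h t) z))) has_derivative
      (\<lambda>v. - \<Omega> d ?xd ?X (coord_deriv c d (h t) (snd c y) v))) (at (snd c y))" by simp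
  then have "((\<lambda>z. F (h t (chart_inv c z))) has_derivative
      (\<lambda>v. - \<Omega> d ?xd ?X (coord_deriv c d (h t) (snd c y) v))) (at (snd c y))"
    by (rule has_derivative_transform_within_open[OF _ open_coord_dom[OF smooth_map_continuous[OF h] c d] dom])
      (simp add: chart_inv_coord_rep[OF d])
  moreover have "((\<lambda>s. snd d (h s y)) has_vector_derivative ?X) (at t)"
    using g d y unfolding generated_at_def by blast
  ultimately show "\<exists>V. ((\<lambda>s. snd d (h s y)) has_vector_derivative V) (at t) \<and>
       ((\<lambda>z. F (h t (chart_inv c z))) has_derivative
          (\<lambda>v. - \<Omega> d ?xd V (coord_deriv c d (h t) (snd c y) v))) (at (snd c y))" by blast
qed

text \<open>The chain rule for \<open>s \<mapsto> \<Phi> (s, x s)\<close>, where \<open>\<Phi>\<close> is the coordinate expression of \<open>f\<close> and \<open>x\<close> is the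
moving point: the two partial derivatives of \<open>\<Phi>\<close> are the velocity of \<open>f\<close> and the derivative of \<open>f t\<close>.\<close>

lemma velocity_compose:
  assumes f: "psmooth A f" and g: "psmooth A g" and ed: "e \<in> A" "d \<in> A"
    and y: "g t y \<in> fst e" "f t (g t y) \<in> fst d"
    and Vf: "((\<lambda>s. snd d (f s (g t y))) has_vector_derivative Vf) (at t)"
    and Vg: "((\<lambda>s. snd e (g s y)) has_vector_derivative Vg) (at t)"
  shows "((\<lambda>s. snd d (f s (g s y))) has_vector_derivative Vf + coord_deriv e d (f t) (snd e (g t y)) Vg) (at t)"
proof -
  let ?\<Phi> = "\<lambda>(s, x). coord_rep e d (f s) x"
  let ?x = "snd e (g t y)"
  let ?S = "{(s, x). x \<in> coord_dom e d (f s)}"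
  have S: "(t, ?x) \<in> ?S" using coord_domI[of e "g t y" "f t" d, OF ed(1) y] by simp
  have "?\<Phi> differentiable (at (t, ?x))"
    by (rule smooth_on_imp_differentiable[OF psmooth_smooth_on[OF f ed] S])
  then obtain D where D: "(?\<Phi> has_derivative D) (at (t, ?x))" unfolding differentiable_def by blast
  interpret D: linear D using D by (rule has_derivative_linear)
  have gy: "continuous_on UNIV (\<lambda>s. g s y)"
    using continuous_on_compose2[OF psmooth_continuous[OF g], of UNIV "\<lambda>s. (s, y)"]
    by (simp add: continuous_on_Pair continuous_on_const continuous_on_id)
  have near: "open ((\<lambda>s. g s y) -` fst e)" "t \<in> (\<lambda>s. g s y) -` fst e"
    using continuous_on_open_vimage[OF open_UNIV] gy open_chart_dom[OF ed(1)] y(1) by auto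
  have "((\<lambda>s. (s, snd e (g s y))) has_derivative (\<lambda>r. (r, r *\<^sub>R Vg))) (at t)"
    using Vg unfolding has_vector_derivative_def by (intro has_derivative_Pair) auto
  from has_derivative_compose[OF this, of ?\<Phi> D] D
  have "((\<lambda>s. ?\<Phi> (s, snd e (g s y))) has_derivative (\<lambda>r. D (r, r *\<^sub>R Vg))) (at t)" by simp
  then have 1: "((\<lambda>s. snd d (f s (g s y))) has_derivative (\<lambda>r. D (r, r *\<^sub>R Vg))) (at t)"
    by (rule has_derivative_transform_within_open[OF _ near]) (simp add: coord_rep_def chart_inv_chart[OF ed(1)])
  have "((\<lambda>s. (s, ?x)) has_derivative (\<lambda>r. (r, 0))) (at t)" by (intro has_derivative_Pair) auto
  from has_derivative_compose[OF this, of ?\<Phi> D] D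
  have "((\<lambda>s. snd d (f s (g t y))) has_derivative (\<lambda>r. D (r, 0))) (at t)"
    by (simp add: coord_rep_def chart_inv_chart[OF ed(1) y(1)])
  then have "((\<lambda>s. snd d (f s (g t y))) has_vector_derivative D (1, 0)) (at t)"
    unfolding has_vector_derivative_def
    by (rule has_derivative_eq_rhs) (simp add: fun_eq_iff D.scaleR[symmetric])
  then have 2: "D (1, 0) = Vf" using Vf vector_derivative_unique_at by blast
  have "((\<lambda>x. (t, x)) has_derivative (\<lambda>v. (0, v))) (at ?x)" by (intro has_derivative_Pair) auto
  from has_derivative_compose[OF this, of ?\<Phi> D] D
  have "(coord_rep e d (f t) has_derivative (\<lambda>v. D (0, v))) (at ?x)" by simp
  from frechet_derivative_at[OF this] have 3: "coord_deriv e d (f t) ?x v = D (0, v)" for v by metis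
  have "D (r, r *\<^sub>R Vg) = r *\<^sub>R (Vf + coord_deriv e d (f t) ?x Vg)" for r
    using D.scaleR[of r "(1, 0) + (0, Vg)"] D.add[of "(1, 0)" "(0, Vg)"] by (simp add: 2 3)
  with 1 show ?thesis unfolding has_vector_derivative_def by simp
qed

text \<open>The velocity of the composition is the velocity of \<open>f\<close> plus the image under the derivative of \<open>f t\<close> of
the velocity of \<open>g\<close>. Paired by \<open>\<Omega>\<close> with the image of a tangent vector, the first part gives the
differential of \<open>E \<circ> g t\<close>, and the second one that of \<open>E'\<close> because \<open>f t\<close> preserves \<open>\<Omega>\<close>.\<close>

lemma pulled_back_compose:
  assumes f: "psmooth A f" "preserves_form A \<Omega> (f t)" "pulled_back A \<Omega> E f t"
    and g: "psmooth A g" "pulled_back A \<Omega> E' g t"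
  shows "pulled_back A \<Omega> (\<lambda>z. E (g t z) + E' z) (\<lambda>s. f s \<circ> g s) t"
  unfolding pulled_back_def
proof (intro allI ballI impI)
  fix y c d assume c: "c \<in> A" and d: "d \<in> A" and y: "y \<in> fst c" "(f t \<circ> g t) y \<in> fst d"
  obtain e where e: "e \<in> A" "g t y \<in> fst e" using chart_at by blast
  have fs: "smooth_map A (f t)" and gs: "smooth_map A (g t)" using f(1) g(1) psmooth_slice by blast+
  let ?xc = "snd c y" let ?xe = "snd e (g t y)" let ?xd = "snd d (f t (g t y))"
  let ?Df = "coord_deriv e d (f t) ?xe" let ?Dg = "coord_deriv c e (g t) ?xc"
  have ce: "?xc \<in> coord_dom c e (g t)" by (rule coord_domI[OF c y(1)]) (rule e(2))
  have edm: "?xe \<in> coord_dom e d (f t)" by (rule coord_domI[OF e]) (use y(2) in simp)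
  have re: "coord_rep c e (g t) ?xc = ?xe" unfolding coord_rep_def by (simp add: chart_inv_chart[OF c y(1)])
  have rd: "coord_rep e d (f t) ?xe = ?xd" unfolding coord_rep_def by (simp add: chart_inv_chart[OF e])
  obtain Vf where Vf: "((\<lambda>s. snd d (f s (g t y))) has_vector_derivative Vf) (at t)"
    and dE: "((\<lambda>z. E (chart_inv e z)) has_derivative (\<lambda>v. - \<Omega> d ?xd Vf (?Df v))) (at ?xe)"
    using f(3) e d y unfolding pulled_back_def by fastforce
  obtain Vg where Vg: "((\<lambda>s. snd e (g s y)) has_vector_derivative Vg) (at t)"
    and dE': "((\<lambda>z. E' (chart_inv c z)) has_derivative (\<lambda>v. - \<Omega> e ?xe Vg (?Dg v))) (at ?xc)"
    using g(2) e c y unfolding pulled_back_def by fastforce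
  let ?V = "Vf + ?Df Vg"
  have V: "((\<lambda>s. snd d ((f s \<circ> g s) y)) has_vector_derivative ?V) (at t)"
    using velocity_compose[OF f(1) g(1) e(1) d e(2) _ Vf Vg] y(2) by simp
  have "((\<lambda>z. E (chart_inv e (coord_rep c e (g t) z))) has_derivative (\<lambda>v. - \<Omega> d ?xd Vf (?Df (?Dg v)))) (at ?xc)"
    by (rule has_derivative_compose[OF coord_rep_has_derivative[OF gs c e(1) ce], where g = "\<lambda>z. E (chart_inv e z)"])
      (use dE re in simp)
  then have "((\<lambda>z. E (g t (chart_inv c z))) has_derivative (\<lambda>v. - \<Omega> d ?xd Vf (?Df (?Dg v)))) (at ?xc)"
    by (rule has_derivative_transform_within_open[OF _ open_coord_dom[OF smooth_map_continuous[OF gs] c e(1)] ce])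
      (simp add: chart_inv_coord_rep[OF e(1)])
  from has_derivative_add[OF this dE']
  have "((\<lambda>z. E (g t (chart_inv c z)) + E' (chart_inv c z)) has_derivative
      (\<lambda>v. - \<Omega> d ?xd Vf (?Df (?Dg v)) + - \<Omega> e ?xe Vg (?Dg v))) (at ?xc)" .
  moreover have "- \<Omega> d ?xd Vf (?Df (?Dg v)) + - \<Omega> e ?xe Vg (?Dg v) = - \<Omega> d ?xd ?V (coord_deriv c d (f t \<circ> g t) ?xc v)" for v
  proof -
    have "\<Omega> e ?xe Vg (?Dg v) = \<Omega> d ?xd (?Df Vg) (?Df (?Dg v))"
      using f(2) e(1) d edm rd unfolding preserves_form_def by metis
    moreover have "coord_deriv c d (f t \<circ> g t) ?xc v = ?Df (?Dg v)"
      using coord_deriv_compose[OF fs gs c d e(1) ce, unfolded re, OF edm] .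
    ultimately show ?thesis
      using bilinear_ladd[OF form_bilinear[OF d, of ?xd]] chart_mem[of "f t (g t y)" d] y(2) by simp
  qed
  ultimately show "\<exists>V. ((\<lambda>s. snd d ((f s \<circ> g s) y)) has_vector_derivative V) (at t) \<and>
       ((\<lambda>z. E (g t (chart_inv c z)) + E' (chart_inv c z)) has_derivative
          (\<lambda>v. - \<Omega> d (snd d ((f t \<circ> g t) y)) V (coord_deriv c d (f t \<circ> g t) ?xc v))) (at ?xc)"
    using V by (intro exI[of _ ?V]) simp
qed

lemma pulled_back_id: "pulled_back A \<Omega> (\<lambda>z. 0) (\<lambda>s. id) t"
  unfolding pulled_back_def
proof (intro allI ballI impI)
  fix y c d assume "c \<in> A" "d \<in> A" "y \<in> fst c" "id y \<in> fst d"
  then have "\<Omega> d (snd d y) 0 w = 0" for w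
    using bilinear_lzero[OF form_bilinear[OF \<open>d \<in> A\<close> chart_mem]] by simp
  then show "\<exists>V. ((\<lambda>s. snd d (id y)) has_vector_derivative V) (at t) \<and>
    ((\<lambda>z. 0) has_derivative (\<lambda>v. - \<Omega> d (snd d (id y)) V (coord_deriv c d id (snd c y) v))) (at (snd c y))"
    by (intro exI[of _ 0]) simp
qed

text \<open>A function with vanishing differential is locally constant, and the manifold is connected.\<close>

lemma zero_derivative_constant:
  fixes E :: "'y \<Rightarrow> real"
  assumes z: "\<And>c x. c \<in> A \<Longrightarrow> x \<in> chart_image c \<Longrightarrow> ((\<lambda>z. E (chart_inv c z)) has_derivative (\<lambda>v. 0)) (at x)"
  shows "E y = E y'"
proof -
  have "\<exists>N. open N \<and> y \<in> N \<and> (\<forall>z\<in>N. E z = E y)" for y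
  proof -
    obtain c where c: "c \<in> A" "y \<in> fst c" using chart_at by blast
    obtain e where e: "e > 0" "ball (snd c y) e \<subseteq> chart_image c"
      using open_contains_ball[of "chart_image c"] open_chart_image[OF c(1)] chart_mem[OF c(2)] by blast
    have "\<exists>k. \<forall>x\<in>ball (snd c y) e. E (chart_inv c x) = k"
      by (rule has_derivative_zero_constant[OF convex_ball]) (use z[OF c(1)] e(2) in \<open>blast intro: has_derivative_at_withinI\<close>)
    then obtain k where k: "\<And>x. x \<in> ball (snd c y) e \<Longrightarrow> E (chart_inv c x) = k" by blast
    let ?N = "fst c \<inter> snd c -` ball (snd c y) e"
    have "open ?N" by (rule continuous_open_preimage[OF continuous_chart[OF c(1)] open_chart_dom[OF c(1)] open_ball])
    moreover have "E z = k" if "z \<in> ?N" for z using k[of "snd c z"] that chart_inv_chart[OF c(1)] by auto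
    moreover have "y \<in> ?N" using c e by simp
    ultimately show ?thesis by metis
  qed
  then obtain N where N: "\<And>y. open (N y)" "\<And>y. y \<in> N y" "\<And>y z. z \<in> N y \<Longrightarrow> E z = E y" by metis
  have "open {z. P (E z)}" for P
  proof -
    have "{z. P (E z)} = (\<Union>y\<in>{z. P (E z)}. N y)" using N(2,3) by (auto; metis)
    then show ?thesis using N(1) by (metis open_UN)
  qed
  note this[of "\<lambda>r. r = E y"] this[of "\<lambda>r. r \<noteq> E y"]
  note o = this
  show ?thesis
  proof (rule ccontr)
    assume ne: "E y \<noteq> E y'"
    have "{z. E z = E y} \<inter> {z. E z \<noteq> E y} \<inter> UNIV = {}" "UNIV \<subseteq> {z. E z = E y} \<union> {z. E z \<noteq> E y}" by auto
    then have "{z. E z = E y} \<inter> UNIV = {} \<or> {z. E z \<noteq> E y} \<inter> UNIV = {}"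
      by (rule connectedD[OF connected_manifold o])
    moreover have "y \<in> {z. E z = E y} \<inter> UNIV" "y' \<in> {z. E z \<noteq> E y} \<inter> UNIV" using ne by auto
    ultimately show False by (metis empty_iff)
  qed
qed

lemma pulled_back_unique:
  assumes "pulled_back A \<Omega> E f t" "pulled_back A \<Omega> E' f t"
  shows "E y - E' y = E y' - E' y'"
proof (rule zero_derivative_constant)
  fix c x assume c: "c \<in> A" and x: "x \<in> chart_image c"
  let ?y = "chart_inv c x"
  have y: "?y \<in> fst c" "snd c ?y = x" using c x by (auto simp: chart_inv_mem chart_chart_inv)
  obtain d where d: "d \<in> A" "f t ?y \<in> fst d" using chart_at by blast
  obtain V where V: "((\<lambda>s. snd d (f s ?y)) has_vector_derivative V) (at t)"
    "((\<lambda>z. E (chart_inv c z)) has_derivative (\<lambda>v. - \<Omega> d (snd d (f t ?y)) V (coord_deriv c d (f t) x v))) (at x)"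
    using assms(1) c d y unfolding pulled_back_def by fastforce
  obtain V' where V': "((\<lambda>s. snd d (f s ?y)) has_vector_derivative V') (at t)"
    "((\<lambda>z. E' (chart_inv c z)) has_derivative (\<lambda>v. - \<Omega> d (snd d (f t ?y)) V' (coord_deriv c d (f t) x v))) (at x)"
    using assms(2) c d y unfolding pulled_back_def by fastforce
  have "V = V'" using V(1) V'(1) vector_derivative_unique_at by blast
  then show "((\<lambda>z. E (chart_inv c z) - E' (chart_inv c z)) has_derivative (\<lambda>v. 0)) (at x)"
    using has_derivative_diff[OF V(2) V'(2)] by simp
qed

section \<open>Integration over the manifold\<close>

sublocale vol: finite_measure vol by (rule vol_finite)

lemma measurable_vol: "f \<in> borel_measurable borel \<Longrightarrow> f \<in> borel_measurable vol"
  using measurable_cong_sets[OF sets_vol refl] by blast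

lemma continuous_bounded:
  assumes "continuous_on UNIV (F :: 'y \<Rightarrow> real)"
  shows "\<exists>B. \<forall>y. \<bar>F y\<bar> \<le> B"
  using compact_imp_bounded[OF compact_continuous_image[OF assms compact_manifold]]
  unfolding bounded_iff by auto

lemma integrable_vol:
  assumes "continuous_on UNIV (F :: 'y \<Rightarrow> real)"
  shows "integrable vol F"
proof -
  obtain B where "\<forall>y. \<bar>F y\<bar> \<le> B" using continuous_bounded[OF assms] by blast
  then show ?thesis
    by (intro vol.integrable_const_bound[of _ B] measurable_vol continuous_borel assms) auto
qed

lemma integral_symplectomorphism:
  assumes f: "symplectomorphism A \<Omega> f" and F: "continuous_on UNIV (F :: 'y \<Rightarrow> real)"
  shows "(\<integral>y. F (f y) \<partial>vol) = (\<integral>y. F y \<partial>vol)"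
proof -
  have "f \<in> measurable vol borel"
    using continuous_borel[OF smooth_map_continuous[OF symplectomorphism_props(2)[OF f]]]
      measurable_cong_sets[OF sets_vol refl] by blast
  then have "(\<integral>y. F y \<partial>distr vol borel f) = (\<integral>y. F (f y) \<partial>vol)"
    by (rule integral_distr[OF _ continuous_borel[OF F]])
  then show ?thesis by (simp add: vol_invariant[OF f])
qed

lemma constant_with_zero_integral:
  assumes "\<And>y y'. F y = F y'" "(\<integral>y. F y \<partial>vol) = (0::real)"
  shows "F y = 0"
proof -
  have "F = (\<lambda>z. F y)" using assms(1) by blast
  then have "(\<integral>z. F y \<partial>vol) = 0" using assms(2) by metis
  then have "measure vol (space vol) * F y = 0" by simp
  moreover have "measure vol (space vol) > 0"
    using vol_pos vol.emeasure_eq_measure[of UNIV] by (simp add: space_vol)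
  ultimately show ?thesis by simp
qed

section \<open>Normalized generators and lengths of loops\<close>

definition normalized_generator :: "(real \<Rightarrow> 'y \<Rightarrow> 'y) \<Rightarrow> (real \<Rightarrow> 'y \<Rightarrow> real) \<Rightarrow> bool" where
  "normalized_generator h H \<longleftrightarrow> generated_by A \<Omega> H h \<and> (\<forall>t. H (t + 1) = H t) \<and> (\<forall>t. (\<integral>y. H t y \<partial>vol) = 0)"

lemma generated_by_smooth: "generated_by A \<Omega> H h \<Longrightarrow> smooth_functions A H"
  unfolding generated_by_iff by blast

lemma generated_by_continuous:
  assumes "generated_by A \<Omega> H h"
  shows "continuous_on UNIV (H t)"
  using continuous_on_compose2[OF smooth_functions_continuous[OF generated_by_smooth[OF assms]], of UNIV "Pair t"]
  by (simp add: continuous_on_Pair continuous_on_const continuous_on_id)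

lemma generated_by_pulled_back:
  assumes "generated_by A \<Omega> H h" "smooth_map A (h t)"
  shows "pulled_back A \<Omega> (\<lambda>z. H t (h t z)) h t"
  using assms by (intro pulled_back_generated smooth_functions_slice) (auto simp: generated_by_iff)

lemma smooth_loop_props:
  assumes "smooth_loop A \<Omega> h"
  shows "psmooth A h" "symplectomorphism A \<Omega> (h t)" "smooth_map A (h t)" "h t \<in> Ham A \<Omega>" "h (t + 1) = h t"
  using assms Ham_symplectomorphism symplectomorphism_props(2)
  unfolding smooth_loop_def smooth_family_iff_psmooth by blast+

text \<open>Composed with \<open>h t\<close>, both functions have the same differential, so they differ by a constant, and
the normalization forces it to vanish. A single time suffices, which allows the comparison of a
generator with its shifts in time.\<close>

lemma generator_unique:
  assumes H: "generated_at A \<Omega> F h t" "continuous_on UNIV F" "(\<integral>y. F y \<partial>vol) = 0"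
      "\<And>c x. c \<in> A \<Longrightarrow> x \<in> chart_image c \<Longrightarrow> (\<lambda>z. F (chart_inv c z)) differentiable (at x)"
    and K: "generated_at A \<Omega> F' h t" "continuous_on UNIV F'" "(\<integral>y. F' y \<partial>vol) = 0"
      "\<And>c x. c \<in> A \<Longrightarrow> x \<in> chart_image c \<Longrightarrow> (\<lambda>z. F' (chart_inv c z)) differentiable (at x)"
    and h: "symplectomorphism A \<Omega> (h t)"
  shows "F = F'"
proof -
  have hs: "bij (h t)" "smooth_map A (h t)" using symplectomorphism_props[OF h] by auto
  have c: "F (h t y) - F' (h t y) = F (h t y') - F' (h t y')" for y y'
    using pulled_back_unique[OF pulled_back_generated[OF H(1) hs(2) H(4)] pulled_back_generated[OF K(1) hs(2) K(4)]] .
  have "F y - F' y = F y' - F' y'" for y y'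
    using c bij_is_surj[OF hs(1)] by (metis surjD)
  then have "F y - F' y = 0" for y
    using H K by (intro constant_with_zero_integral[of "\<lambda>y. F y - F' y"]) (auto simp: integrable_vol)
  then show ?thesis by (simp add: fun_eq_iff)
qed

lemma normalized_generator_unique:
  assumes "smooth_loop A \<Omega> h" "normalized_generator h H" "normalized_generator h H'"
  shows "H = H'"
proof
  fix t
  show "H t = H' t"
    using assms smooth_loop_props(2)[OF assms(1)]
    by (intro generator_unique[of _ h t] generated_by_continuous[of _ h] smooth_functions_slice)
      (auto simp: normalized_generator_def generated_by_iff)
qed

lemma loop_hamiltonian_eq:
  assumes "smooth_loop A \<Omega> h" "normalized_generator h H"
  shows "loop_hamiltonian A \<Omega> h = H"
  unfolding loop_hamiltonian_def symplectic_volume_eq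
  using the_equality[of "normalized_generator h" H] normalized_generator_unique[OF assms(1) _ assms(2)] assms(2)
  unfolding normalized_generator_def by blast

text \<open>If no normalized generator exists, then the definite description in \<open>loop_hamiltonian\<close> is that of
an unsatisfiable property. Its value is unspecified, but the same for all such loops, and so is their
length.\<close>

definition default_length :: real where
  "default_length = integral {0..1} (\<lambda>t. SUP y::'y. \<bar>(THE H :: real \<Rightarrow> 'y \<Rightarrow> real. False) t y\<bar>)"

lemma hofer_length_default:
  assumes "\<nexists>H. normalized_generator h H"
  shows "hofer_length A \<Omega> h = default_length"
proof -
  have "loop_hamiltonian A \<Omega> h = (THE H. False)"
    unfolding loop_hamiltonian_def symplectic_volume_eq
    using assms unfolding normalized_generator_def by (intro arg_cong[where f = The] ext) blast
  then show ?thesis unfolding hofer_length_def default_length_def by simp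
qed

lemma hofer_length_bounds:
  assumes "smooth_loop A \<Omega> h" "normalized_generator h H"
  shows "0 \<le> hofer_length A \<Omega> h"
    and "(\<And>t y. \<bar>H t y\<bar> \<le> B) \<Longrightarrow> hofer_length A \<Omega> h \<le> B"
proof -
  have H: "hofer_length A \<Omega> h = integral {0..1} (\<lambda>t. SUP y. \<bar>H t y\<bar>)"
    unfolding hofer_length_def loop_hamiltonian_eq[OF assms] ..
  have nn: "0 \<le> (SUP y. \<bar>H t y\<bar>)" for t
  proof -
    have "bdd_above (range (\<lambda>y. \<bar>H t y\<bar>))"
      using continuous_bounded[OF generated_by_continuous] assms(2)
      unfolding normalized_generator_def bdd_above_def by blast
    then have "\<bar>H t undefined\<bar> \<le> (SUP y. \<bar>H t y\<bar>)" by (rule cSUP_upper[OF UNIV_I])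
    then show ?thesis by linarith
  qed
  \<comment> \<open>Where the maximum is not integrable in time, the integral is zero by convention.\<close>
  show "0 \<le> hofer_length A \<Omega> h"
    unfolding H
    by (cases "(\<lambda>t. SUP y. \<bar>H t y\<bar>) integrable_on {0..1}") (auto simp: nn not_integrable_integral intro: integral_nonneg)
  assume B: "\<And>t y. \<bar>H t y\<bar> \<le> B"
  then have le: "(SUP y. \<bar>H t y\<bar>) \<le> B" for t by (intro cSUP_least) auto
  have "0 \<le> B" using nn le order_trans by blast
  show "hofer_length A \<Omega> h \<le> B"
  proof (cases "(\<lambda>t. SUP y. \<bar>H t y\<bar>) integrable_on {0..1}")
    case True
    have "integral {0..1} (\<lambda>t. SUP y. \<bar>H t y\<bar>) \<le> integral {0..1} (\<lambda>t::real. B)"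
      by (rule integral_le[OF True]) (auto simp: le)
    then show ?thesis unfolding H by simp
  next
    case False
    then show ?thesis unfolding H using \<open>0 \<le> B\<close> by (simp add: not_integrable_integral)
  qed
qed

lemma hofer_length_lower:
  assumes "smooth_loop A \<Omega> h"
  shows "min 0 default_length \<le> hofer_length A \<Omega> h"
  using hofer_length_default[of h] hofer_length_bounds(1)[OF assms]
  by (cases "\<exists>H. normalized_generator h H") (auto simp: min_le_iff_disj)

section \<open>Loops that run with multiple speed\<close>

lemma smooth_loop_speed:
  assumes h: "smooth_loop A \<Omega> h"
  shows "smooth_loop A \<Omega> (\<lambda>t. h (real k * t))"
  unfolding smooth_loop_def smooth_family_iff_psmooth
proof (intro conjI allI)
  have per: "h (t + real n) = h t" for t n
    by (induction n) (use smooth_loop_props(5)[OF h] in \<open>auto simp: add.assoc[symmetric] add.commute[of 1]\<close>)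
  show "h (real k * (t + 1)) = h (real k * t)" for t
    using per[of "real k * t" k] by (simp add: algebra_simps)
  show "h (real k * t) \<in> Ham A \<Omega>" for t using smooth_loop_props(4)[OF h] .
  show "psmooth A (\<lambda>t. h (real k * t))"
    by (rule psmooth_reparam[OF smooth_loop_props(1)[OF h] smooth_on_linear[OF open_UNIV bounded_linear_mult_right]])
qed

text \<open>A generator \<open>K\<close> of \<open>t \<mapsto> h (k t)\<close> yields the generator \<open>K (t / k) / k\<close> of \<open>h\<close>. A priori it has period \<open>k\<close>;
as \<open>h\<close> has period \<open>1\<close>, the uniqueness of normalized generators shows that it has period \<open>1\<close> as well.\<close>

lemma normalized_generator_slow_down:
  assumes h: "smooth_loop A \<Omega> h" and k: "k > 0" and K: "normalized_generator (\<lambda>t. h (real k * t)) K"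
  shows "\<exists>H. normalized_generator h H"
proof -
  have KD: "generated_by A \<Omega> K (\<lambda>t. h (real k * t))" "\<And>t. (\<integral>y. K t y \<partial>vol) = 0"
    using K unfolding normalized_generator_def by auto
  define H where "H t y = (1 / real k) * K ((1 / real k) * t) y" for t y
  have g: "generated_by A \<Omega> (\<lambda>t y. (1 / real k) * K ((1 / real k) * t) y) (\<lambda>t. h (real k * ((1 / real k) * t)))"
    by (rule generated_by_reparam[OF KD(1) smooth_on_linear[OF open_UNIV bounded_linear_mult_right] smooth_on_const])
      (use k in \<open>auto intro!: derivative_eq_intros\<close>)
  then have gH: "generated_by A \<Omega> H h" unfolding H_def[abs_def] using k by simp
  have n: "(\<integral>y. H t y \<partial>vol) = 0" for t unfolding H_def using KD(2) by simp
  have "H (t + 1) = H t" for t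
  proof (rule generator_unique[of _ h t])
    have "generated_at A \<Omega> (H (t + 1)) h (t + 1)" using gH unfolding generated_by_iff by blast
    then have "generated_at A \<Omega> (\<lambda>y. 1 * H (t + 1) y) (\<lambda>s. h (s + 1)) t"
      by (intro generated_at_reparam[where \<theta> = "\<lambda>s. s + 1"] smooth_functions_slice[OF generated_by_smooth[OF gH]])
        (auto intro!: derivative_eq_intros)
    then show "generated_at A \<Omega> (H (t + 1)) h t" using smooth_loop_props(5)[OF h] by simp
    show "generated_at A \<Omega> (H t) h t" using gH unfolding generated_by_iff by blast
  qed (use n generated_by_continuous[OF gH] smooth_functions_slice[OF generated_by_smooth[OF gH]] smooth_loop_props(2)[OF h] in auto)
  then show ?thesis using gH n unfolding normalized_generator_def by blast
qed

section \<open>Iterated skew products\<close>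

lemma psmooth_skew_iterate:
  assumes "psmooth A h"
  shows "psmooth A (skew_iterate h \<alpha> k)"
proof (induction k)
  case 0
  have "skew_iterate h \<alpha> 0 = (\<lambda>t. id)" by (simp add: fun_eq_iff)
  then show ?case using psmooth_const[OF smooth_map_id] by metis
next
  case (Suc k)
  have "psmooth A (\<lambda>t. h (real k * \<alpha> + 1 * t))" by (rule psmooth_reparam[OF assms smooth_on_affine])
  from psmooth_compose[OF this Suc]
  have "psmooth A (\<lambda>t. h (t + real k * \<alpha>) \<circ> skew_iterate h \<alpha> k t)" by (simp add: add.commute)
  moreover have "skew_iterate h \<alpha> (Suc k) = (\<lambda>t. h (t + real k * \<alpha>) \<circ> skew_iterate h \<alpha> k t)" by (simp add: fun_eq_iff)
  ultimately show ?case by metis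
qed

lemma smooth_loop_skew_iterate:
  assumes h: "smooth_loop A \<Omega> h"
  shows "smooth_loop A \<Omega> (skew_iterate h \<alpha> k)"
proof -
  have id: "id \<in> Ham A \<Omega>" using id_in_Ham[OF smooth_loop_props(4)[OF h]] .
  have "skew_iterate h \<alpha> k (t + 1) = skew_iterate h \<alpha> k t" for t
    using smooth_loop_props(5)[OF h] by (induction k) (auto simp: add.assoc add.commute[of 1], simp add: add.assoc[symmetric])
  moreover have "skew_iterate h \<alpha> k t \<in> Ham A \<Omega>" for t
    using smooth_loop_props(4)[OF h] id by (induction k) (auto intro: Ham_compose)
  ultimately show ?thesis
    using psmooth_skew_iterate[OF smooth_loop_props(1)[OF h]] unfolding smooth_loop_def smooth_family_iff_psmooth by blast
qed

text \<open>The Hamiltonian of the iterated loop along a trajectory is a Birkhoff sum of the function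
\<open>(t, y) \<mapsto> H t (h t y)\<close> for the skew product. Indeed both sides are Hamiltonians of the same motion in
terms of the starting point \<open>z\<close>, hence differ by a constant, and both have integral zero because all
maps involved preserve the volume.\<close>

lemma skew_iterate_generator:
  assumes h: "smooth_loop A \<Omega> h" and H: "normalized_generator h H"
    and K: "normalized_generator (skew_iterate h \<alpha> k) K"
  shows "K t (skew_iterate h \<alpha> k t z) =
    (\<Sum>j<k. H (t + real j * \<alpha>) (h (t + real j * \<alpha>) (skew_iterate h \<alpha> j t z)))"
proof -
  let ?it = "skew_iterate h \<alpha>"
  let ?E = "\<lambda>k z. \<Sum>j<k. H (t + real j * \<alpha>) (h (t + real j * \<alpha>) (?it j t z))"
  note it = smooth_loop_props[OF smooth_loop_skew_iterate[OF h, of \<alpha>]]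
  note hp = smooth_loop_props[OF h]
  have gH: "generated_by A \<Omega> H h" and nH: "\<And>t. (\<integral>y. H t y \<partial>vol) = 0"
    and gK: "generated_by A \<Omega> K (?it k)" and nK: "(\<integral>y. K t y \<partial>vol) = 0"
    using H K unfolding normalized_generator_def by auto
  have pb: "pulled_back A \<Omega> (?E k) (?it k) t" for k
  proof (induction k)
    case 0
    have "skew_iterate h \<alpha> 0 = (\<lambda>t. id)" by (simp add: fun_eq_iff)
    then show ?case using pulled_back_id by (simp only: lessThan_0 sum.empty)
  next
    case (Suc k)
    let ?a = "real k * \<alpha>"
    have ps: "psmooth A (\<lambda>s. h (s + ?a))"
      using psmooth_reparam[OF hp(1) smooth_on_affine[of ?a 1]] by (simp add: add.commute)
    have "generated_at A \<Omega> (\<lambda>y. 1 * H (t + ?a) y) (\<lambda>s. h (s + ?a)) t"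
      by (rule generated_at_reparam[where \<theta> = "\<lambda>s. s + ?a"])
        (use gH in \<open>auto simp: generated_by_iff intro!: derivative_eq_intros smooth_functions_slice\<close>)
    then have "pulled_back A \<Omega> (\<lambda>z. H (t + ?a) (h (t + ?a) z)) (\<lambda>s. h (s + ?a)) t"
      using pulled_back_generated[of "H (t + ?a)" "\<lambda>s. h (s + ?a)" t] hp(3) smooth_functions_slice[OF generated_by_smooth[OF gH]]
      by simp
    from pulled_back_compose[OF ps symplectomorphism_props(4)[OF hp(2)] this it(1) Suc]
    moreover have "skew_iterate h \<alpha> (Suc k) = (\<lambda>s. h (s + ?a) \<circ> skew_iterate h \<alpha> k s)" by (simp add: fun_eq_iff)
    ultimately show ?case by (simp only: sum.lessThan_Suc add.commute)
  qed
  have cE: "continuous_on UNIV (\<lambda>z. H (t + real j * \<alpha>) (h (t + real j * \<alpha>) (?it j t z)))" for j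
    by (intro continuous_on_compose2[OF generated_by_continuous[OF gH]] continuous_on_compose2[OF smooth_map_continuous[OF hp(3)]]
        smooth_map_continuous[OF it(3)]) auto
  have iE: "(\<integral>z. H (t + real j * \<alpha>) (h (t + real j * \<alpha>) (?it j t z)) \<partial>vol) = 0" for j
  proof -
    have "(\<integral>z. H (t + real j * \<alpha>) ((h (t + real j * \<alpha>) \<circ> ?it j t) z) \<partial>vol) = (\<integral>z. H (t + real j * \<alpha>) z \<partial>vol)"
      by (rule integral_symplectomorphism[OF symplectomorphism_compose[OF hp(2) it(2)] generated_by_continuous[OF gH]])
    then show ?thesis using nH by simp
  qed
  have cK: "continuous_on UNIV (\<lambda>z. K t (?it k t z))"
    by (intro continuous_on_compose2[OF generated_by_continuous[OF gK]] smooth_map_continuous[OF it(3)]) auto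
  have iK: "(\<integral>z. K t (?it k t z) \<partial>vol) = 0"
    using integral_symplectomorphism[OF it(2) generated_by_continuous[OF gK]] nK by simp
  have iS: "(\<integral>z. ?E k z \<partial>vol) = 0"
    by (subst Bochner_Integration.integral_sum) (use integrable_vol[OF cE] iE in simp_all)
  have "K t (?it k t z) - ?E k z = 0"
  proof (rule constant_with_zero_integral[of "\<lambda>z. K t (?it k t z) - ?E k z"])
    show "K t (?it k t y) - ?E k y = K t (?it k t y') - ?E k y'" for y y'
      by (rule pulled_back_unique[OF generated_by_pulled_back[OF gK it(3)] pb])
    show "(\<integral>z. K t (?it k t z) - ?E k z \<partial>vol) = 0"
      using cE cK iS iK by (subst Bochner_Integration.integral_diff) (auto intro!: integrable_vol Bochner_Integration.integrable_sum)
  qed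
  then show ?thesis by simp
qed

lemma hofer_length_skew_iterate:
  assumes h: "smooth_loop A \<Omega> h" and H: "normalized_generator h H"
    and B: "\<And>t z. \<bar>\<Sum>j<k. H (t + real j * \<alpha>) (h (t + real j * \<alpha>) (skew_iterate h \<alpha> j t z))\<bar> \<le> B"
  shows "hofer_length A \<Omega> (skew_iterate h \<alpha> k) \<le> max B default_length"
proof (cases "\<exists>K. normalized_generator (skew_iterate h \<alpha> k) K")
  case True
  then obtain K where K: "normalized_generator (skew_iterate h \<alpha> k) K" by blast
  note it = smooth_loop_skew_iterate[OF h, of \<alpha> k]
  have "\<bar>K t y\<bar> \<le> B" for t y
  proof -
    obtain z where "y = skew_iterate h \<alpha> k t z"
      using bij_is_surj[OF symplectomorphism_props(1)[OF smooth_loop_props(2)[OF it]]] by (metis surjD)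
    then show ?thesis using skew_iterate_generator[OF h H K] B by metis
  qed
  then show ?thesis using hofer_length_bounds(2)[OF it K] by fastforce
next
  case False
  then show ?thesis using hofer_length_default by fastforce
qed

end


section \<open>Smooth families are continuous\<close>

lemma iter_deriv_slice:
  assumes W: "open W"
  shows "smooth_on W \<Phi> \<Longrightarrow> (p, x) \<in> W \<Longrightarrow>
    iter_deriv (\<lambda>x. \<Phi> (p, x)) vs x = iter_deriv \<Phi> (map (Pair 0) vs) (p, x)"
proof (induction vs arbitrary: \<Phi>)
  case (Cons v vs)
  let ?Wp = "Pair p -` W"
  have o: "open ?Wp" by (intro open_vimage W) (auto intro!: continuous_intros)
  have e: "frechet_derivative (\<lambda>x. \<Phi> (p, x)) (at z) v = frechet_derivative \<Phi> (at (p, z)) (0, v)" if "z \<in> ?Wp" for z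
  proof -
    have "(\<Phi> has_derivative frechet_derivative \<Phi> (at (p, z))) (at (p, z))"
      using smooth_on_imp_has_derivative[OF Cons.prems(1)] that by simp
    moreover have "((\<lambda>x. (p, x)) has_derivative (\<lambda>v. (0, v))) (at z)" by (intro has_derivative_Pair) auto
    ultimately have "((\<lambda>x. \<Phi> (p, x)) has_derivative (\<lambda>v. frechet_derivative \<Phi> (at (p, z)) (0, v))) (at z)"
      by (rule has_derivative_compose[rotated])
    from frechet_derivative_at[OF this] show ?thesis by metis
  qed
  have s: "smooth_on W (\<lambda>z. frechet_derivative \<Phi> (at z) (0, v))"
    using smooth_on_iter_deriv[OF Cons.prems(1), of "[(0, v)]"] by simp
  have "iter_deriv (\<lambda>x. \<Phi> (p, x)) (v # vs) x = iter_deriv (\<lambda>z. frechet_derivative \<Phi> (at (p, z)) (0, v)) vs x"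
    unfolding iter_deriv.simps by (rule iter_deriv_cong[OF o e]) (use Cons.prems in auto)
  also have "\<dots> = iter_deriv \<Phi> (map (Pair 0) (v # vs)) (p, x)"
    using Cons.IH[OF s Cons.prems(2)] by simp
  finally show ?case .
qed simp

lemma open_tube:
  fixes W :: "('p::topological_space \<times> 'q::topological_space) set"
  assumes "open W" "compact K"
  shows "open {p. \<forall>x\<in>K. (p, x) \<in> W}"
proof (rule Topological_Spaces.openI)
  fix p assume "p \<in> {p. \<forall>x\<in>K. (p, x) \<in> W}"
  then have "{p} \<times> K \<subseteq> W" by blast
  then obtain U V where "open U" "p \<in> U" "K \<subseteq> V" "U \<times> V \<subseteq> W"
    using tube_lemma_right[of euclidean euclidean W K p] assms by auto
  then show "\<exists>T. open T \<and> p \<in> T \<and> T \<subseteq> {p. \<forall>x\<in>K. (p, x) \<in> W}" by (intro exI[of _ U]) blast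
qed

text \<open>The conditions that define a neighbourhood are finitely many strict inequalities between functions
that are jointly continuous in the parameter and in a point of a compact set, so they are open in the
parameter.\<close>

lemma (in smooth_manifold) psmooth_open_smooth_nhd:
  fixes F :: "'p::euclidean_space \<Rightarrow> 'y \<Rightarrow> 'y"
  assumes F: "psmooth A F" and f: "smooth_map A f" and cd: "c \<in> A" "d \<in> A"
    and K: "compact K" "K \<subseteq> fst c" "f ` K \<subseteq> fst d"
  shows "open {p. F p \<in> smooth_nhd A f c d K r \<epsilon>}"
proof -
  let ?K = "snd c ` K"
  let ?W = "{(p, x). x \<in> coord_dom c d (F p)}"
  let ?\<Phi> = "\<lambda>(p, x). coord_rep c d (F p) x"
  let ?vs = "{vs :: (real ^ 'n) list. set vs \<subseteq> Basis \<and> length vs \<le> r}"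
  let ?g = "\<lambda>vs z. norm (iter_deriv ?\<Phi> (map (Pair 0) vs) z - iter_deriv (coord_rep c d f) vs (snd z))"
  let ?W' = "?W \<inter> (UNIV \<times> coord_dom c d f)"
  let ?V = "\<lambda>vs. {z \<in> ?W'. ?g vs z < \<epsilon>}"
  have cK: "compact ?K"
    using compact_continuous_image[OF continuous_on_subset[OF continuous_chart[OF cd(1)] K(2)] K(1)] .
  have oW: "open ?W" by (rule open_coord_dom_family[OF psmooth_continuous[OF F] cd])
  have of: "open (coord_dom c d f)" by (rule open_coord_dom[OF smooth_map_continuous[OF f] cd])
  have oW': "open ?W'" by (intro open_Int oW open_Times open_UNIV of)
  have oV: "open (?V vs)" for vs
  proof -
    have "continuous_on ?W' (iter_deriv ?\<Phi> (map (Pair 0) vs))"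
      by (rule continuous_on_subset[OF smooth_on_imp_continuous_on[OF smooth_on_iter_deriv[OF psmooth_smooth_on[OF F cd]]]]) blast
    moreover have "continuous_on (coord_dom c d f) (iter_deriv (coord_rep c d f) vs)"
      using f cd unfolding smooth_map_def by (blast intro: smooth_on_imp_continuous_on smooth_on_iter_deriv)
    then have "continuous_on ?W' (\<lambda>z. iter_deriv (coord_rep c d f) vs (snd z))"
      by (rule continuous_on_compose2) (auto intro!: continuous_intros)
    ultimately have "continuous_on ?W' (?g vs)" by (intro continuous_intros)
    from continuous_open_preimage[OF this oW', of "{..<\<epsilon>}"] show ?thesis
      by (simp add: vimage_def Int_def conj_assoc)
  qed
  have "finite ?vs" by (rule finite_lists_length_le) simp
  then have o: "open (\<Inter>vs\<in>?vs. {p. \<forall>x\<in>?K. (p, x) \<in> ?V vs})"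
    by (intro open_INT ballI open_tube oV cK)
  have dom: "snd c y \<in> coord_dom c d f" "(p, snd c y) \<in> ?W \<longleftrightarrow> F p y \<in> fst d" if "y \<in> K" for y p
    using that K by (auto simp: coord_dom_iff chart_inv_chart[OF cd(1)] chart_mem subset_iff)
  have sl: "iter_deriv (coord_rep c d (F p)) vs x = iter_deriv ?\<Phi> (map (Pair 0) vs) (p, x)" if "(p, x) \<in> ?W" for p x vs
    using iter_deriv_slice[OF oW psmooth_smooth_on[OF F cd] that] by simp
  have iff: "F p \<in> smooth_nhd A f c d K r \<epsilon> \<longleftrightarrow> p \<in> (\<Inter>vs\<in>?vs. {p. \<forall>x\<in>?K. (p, x) \<in> ?V vs})" for p
  proof
    assume l: "F p \<in> smooth_nhd A f c d K r \<epsilon>"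
    show "p \<in> (\<Inter>vs\<in>?vs. {p. \<forall>x\<in>?K. (p, x) \<in> ?V vs})"
    proof (intro INT_I CollectI ballI)
      fix vs x assume vs: "vs \<in> ?vs" and x: "x \<in> ?K"
      obtain y where y: "y \<in> K" "x = snd c y" using x by blast
      have W: "(p, x) \<in> ?W" using l y dom(2)[of y p] unfolding smooth_nhd_def by blast
      have "norm (iter_deriv (coord_rep c d (F p)) vs x - iter_deriv (coord_rep c d f) vs x) < \<epsilon>"
        using l vs x unfolding smooth_nhd_def by blast
      then show "(p, x) \<in> ?W' \<and> ?g vs (p, x) < \<epsilon>"
        using W dom(1)[OF y(1)] y(2) sl[OF W] by auto
    qed
  next
    assume r: "p \<in> (\<Inter>vs\<in>?vs. {p. \<forall>x\<in>?K. (p, x) \<in> ?V vs})"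
    have W: "(p, x) \<in> ?W" if "x \<in> ?K" for x
    proof -
      have "([] :: (real ^ 'n) list) \<in> ?vs" by simp
      with r have "\<forall>x\<in>?K. (p, x) \<in> ?V []" by blast
      with that show ?thesis by blast
    qed
    have "F p ` K \<subseteq> fst d" using W dom(2) by blast
    moreover have "norm (iter_deriv (coord_rep c d (F p)) vs x - iter_deriv (coord_rep c d f) vs x) < \<epsilon>"
      if "vs \<in> ?vs" "x \<in> ?K" for vs x
      using r that sl[OF W[OF that(2)]] by auto
    ultimately show "F p \<in> smooth_nhd A f c d K r \<epsilon>"
      unfolding smooth_nhd_def using psmooth_slice[OF F] by blast
  qed
  show ?thesis unfolding iff Collect_mem_eq by (rule o)
qed

text \<open>This turns continuous maps from the unit square into a parameter plane into homotopies of loops in the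
group with its \<open>C\<close>-infinity topology.\<close>

lemma (in smooth_manifold) psmooth_continuous_map:
  fixes F :: "'p::euclidean_space \<Rightarrow> 'y \<Rightarrow> 'y"
  assumes F: "psmooth A F" and H: "\<And>p. F p \<in> Ham A \<Omega>"
  shows "continuous_map euclidean (Ham_topology A \<Omega>) F"
  unfolding Ham_topology_def continuous_map_in_subtopology
proof
  show "continuous_map euclidean (smooth_topology A) F"
    unfolding smooth_topology_def
  proof (rule continuous_on_generated_topo)
    fix U assume "U \<in> {smooth_nhd A f c d K r \<epsilon> | f c d K r \<epsilon>. smooth_map A f \<and> c \<in> A \<and> d \<in> A \<and>
        compact K \<and> K \<subseteq> fst c \<and> f ` K \<subseteq> fst d \<and> 0 < \<epsilon>}"
    then obtain f c d K r \<epsilon> where U: "U = smooth_nhd A f c d K r \<epsilon>" "smooth_map A f" "c \<in> A" "d \<in> A"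
      "compact K" "K \<subseteq> fst c" "f ` K \<subseteq> fst d" by blast
    show "openin euclidean (F -` U \<inter> topspace euclidean)"
      using psmooth_open_smooth_nhd[OF F U(2-7), of r \<epsilon>] unfolding U(1) by (simp add: vimage_def)
  next
    obtain c where c: "c \<in> A" using chart_at by blast
    show "F ` topspace euclidean \<subseteq> \<Union> {smooth_nhd A f c d K r \<epsilon> | f c d K r \<epsilon>. smooth_map A f \<and> c \<in> A \<and> d \<in> A \<and>
        compact K \<and> K \<subseteq> fst c \<and> f ` K \<subseteq> fst d \<and> 0 < \<epsilon>}" (is "_ \<subseteq> \<Union> ?S")
    proof (rule image_subsetI)
      fix p
      have s: "smooth_map A (F p)" by (rule psmooth_slice[OF F])
      \<comment> \<open>For the empty compact set the inequalities are void.\<close>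
      have "F p \<in> smooth_nhd A (F p) c c {} 0 1" using s unfolding smooth_nhd_def by simp
      moreover have "smooth_nhd A (F p) c c {} 0 1 \<in> ?S"
      proof (intro CollectI exI conjI)
        show "smooth_nhd A (F p) c c {} 0 1 = smooth_nhd A (F p) c c {} 0 1" by (rule refl)
      qed (use s c in simp_all)
      ultimately show "F p \<in> \<Union> ?S" by (rule UnionI[rotated])
    qed
  qed
  show "F \<in> topspace euclidean \<rightarrow> Ham A \<Omega>" using H by auto
qed

section \<open>Loops up to homotopy\<close>

abbreviation unit_square :: "(real \<times> real) topology" where
  "unit_square \<equiv> top_of_set ({0..1} \<times> {0..1})"

abbreviation free_homotopic :: "'a topology \<Rightarrow> (real \<Rightarrow> 'a) \<Rightarrow> (real \<Rightarrow> 'a) \<Rightarrow> bool" where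
  "free_homotopic X \<equiv> homotopic_with (\<lambda>r. r 0 = r 1) (top_of_set {0..1}) X"

abbreviation based_homotopic :: "'a topology \<Rightarrow> 'a \<Rightarrow> (real \<Rightarrow> 'a) \<Rightarrow> (real \<Rightarrow> 'a) \<Rightarrow> bool" where
  "based_homotopic X a \<equiv> homotopic_with (\<lambda>r. r 0 = a \<and> r 1 = a) (top_of_set {0..1}) X"

lemma unit_square_eq: "prod_topology (top_of_set {0..1::real}) (top_of_set {0..1::real}) = unit_square"
  using subtopology_Times[of euclidean euclidean "{0..1::real}" "{0..1::real}"] by simp

lemma homotopic_loops_iff:
  assumes "\<And>r r' :: real \<Rightarrow> 'a. r 0 = r' 0 \<Longrightarrow> r 1 = r' 1 \<Longrightarrow> P r = P r'"
  shows "homotopic_with P (top_of_set {0..1}) X p q \<longleftrightarrow>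
    (\<exists>K. continuous_map unit_square X (\<lambda>(s, t). K s t) \<and>
      (\<forall>t\<in>{0..1}. K 0 t = p t \<and> K 1 t = q t) \<and> (\<forall>s\<in>{0..1}. P (K s)))"
proof -
  have "homotopic_with P (top_of_set {0..1}) X p q \<longleftrightarrow>
    (\<exists>h. continuous_map unit_square X h \<and> (\<forall>x\<in>topspace (top_of_set {0..1}). h (0, x) = p x) \<and>
       (\<forall>x\<in>topspace (top_of_set {0..1}). h (1, x) = q x) \<and> (\<forall>t\<in>{0..1}. P (\<lambda>x. h (t, x))))"
    unfolding unit_square_eq[symmetric]
    by (rule homotopic_with) (rule assms, simp_all)
  also have "\<dots> \<longleftrightarrow> (\<exists>K. continuous_map unit_square X (\<lambda>(s, t). K s t) \<and>
      (\<forall>t\<in>{0..1}. K 0 t = p t \<and> K 1 t = q t) \<and> (\<forall>s\<in>{0..1}. P (K s)))"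
  proof
    assume "\<exists>h. continuous_map unit_square X h \<and> (\<forall>x\<in>topspace (top_of_set {0..1}). h (0, x) = p x) \<and>
       (\<forall>x\<in>topspace (top_of_set {0..1}). h (1, x) = q x) \<and> (\<forall>t\<in>{0..1}. P (\<lambda>x. h (t, x)))"
    then obtain h where "continuous_map unit_square X h \<and> (\<forall>x\<in>topspace (top_of_set {0..1}). h (0, x) = p x) \<and>
       (\<forall>x\<in>topspace (top_of_set {0..1}). h (1, x) = q x) \<and> (\<forall>t\<in>{0..1}. P (\<lambda>x. h (t, x)))" by blast
    then show "\<exists>K. continuous_map unit_square X (\<lambda>(s, t). K s t) \<and>
      (\<forall>t\<in>{0..1}. K 0 t = p t \<and> K 1 t = q t) \<and> (\<forall>s\<in>{0..1}. P (K s))"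
      by (intro exI[of _ "\<lambda>s t. h (s, t)"]) simp
  next
    assume "\<exists>K. continuous_map unit_square X (\<lambda>(s, t). K s t) \<and>
      (\<forall>t\<in>{0..1}. K 0 t = p t \<and> K 1 t = q t) \<and> (\<forall>s\<in>{0..1}. P (K s))"
    then obtain K where "continuous_map unit_square X (\<lambda>(s, t). K s t) \<and>
      (\<forall>t\<in>{0..1}. K 0 t = p t \<and> K 1 t = q t) \<and> (\<forall>s\<in>{0..1}. P (K s))" by blast
    then show "\<exists>h. continuous_map unit_square X h \<and> (\<forall>x\<in>topspace (top_of_set {0..1}). h (0, x) = p x) \<and>
       (\<forall>x\<in>topspace (top_of_set {0..1}). h (1, x) = q x) \<and> (\<forall>t\<in>{0..1}. P (\<lambda>x. h (t, x)))"
      by (intro exI[of _ "\<lambda>(s, t). K s t"]) simp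
  qed
  finally show ?thesis .
qed

lemma free_homotopicI:
  assumes "continuous_map unit_square X (\<lambda>(s, t). K s t)" "\<And>s. s \<in> {0..1} \<Longrightarrow> K s 0 = K s 1"
    "\<And>t. t \<in> {0..1} \<Longrightarrow> K 0 t = p t" "\<And>t. t \<in> {0..1} \<Longrightarrow> K 1 t = q t"
  shows "free_homotopic X p q"
  by (subst homotopic_loops_iff) (use assms in auto)

lemma free_homotopicE:
  assumes "free_homotopic X p q"
  obtains K where "continuous_map unit_square X (\<lambda>(s, t). K s t)" "\<And>s. s \<in> {0..1} \<Longrightarrow> K s 0 = K s 1"
    "\<And>t. t \<in> {0..1} \<Longrightarrow> K 0 t = p t" "\<And>t. t \<in> {0..1} \<Longrightarrow> K 1 t = q t"
  using assms by (subst (asm) homotopic_loops_iff) auto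

lemma based_homotopicI:
  assumes "continuous_map unit_square X (\<lambda>(s, t). K s t)" "\<And>s. s \<in> {0..1} \<Longrightarrow> K s 0 = a" "\<And>s. s \<in> {0..1} \<Longrightarrow> K s 1 = a"
    "\<And>t. t \<in> {0..1} \<Longrightarrow> K 0 t = p t" "\<And>t. t \<in> {0..1} \<Longrightarrow> K 1 t = q t"
  shows "based_homotopic X a p q"
  by (subst homotopic_loops_iff) (use assms in auto)

lemma based_homotopicE:
  assumes "based_homotopic X a p q"
  obtains K where "continuous_map unit_square X (\<lambda>(s, t). K s t)" "\<And>s. s \<in> {0..1} \<Longrightarrow> K s 0 = a" "\<And>s. s \<in> {0..1} \<Longrightarrow> K s 1 = a"
    "\<And>t. t \<in> {0..1} \<Longrightarrow> K 0 t = p t" "\<And>t. t \<in> {0..1} \<Longrightarrow> K 1 t = q t"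
  using assms by (subst (asm) homotopic_loops_iff) auto

lemma based_imp_free: "based_homotopic X a p q \<Longrightarrow> free_homotopic X p q"
  by (erule homotopic_with_mono) auto

lemma continuous_loop_concat:
  assumes P: "continuous_map unit_square X (\<lambda>(s, t). P s t)" and Q: "continuous_map unit_square X (\<lambda>(s, t). Q s t)"
    and PQ: "\<And>s. s \<in> {0..1} \<Longrightarrow> P s 1 = Q s 0"
  shows "continuous_map unit_square X (\<lambda>(s, t). loop_concat (P s) (Q s) t)"
proof -
  have c: "continuous_map (top_of_set S) X (\<lambda>z. R (fst z) (\<theta> (snd z)))"
    if "continuous_map unit_square X (\<lambda>(s, t). R s t)" "continuous_on UNIV \<theta>" "\<And>z. z \<in> S \<Longrightarrow> fst z \<in> {0..1} \<and> \<theta> (snd z) \<in> {0..1}"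
    for R and \<theta> :: "real \<Rightarrow> real" and S
  proof -
    have "continuous_map (top_of_set S) unit_square (\<lambda>z. (fst z, \<theta> (snd z)))"
      using that(3) by (auto simp: continuous_map_in_subtopology
          intro!: continuous_intros continuous_on_compose2[OF that(2)])
    from continuous_map_compose[OF this that(1)] show ?thesis by (simp add: o_def case_prod_unfold)
  qed
  have "continuous_map unit_square X (\<lambda>z. if snd z \<le> 1 / 2 then P (fst z) (2 * snd z) else Q (fst z) (2 * snd z - 1))"
  proof (rule continuous_map_cases_le)
    show "continuous_map (subtopology unit_square {x \<in> topspace unit_square. snd x \<le> 1 / 2}) X (\<lambda>z. P (fst z) (2 * snd z))"
      unfolding subtopology_subtopology by (rule c[OF P]) (auto intro!: continuous_intros)
    show "continuous_map (subtopology unit_square {x \<in> topspace unit_square. 1 / 2 \<le> snd x}) X (\<lambda>z. Q (fst z) (2 * snd z - 1))"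
      unfolding subtopology_subtopology by (rule c[OF Q]) (auto intro!: continuous_intros)
    show "P (fst z) (2 * snd z) = Q (fst z) (2 * snd z - 1)" if "z \<in> topspace unit_square" "snd z = 1 / 2" for z
      unfolding that(2) using PQ[of "fst z"] that(1) by auto
  qed (auto intro!: continuous_intros)
  then show ?thesis by (simp add: loop_concat_def case_prod_unfold)
qed

text \<open>Iterated concatenation. It starts with the constant loop at \<open>p 0\<close>, rather than at a base point, in
order to be meaningful for free loops.\<close>

primrec loop_power :: "nat \<Rightarrow> (real \<Rightarrow> 'a) \<Rightarrow> real \<Rightarrow> 'a" where
  "loop_power 0 p = (\<lambda>_. p 0)"
| "loop_power (Suc k) p = loop_concat (loop_power k p) p"

lemma loop_power_ends:
  assumes "p 0 = p 1"
  shows "loop_power k p 0 = p 0" "loop_power k p 1 = p 0"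
  using assms by (induction k) (auto simp: loop_concat_def)

lemma continuous_loop_power:
  assumes K: "continuous_map unit_square X (\<lambda>(s, t). K s t)" "\<And>s. s \<in> {0..1} \<Longrightarrow> K s 0 = K s 1"
  shows "continuous_map unit_square X (\<lambda>(s, t). loop_power k (K s) t)"
proof (induction k)
  case 0
  have "continuous_map unit_square unit_square (\<lambda>z. (fst z, 0))"
    by (auto simp: continuous_map_in_subtopology intro!: continuous_intros)
  from continuous_map_compose[OF this K(1)] show ?case by (simp add: o_def case_prod_unfold)
next
  case (Suc k)
  show ?case unfolding loop_power.simps
    by (rule continuous_loop_concat[OF Suc K(1)]) (use K(2) loop_power_ends(2) in metis)
qed

lemma loop_power_cong: "(\<And>t. t \<in> {0..1} \<Longrightarrow> p t = q t) \<Longrightarrow> t \<in> {0..1} \<Longrightarrow> loop_power k p t = loop_power k q t"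
  by (induction k arbitrary: t) (auto simp: loop_concat_def)

text \<open>All loops of a free homotopy may be concatenated with themselves simultaneously, each one at its own
starting point.\<close>

lemma free_homotopic_loop_power:
  assumes "free_homotopic X p q"
  shows "free_homotopic X (loop_power k p) (loop_power k q)"
proof -
  obtain K where K: "continuous_map unit_square X (\<lambda>(s, t). K s t)" "\<And>s. s \<in> {0..1} \<Longrightarrow> K s 0 = K s 1"
    "\<And>t. t \<in> {0..1} \<Longrightarrow> K 0 t = p t" "\<And>t. t \<in> {0..1} \<Longrightarrow> K 1 t = q t"
    using free_homotopicE[OF assms] by metis
  show ?thesis
  proof (rule free_homotopicI[OF continuous_loop_power[OF K(1,2)]])
    show "loop_power k (K s) 0 = loop_power k (K s) 1" if "s \<in> {0..1}" for s
      using loop_power_ends[OF K(2)[OF that]] by simp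
    show "loop_power k (K 0) t = loop_power k p t" if "t \<in> {0..1}" for t
      by (rule loop_power_cong[OF K(3) that])
    show "loop_power k (K 1) t = loop_power k q t" if "t \<in> {0..1}" for t
      by (rule loop_power_cong[OF K(4) that])
  qed
qed

lemma based_homotopic_concat:
  assumes "based_homotopic X a p p'" "based_homotopic X a q q'"
  shows "based_homotopic X a (loop_concat p q) (loop_concat p' q')"
proof -
  obtain K where K: "continuous_map unit_square X (\<lambda>(s, t). K s t)" "\<And>s. s \<in> {0..1} \<Longrightarrow> K s 0 = a" "\<And>s. s \<in> {0..1} \<Longrightarrow> K s 1 = a"
    "\<And>t. t \<in> {0..1} \<Longrightarrow> K 0 t = p t" "\<And>t. t \<in> {0..1} \<Longrightarrow> K 1 t = p' t"
    using based_homotopicE[OF assms(1)] by metis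
  obtain L where L: "continuous_map unit_square X (\<lambda>(s, t). L s t)" "\<And>s. s \<in> {0..1} \<Longrightarrow> L s 0 = a" "\<And>s. s \<in> {0..1} \<Longrightarrow> L s 1 = a"
    "\<And>t. t \<in> {0..1} \<Longrightarrow> L 0 t = q t" "\<And>t. t \<in> {0..1} \<Longrightarrow> L 1 t = q' t"
    using based_homotopicE[OF assms(2)] by metis
  show ?thesis
    by (rule based_homotopicI[OF continuous_loop_concat[OF K(1) L(1)]]) (use K L in \<open>auto simp: loop_concat_def\<close>)
qed

lemma loop_power_in_pow:
  assumes \<gamma>: "\<gamma> \<in> carrier (fundamental_group X a)" and p: "p \<in> \<gamma>"
  shows "loop_power k p \<in> \<gamma> [^]\<^bsub>fundamental_group X a\<^esub> k"
    and "based_homotopic X a (loop_power k p) (loop_power k p)"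
proof -
  obtain p0 where "\<gamma> = loop_class X a p0" using \<gamma> unfolding fundamental_group_def by auto
  then have "based_homotopic X a p0 p" using p unfolding loop_class_def by simp
  note hom = this
  have p01: "p 0 = a" "p 1 = a" using homotopic_with_imp_property[OF hom] by auto
  then have pc: "based_homotopic X a p p" using homotopic_with_imp_continuous_maps[OF hom] by simp
  show r: "based_homotopic X a (loop_power k p) (loop_power k p)" for k
  proof (induction k)
    case 0
    have "a \<in> topspace X"
      using pc p01(1) continuous_map_image_subset_topspace[of "top_of_set {0..1}" X p] by force
    then show ?case using p01 by simp
  next
    case (Suc k)
    show ?case unfolding loop_power.simps by (rule based_homotopic_concat[OF Suc pc])
  qed
  show "loop_power k p \<in> \<gamma> [^]\<^bsub>fundamental_group X a\<^esub> k"
  proof (induction k)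
    case 0
    show ?case using r[of 0] p01 by (simp add: nat_pow_def fundamental_group_def loop_class_def)
  next
    case (Suc k)
    have "loop_power (Suc k) p \<in> loop_class X a (loop_concat (loop_power k p) p)"
      using r[of "Suc k"] by (simp add: loop_class_def)
    then show ?case using Suc p by (simp add: nat_pow_def fundamental_group_def del: loop_power.simps) blast
  qed
qed

lemma represents_power:
  assumes \<gamma>: "\<gamma> \<in> carrier (fundamental_group X a)" and h: "represents X h \<gamma>"
    and l: "free_homotopic X l (loop_power k h)"
  shows "represents X l (\<gamma> [^]\<^bsub>fundamental_group X a\<^esub> k)"
proof -
  obtain p where p: "p \<in> \<gamma>" "free_homotopic X h p" using h unfolding represents_def by blast
  have "free_homotopic X l (loop_power k p)"
    using homotopic_with_trans[OF l free_homotopic_loop_power[OF p(2)]] .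
  then show ?thesis using loop_power_in_pow(1)[OF \<gamma> p(1)] unfolding represents_def by blast
qed

text \<open>The parametrization of the \<open>k\<close>-fold concatenation of a loop by the universal cover of the circle.\<close>

primrec winding_path :: "nat \<Rightarrow> real \<Rightarrow> real" where
  "winding_path 0 t = 0"
| "winding_path (Suc k) t = (if t \<le> 1 / 2 then winding_path k (2 * t) else real k + (2 * t - 1))"

lemma winding_path_ends: "winding_path k 0 = 0" "winding_path k 1 = real k"
  by (induction k) auto

lemma winding_path_continuous: "continuous_on {0..1} (winding_path k)"
proof (induction k)
  case (Suc k)
  have "continuous_on ({0..1/2} \<union> {1/2..1}) (\<lambda>t. if t \<le> 1 / 2 then winding_path k (2 * t) else real k + (2 * t - 1))"
  proof (intro continuous_on_If closed_atLeastAtMost continuous_on_compose2[OF Suc] continuous_intros)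
    fix t :: real assume "t \<in> {1/2..1}" "t \<le> 1 / 2"
    then have t: "t = 1 / 2" by simp
    show "winding_path k (2 * t) = real k + (2 * t - 1)" unfolding t by (simp add: winding_path_ends)
  qed (auto simp: winding_path_ends)
  moreover have "{0..1/2} \<union> {1/2..1} = {0..1::real}" by auto
  ultimately show ?case by (simp add: fun_eq_iff cong: continuous_on_cong)
qed (auto intro: continuous_on_const)

lemma periodic_nat: "(\<And>t::real. h (t + 1) = h t) \<Longrightarrow> h (t + real n) = h t"
  by (induction n) (auto simp: add.assoc[symmetric] add.commute[of 1])

lemma loop_power_periodic:
  assumes h: "\<And>t. h (t + 1) = h t"
  shows "t \<in> {0..1} \<Longrightarrow> loop_power k h t = h (winding_path k t)"
proof (induction k arbitrary: t)
  case (Suc k)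
  show ?case
  proof (cases "t \<le> 1 / 2")
    case True
    then show ?thesis using Suc by (simp add: loop_concat_def)
  next
    case False
    then show ?thesis using periodic_nat[where h = h, OF h, of "2 * t - 1" k] by (simp add: loop_concat_def add.commute)
  qed
qed simp

text \<open>The two paths \<open>t \<mapsto> k t\<close> and \<open>winding_path k\<close> are homotopic relative to their ends by linear interpolation.\<close>

lemma free_homotopic_speed:
  assumes h: "\<And>t. h (t + 1) = h t" "continuous_map euclidean X (h :: real \<Rightarrow> 'a)"
  shows "free_homotopic X (\<lambda>t. h (real k * t)) (loop_power k h)"
proof (rule free_homotopicI)
  let ?K = "\<lambda>s t. h ((1 - s) * (real k * t) + s * winding_path k t)"
  have "continuous_on ({0..1} \<times> {0..1}) (\<lambda>z. (1 - fst z) * (real k * snd z) + fst z * winding_path k (snd z))"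
    by (intro continuous_intros continuous_on_compose2[OF winding_path_continuous]) auto
  then have "continuous_map unit_square euclidean (\<lambda>z. (1 - fst z) * (real k * snd z) + fst z * winding_path k (snd z))"
    by simp
  from continuous_map_compose[OF this h(2)]
  show "continuous_map unit_square X (\<lambda>(s, t). ?K s t)" by (simp add: o_def case_prod_unfold)
  show "?K s 0 = ?K s 1" for s
    using periodic_nat[where h = h, OF h(1), of 0 k] by (simp add: winding_path_ends algebra_simps)
qed (simp_all add: loop_power_periodic[where h = h, OF h(1)])

text \<open>Unlike \<open>skew_iterate\<close>, this allows factors over an arbitrary parameter space.\<close>

primrec family_product :: "(nat \<Rightarrow> 'p \<Rightarrow> 'y \<Rightarrow> 'y) \<Rightarrow> nat \<Rightarrow> 'p \<Rightarrow> 'y \<Rightarrow> 'y" where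
  "family_product u 0 p = id"
| "family_product u (Suc k) p = u k p \<circ> family_product u k p"

context symplectic_manifold
begin

lemma psmooth_family_product:
  fixes u :: "nat \<Rightarrow> 'p::euclidean_space \<Rightarrow> 'y \<Rightarrow> 'y"
  assumes "\<And>i. psmooth A (u i)"
  shows "psmooth A (family_product u k)"
proof (induction k)
  case 0
  have "family_product u 0 = (\<lambda>p. id)" by (simp add: fun_eq_iff)
  then show ?case using psmooth_const[OF smooth_map_id] by metis
next
  case (Suc k)
  have "family_product u (Suc k) = (\<lambda>p. u k p \<circ> family_product u k p)" by (simp add: fun_eq_iff)
  then show ?case using psmooth_compose[OF assms Suc] by metis
qed

lemma smooth_square_continuous:
  assumes F: "psmooth A (F :: real \<times> real \<Rightarrow> 'y \<Rightarrow> 'y)" "\<And>z. F z \<in> Ham A \<Omega>"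
    and \<theta>: "continuous_on ({0..1} \<times> {0..1}) \<theta>"
  shows "continuous_map unit_square (Ham_topology A \<Omega>) (\<lambda>(s, t). F (\<theta> (s, t)))"
proof -
  have "continuous_map unit_square euclidean \<theta>" using \<theta> by simp
  from continuous_map_compose[OF this psmooth_continuous_map[OF F]]
  show ?thesis by (simp add: o_def case_prod_unfold)
qed

lemma smooth_on_fst_snd:
  "smooth_on UNIV (\<lambda>z::real \<times> real. a * fst z + b * snd z)"
  using smooth_on_add[OF open_UNIV
      smooth_on_bounded_linear[OF open_UNIV bounded_linear_mult_right smooth_on_linear[OF open_UNIV bounded_linear_fst]]
      smooth_on_bounded_linear[OF open_UNIV bounded_linear_mult_right smooth_on_linear[OF open_UNIV bounded_linear_snd]]] .

text \<open>The Eckmann-Hilton argument: the map \<open>(a, b) \<mapsto> g a \<circ> (g b)\<^sup>k\<close> of the square sends the diagonal to the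
pointwise power, and the path along two edges to a concatenation. The diagonal is deformed linearly
into the edge path.\<close>

lemma power_homotopic_concat:
  assumes g: "psmooth A g" "\<And>t. g t \<in> Ham A \<Omega>" "g 0 = id" "g 1 = id"
  shows "based_homotopic (Ham_topology A \<Omega>) id (\<lambda>t. g t ^^ k) (loop_power k g)"
proof (induction k)
  case 0
  have "range g \<subseteq> topspace (Ham_topology A \<Omega>)"
    using continuous_map_image_subset_topspace[OF psmooth_continuous_map[OF g(1,2)]] by simp
  then have "id \<in> topspace (Ham_topology A \<Omega>)" using g(3) by (metis range_subsetD)
  then show ?case using g(3) by (simp add: id_def)
next
  case (Suc k)
  have gk: "(\<lambda>t. g t ^^ k) = family_product (\<lambda>_. g) k" for k by (induction k) (simp_all add: fun_eq_iff)
  have Hk: "g t ^^ k \<in> Ham A \<Omega>" for t k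
  proof (induction k)
    case 0
    show ?case using id_in_Ham[OF g(2)] by (simp only: funpow.simps)
  next
    case (Suc k)
    show ?case unfolding funpow.simps by (rule Ham_compose[OF g(2) Suc])
  qed
  define F where "F z = g (fst z) \<circ> g (snd z) ^^ k" for z :: "real \<times> real"
  have F: "psmooth A F"
    unfolding F_def
  proof (rule psmooth_compose)
    show "psmooth A (\<lambda>z::real \<times> real. g (fst z))"
      using psmooth_reparam[OF g(1) smooth_on_linear[OF open_UNIV bounded_linear_fst]] .
    have "psmooth A (\<lambda>t. g t ^^ k)" unfolding gk by (rule psmooth_family_product) (rule g(1))
    from psmooth_reparam[OF this smooth_on_linear[OF open_UNIV bounded_linear_snd]]
    show "psmooth A (\<lambda>z::real \<times> real. g (snd z) ^^ k)" .
  qed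
  have FH: "F z \<in> Ham A \<Omega>" for z unfolding F_def by (rule Ham_compose[OF g(2) Hk])
  \<comment> \<open>The edge path in the square runs from (0, 0) through (0, 1) to (1, 1).\<close>
  define e1 e2 :: "real \<Rightarrow> real" where "e1 t = max 0 (2 * t - 1)" and "e2 t = min 1 (2 * t)" for t
  define \<theta> where "\<theta> z = ((1 - fst z) * snd z + fst z * e1 (snd z), (1 - fst z) * snd z + fst z * e2 (snd z))" for z
  have c\<theta>: "continuous_on ({0..1} \<times> {0..1}) \<theta>" unfolding \<theta>_def e1_def e2_def by (intro continuous_intros)
  have "based_homotopic (Ham_topology A \<Omega>) id (\<lambda>t. g t ^^ Suc k) (loop_concat (\<lambda>t. g t ^^ k) g)"
  proof (rule based_homotopicI[OF smooth_square_continuous[OF F FH c\<theta>]])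
    have idk: "id ^^ n = (id :: 'y \<Rightarrow> 'y)" for n by (induction n) auto
    show "F (\<theta> (s, 0)) = id" "F (\<theta> (s, 1)) = id" for s
      by (simp_all add: \<theta>_def e1_def e2_def F_def g idk)
    show "F (\<theta> (0, t)) = g t ^^ Suc k" for t by (simp add: \<theta>_def F_def)
    show "F (\<theta> (1, t)) = loop_concat (\<lambda>t. g t ^^ k) g t" for t
      by (cases "t \<le> 1 / 2") (auto simp: \<theta>_def F_def e1_def e2_def loop_concat_def g idk)
  qed
  moreover have "based_homotopic (Ham_topology A \<Omega>) id g g"
  proof -
    have "continuous_map (top_of_set {0..1}) (Ham_topology A \<Omega>) g"
      using continuous_map_from_subtopology[OF psmooth_continuous_map[OF g(1,2)]] by simp
    then show ?thesis using g(3,4) by simp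
  qed
  ultimately show ?case
    unfolding loop_power.simps using homotopic_with_trans based_homotopic_concat[OF Suc] by blast
qed

text \<open>A path \<open>\<eta>\<close> from the identity to the inverse of \<open>h 0\<close> is composed with each factor of the iterated
product, and simultaneously the shifts by multiples of \<open>\<alpha>\<close> are contracted to zero. This deforms the
iterated product into the pointwise power of the based loop \<open>g t = h t \<circ> \<eta> 1\<close>, which is homotopic to
the iterated concatenation of \<open>g\<close>; and \<open>g\<close> is freely homotopic to \<open>h\<close>.\<close>

lemma skew_iterate_homotopic:
  assumes h: "smooth_loop A \<Omega> h"
  shows "free_homotopic (Ham_topology A \<Omega>) (skew_iterate h \<alpha> k) (loop_power k h)"
proof -
  note hp = smooth_loop_props[OF h]
  obtain \<eta> where \<eta>: "psmooth A \<eta>" "\<eta> (0::real) = id" "h 0 \<circ> \<eta> 1 = id" "\<And>s. \<eta> s \<in> Ham A \<Omega>"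
    using Ham_inverse_path[OF hp(4)[of 0]] by metis
  define g where "g t = h t \<circ> \<eta> 1" for t
  have g: "psmooth A g" "g t \<in> Ham A \<Omega>" for t
    unfolding g_def using psmooth_compose[OF hp(1) psmooth_const[OF psmooth_slice[OF \<eta>(1)]]] Ham_compose[OF hp(4) \<eta>(4)] by blast+
  have g01: "g 0 = id" "g 1 = id" using \<eta>(3) hp(5)[of 0] by (simp_all add: g_def)
  have sq: "psmooth A (\<lambda>z::real \<times> real. h (snd z + (1 - fst z) * b) \<circ> \<eta> (fst z))" for b
  proof (rule psmooth_compose)
    have "smooth_on UNIV (\<lambda>z::real \<times> real. ((- b) * fst z + 1 * snd z) + b)"
      by (intro smooth_on_add smooth_on_const smooth_on_fst_snd) simp
    then have "smooth_on UNIV (\<lambda>z::real \<times> real. snd z + (1 - fst z) * b)" by (simp add: algebra_simps)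
    from psmooth_reparam[OF hp(1) this] show "psmooth A (\<lambda>z::real \<times> real. h (snd z + (1 - fst z) * b))" .
    show "psmooth A (\<lambda>z::real \<times> real. \<eta> (fst z))"
      using psmooth_reparam[OF \<eta>(1) smooth_on_linear[OF open_UNIV bounded_linear_fst]] .
  qed
  define u where "u i z = h (snd z + (1 - fst z) * (real i * \<alpha>)) \<circ> \<eta> (fst z)" for i :: nat and z :: "real \<times> real"
  have id: "id \<in> Ham A \<Omega>" by (rule id_in_Ham[OF hp(4)])
  have U: "psmooth A (family_product u k)" by (rule psmooth_family_product) (unfold u_def, rule sq)
  have UH: "family_product u k z \<in> Ham A \<Omega>" for z
  proof (induction k)
    case (Suc k)
    show ?case unfolding family_product.simps u_def by (intro Ham_compose hp(4) \<eta>(4)) (rule Suc[unfolded u_def])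
  qed (simp only: family_product.simps id)
  have 1: "free_homotopic (Ham_topology A \<Omega>) (skew_iterate h \<alpha> k) (\<lambda>t. g t ^^ k)"
  proof (rule free_homotopicI[OF smooth_square_continuous[OF U UH continuous_on_id]])
    have "u i (s, 0) = u i (s, 1)" for i s
      unfolding u_def using hp(5)[of "(1 - s) * (real i * \<alpha>)"] by (simp add: add.commute)
    then show "family_product u k (s, 0) = family_product u k (s, 1)" for s by (induction k) simp_all
    show "family_product u k (0, t) = skew_iterate h \<alpha> k t" for t
      by (induction k) (simp_all add: u_def \<eta>(2))
    show "family_product u k (1, t) = g t ^^ k" for t
      by (induction k) (simp_all add: u_def g_def id_def)
  qed
  have 2: "free_homotopic (Ham_topology A \<Omega>) (\<lambda>t. g t ^^ k) (loop_power k g)"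
    by (rule based_imp_free[OF power_homotopic_concat[OF g g01]])
  define v where "v z = h (snd z) \<circ> \<eta> (fst z)" for z :: "real \<times> real"
  have v: "psmooth A v" "v z \<in> Ham A \<Omega>" for z
    unfolding v_def using sq[of 0] Ham_compose[OF hp(4) \<eta>(4)] by simp_all
  have "free_homotopic (Ham_topology A \<Omega>) h g"
    by (rule free_homotopicI[OF smooth_square_continuous[OF v continuous_on_id]])
      (use hp(5)[of 0] \<eta>(2) in \<open>auto simp: v_def g_def\<close>)
  then have "free_homotopic (Ham_topology A \<Omega>) g h" by (rule homotopic_with_symD)
  then have 3: "free_homotopic (Ham_topology A \<Omega>) (loop_power k g) (loop_power k h)"
    by (rule free_homotopic_loop_power)
  show ?thesis by (rule homotopic_with_trans[OF 1 homotopic_with_trans[OF 2 3]])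
qed

lemma represents_skew_iterate:
  assumes "\<gamma> \<in> carrier (Ham_pi1 A \<Omega>)" "smooth_loop A \<Omega> h" "represents (Ham_topology A \<Omega>) h \<gamma>"
  shows "represents (Ham_topology A \<Omega>) (skew_iterate h \<alpha> k) (\<gamma> [^]\<^bsub>Ham_pi1 A \<Omega>\<^esub> k)"
  by (rule represents_power[OF assms(1,3) skew_iterate_homotopic[OF assms(2)]])

lemma represents_speed:
  assumes "\<gamma> \<in> carrier (Ham_pi1 A \<Omega>)" "smooth_loop A \<Omega> h" "represents (Ham_topology A \<Omega>) h \<gamma>"
  shows "represents (Ham_topology A \<Omega>) (\<lambda>t. h (real k * t)) (\<gamma> [^]\<^bsub>Ham_pi1 A \<Omega>\<^esub> k)"
  by (rule represents_power[OF assms(1,3) free_homotopic_speed])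
    (use smooth_loop_props[OF assms(2)] psmooth_continuous_map[of h \<Omega>] in auto)

end


section \<open>The Riesz representation theorem on compact Hausdorff spaces\<close>

locale normalized_functional =
  fixes X :: "'a topology" and L :: "('a \<Rightarrow> real) \<Rightarrow> real"
  assumes compact_X: "compact_space X" and Hausdorff_X: "Hausdorff_space X"
    and L_add: "continuous_map X euclideanreal f \<Longrightarrow> continuous_map X euclideanreal g \<Longrightarrow> L (\<lambda>x. f x + g x) = L f + L g"
    and L_scale: "continuous_map X euclideanreal f \<Longrightarrow> L (\<lambda>x. r * f x) = r * L f"
    and L_mono: "continuous_map X euclideanreal f \<Longrightarrow> continuous_map X euclideanreal g \<Longrightarrow>
       (\<And>x. x \<in> topspace X \<Longrightarrow> f x \<le> g x) \<Longrightarrow> L f \<le> L g"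
    and L_one: "L (\<lambda>x. 1) = 1"
begin

lemma normal_X: "normal_space X"
  using compact_Hausdorff_or_regular_imp_normal_space compact_X Hausdorff_X by blast

lemma L_cong:
  "continuous_map X euclideanreal f \<Longrightarrow> continuous_map X euclideanreal g \<Longrightarrow>
     (\<And>x. x \<in> topspace X \<Longrightarrow> f x = g x) \<Longrightarrow> L f = L g"
  by (rule antisym) (auto intro: L_mono)

lemma L_const: "L (\<lambda>x. r) = r"
  using L_scale[of "\<lambda>x. 1" r] L_one by simp

lemma L_sum:
  "finite I \<Longrightarrow> (\<And>i. i \<in> I \<Longrightarrow> continuous_map X euclideanreal (f i)) \<Longrightarrow> L (\<lambda>x. \<Sum>i\<in>I. f i x) = (\<Sum>i\<in>I. L (f i))"
  by (induction I rule: finite_induct) (auto simp: L_const L_add continuous_map_sum)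

text \<open>The measure of an open set is to be the supremum of the functional on the functions between zero and
the indicator of the set. It is extended to all subsets by outer regularity, and Caratheodory's
construction makes it a Borel measure.\<close>

definition test :: "'a set \<Rightarrow> ('a \<Rightarrow> real) set" where
  "test V = {f. continuous_map X euclideanreal f \<and> (\<forall>x\<in>topspace X. 0 \<le> f x \<and> f x \<le> 1) \<and>
     (\<forall>x\<in>topspace X - V. f x = 0)}"

definition open_mass :: "'a set \<Rightarrow> real" where
  "open_mass V = Sup (L ` test V)"

lemma testD:
  assumes "f \<in> test V"
  shows "continuous_map X euclideanreal f" "\<And>x. x \<in> topspace X \<Longrightarrow> 0 \<le> f x" "\<And>x. x \<in> topspace X \<Longrightarrow> f x \<le> 1"
    "\<And>x. x \<in> topspace X \<Longrightarrow> x \<notin> V \<Longrightarrow> f x = 0"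
  using assms unfolding test_def by auto

lemma testI:
  assumes "continuous_map X euclideanreal f" "\<And>x. x \<in> topspace X \<Longrightarrow> 0 \<le> f x" "\<And>x. x \<in> topspace X \<Longrightarrow> f x \<le> 1"
    "\<And>x. x \<in> topspace X \<Longrightarrow> x \<notin> V \<Longrightarrow> f x = 0"
  shows "f \<in> test V"
  using assms unfolding test_def by auto

lemma test_zero: "(\<lambda>x. 0) \<in> test V"
  by (rule testI) auto

lemma L_test_bounds: "f \<in> test V \<Longrightarrow> 0 \<le> L f \<and> L f \<le> 1"
  using L_mono[of "\<lambda>x. 0" f] L_mono[of f "\<lambda>x. 1"] L_const testD[of f V] by auto

lemma L_le_open_mass: "f \<in> test V \<Longrightarrow> L f \<le> open_mass V"
  unfolding open_mass_def using L_test_bounds by (intro cSUP_upper) (auto simp: bdd_above_def)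

lemma open_mass_le: "(\<And>f. f \<in> test V \<Longrightarrow> L f \<le> r) \<Longrightarrow> open_mass V \<le> r"
  unfolding open_mass_def using test_zero by (intro cSUP_least) auto

lemma open_mass_approx:
  assumes "\<epsilon> > 0"
  obtains f where "f \<in> test V" "open_mass V - \<epsilon> < L f"
proof -
  have "\<exists>y\<in>L ` test V. open_mass V - \<epsilon> < y"
    unfolding open_mass_def using assms test_zero L_test_bounds by (intro less_cSupD) auto
  then show thesis using that by blast
qed

lemma open_mass_nonneg: "0 \<le> open_mass V"
  using L_le_open_mass[OF test_zero] L_const[of 0] by simp

lemma open_mass_mono: "V \<subseteq> W \<Longrightarrow> open_mass V \<le> open_mass W"
  by (rule open_mass_le) (auto intro!: L_le_open_mass testI dest: testD)

lemma open_mass_empty: "open_mass {} = 0"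
proof (rule antisym[OF open_mass_le open_mass_nonneg])
  fix f assume "f \<in> test {}"
  then have "L f \<le> L (\<lambda>x. 0)" using testD[of f "{}"] by (intro L_mono) auto
  then show "L f \<le> 0" using L_const[of 0] by simp
qed

lemma open_mass_topspace: "open_mass (topspace X) = 1"
proof (rule antisym[OF open_mass_le])
  show "L f \<le> 1" if "f \<in> test (topspace X)" for f using L_test_bounds[OF that] by simp
  have "(\<lambda>x. 1) \<in> test (topspace X)" by (rule testI) auto
  then show "1 \<le> open_mass (topspace X)" using L_le_open_mass L_one by metis
qed

text \<open>Subtracting \<open>\<epsilon>\<close> replaces a test function by one that is supported in a closed subset.\<close>

lemma test_truncate:
  assumes f: "f \<in> test V" and e: "\<epsilon> > 0"
  obtains f' K where "closedin X K" "K \<subseteq> V" "continuous_map X euclideanreal f'"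
    "\<And>x. x \<in> topspace X \<Longrightarrow> 0 \<le> f' x \<and> f' x \<le> 1" "\<And>x. x \<in> topspace X \<Longrightarrow> x \<notin> K \<Longrightarrow> f' x = 0" "L f \<le> L f' + \<epsilon>"
proof
  let ?K = "{x \<in> topspace X. f x \<in> {\<epsilon>..}}" let ?f = "\<lambda>x. max 0 (f x - \<epsilon>)"
  note f' = testD[OF f]
  show "closedin X ?K" by (rule closedin_continuous_map_preimage[OF f'(1)]) simp
  show "?K \<subseteq> V" using f'(4) e by force
  show c: "continuous_map X euclideanreal ?f" using f'(1) by (intro continuous_intros) auto
  show "0 \<le> ?f x \<and> ?f x \<le> 1" if "x \<in> topspace X" for x using f'(3)[OF that] e by auto
  show "?f x = 0" if "x \<in> topspace X" "x \<notin> ?K" for x using that by auto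
  have "L f \<le> L (\<lambda>x. ?f x + \<epsilon>)"
    by (rule L_mono[OF f'(1)]) (use c in \<open>auto intro!: continuous_intros\<close>)
  then show "L f \<le> L ?f + \<epsilon>" using L_add[OF c, of "\<lambda>x. \<epsilon>"] L_const by simp
qed

text \<open>By Urysohn's lemma a function supported in a closed subset of \<open>V \<union> W\<close> splits into a test function for
\<open>V\<close> and one for \<open>W\<close>.\<close>

lemma open_mass_Un:
  assumes "openin X V" "openin X W"
  shows "open_mass (V \<union> W) \<le> open_mass V + open_mass W"
proof (rule open_mass_le)
  fix f assume f: "f \<in> test (V \<union> W)"
  show "L f \<le> open_mass V + open_mass W"
  proof (rule field_le_epsilon)
    fix \<epsilon> :: real assume "\<epsilon> > 0"
    then obtain f' K where K: "closedin X K" "K \<subseteq> V \<union> W" "continuous_map X euclideanreal f'"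
      "\<And>x. x \<in> topspace X \<Longrightarrow> 0 \<le> f' x \<and> f' x \<le> 1" "\<And>x. x \<in> topspace X \<Longrightarrow> x \<notin> K \<Longrightarrow> f' x = 0" "L f \<le> L f' + \<epsilon>"
      using test_truncate[OF f] by metis
    have "closedin X (K - W)" "closedin X (topspace X - V)" "disjnt (K - W) (topspace X - V)"
      using K(1,2) assms by (auto simp: closedin_diff disjnt_def)
    then obtain u where u: "continuous_map X (top_of_set {0..1::real}) u" "u ` (K - W) \<subseteq> {1}" "u ` (topspace X - V) \<subseteq> {0}"
      using Urysohn_lemma[OF normal_X, of "topspace X - V" "K - W" 0 1] by (metis disjnt_sym zero_le_one)
    have uc: "continuous_map X euclideanreal u" and u01: "\<And>x. x \<in> topspace X \<Longrightarrow> 0 \<le> u x \<and> u x \<le> 1"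
      using u(1) unfolding continuous_map_in_subtopology by auto
    have 1: "(\<lambda>x. f' x * u x) \<in> test V"
      using K(3,4) uc u01 u(3) by (intro testI continuous_map_real_mult) (auto intro: mult_le_one)
    have 2: "(\<lambda>x. f' x * (1 - u x)) \<in> test W"
    proof (rule testI)
      show "continuous_map X euclideanreal (\<lambda>x. f' x * (1 - u x))" using K(3) uc by (intro continuous_intros) auto
      show "f' x * (1 - u x) = 0" if "x \<in> topspace X" "x \<notin> W" for x
        using K(5)[OF that(1)] u(2) that by (cases "x \<in> K") auto
    qed (use K(4) u01 in \<open>auto intro: mult_le_one\<close>)
    have "L f' = L (\<lambda>x. f' x * u x + f' x * (1 - u x))" by (simp add: algebra_simps)
    also have "\<dots> = L (\<lambda>x. f' x * u x) + L (\<lambda>x. f' x * (1 - u x))" by (rule L_add[OF testD(1)[OF 1] testD(1)[OF 2]])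
    also have "\<dots> \<le> open_mass V + open_mass W" using L_le_open_mass[OF 1] L_le_open_mass[OF 2] by simp
    finally show "L f \<le> open_mass V + open_mass W + \<epsilon>" using K(6) by simp
  qed
qed

lemma open_mass_finite_UN:
  fixes n :: nat
  assumes "\<And>i. openin X (V i)"
  shows "open_mass (\<Union>i<n. V i) \<le> (\<Sum>i<n. open_mass (V i))"
proof (induction n)
  case (Suc n)
  have "open_mass (\<Union>i<Suc n. V i) \<le> open_mass (\<Union>i<n. V i) + open_mass (V n)"
  proof -
    have "openin X (\<Union>i<n. V i)" using assms by (auto intro!: openin_Union)
    from open_mass_Un[OF this assms[of n]] show ?thesis by (simp add: lessThan_Suc Un_commute)
  qed
  then show ?case using Suc by simp
qed (simp add: open_mass_empty)

text \<open>After truncation a test function is supported in a compact set, which is covered by finitely many of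
the open sets.\<close>

lemma open_mass_countable_UN:
  assumes V: "\<And>i. openin X (V i)"
  shows "ennreal (open_mass (\<Union>i. V i)) \<le> (\<Sum>i. ennreal (open_mass (V i)))"
proof (rule ennreal_le_epsilon)
  fix \<epsilon> :: real assume fin: "(\<Sum>i. ennreal (open_mass (V i))) < top_class.top" and e: "\<epsilon> > 0"
  obtain S where S: "(\<Sum>i. ennreal (open_mass (V i))) = ennreal S" "S \<ge> 0"
    using fin by (cases "\<Sum>i. ennreal (open_mass (V i))" rule: ennreal_cases) auto
  have "open_mass (\<Union>i. V i) \<le> S + \<epsilon>"
  proof (rule open_mass_le)
    fix f assume f: "f \<in> test (\<Union>i. V i)"
    obtain f' K where K: "closedin X K" "K \<subseteq> (\<Union>i. V i)" "continuous_map X euclideanreal f'"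
      "\<And>x. x \<in> topspace X \<Longrightarrow> 0 \<le> f' x \<and> f' x \<le> 1" "\<And>x. x \<in> topspace X \<Longrightarrow> x \<notin> K \<Longrightarrow> f' x = 0" "L f \<le> L f' + \<epsilon>"
      using test_truncate[OF f e] by metis
    have "compactin X K" by (rule closedin_compact_space[OF compact_X K(1)])
    then obtain \<F> where F: "finite \<F>" "\<F> \<subseteq> range V" "K \<subseteq> \<Union> \<F>"
      using V K(2) unfolding compactin_def by (metis (no_types, lifting) imageE)
    then obtain I where I: "finite I" "\<F> = V ` I" by (metis finite_subset_image)
    obtain n where n: "I \<subseteq> {..<n}" using I(1) finite_nat_iff_bounded by blast
    have "f' \<in> test (\<Union>i<n. V i)"
      using K(3-5) F(3) I(2) n by (intro testI) blast+
    then have "L f' \<le> open_mass (\<Union>i<n. V i)" by (rule L_le_open_mass)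
    also have "\<dots> \<le> (\<Sum>i<n. open_mass (V i))" by (rule open_mass_finite_UN[OF V])
    also have "\<dots> \<le> S"
    proof -
      have "ennreal (\<Sum>i<n. open_mass (V i)) = (\<Sum>i<n. ennreal (open_mass (V i)))" by (simp add: open_mass_nonneg)
      also have "\<dots> \<le> ennreal S" unfolding S(1)[symmetric] by (rule sum_le_suminf) auto
      finally show ?thesis using S(2) by (simp add: ennreal_le_iff)
    qed
    finally show "L f \<le> S + \<epsilon>" using K(6) by simp
  qed
  then show "ennreal (open_mass (\<Union>i. V i)) \<le> (\<Sum>i. ennreal (open_mass (V i))) + ennreal \<epsilon>"
    unfolding S(1) using S(2) e by (simp add: ennreal_plus[symmetric] ennreal_leI del: ennreal_plus)
qed

definition outer :: "'a set \<Rightarrow> ennreal" where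
  "outer B = (INF V\<in>{V. openin X V \<and> B \<subseteq> V}. ennreal (open_mass V))"

lemma outer_le: "openin X V \<Longrightarrow> B \<subseteq> V \<Longrightarrow> outer B \<le> ennreal (open_mass V)"
  unfolding outer_def by (rule INF_lower) simp

lemma outer_open: "openin X V \<Longrightarrow> outer V = ennreal (open_mass V)"
  by (rule antisym[OF outer_le]) (auto simp: outer_def intro!: INF_greatest ennreal_leI open_mass_mono)

lemma outer_mono: "B \<subseteq> B' \<Longrightarrow> outer B \<le> outer B'"
  unfolding outer_def by (rule INF_superset_mono) auto

lemma outer_approx:
  assumes "outer B < e"
  obtains V where "openin X V" "B \<subseteq> V" "ennreal (open_mass V) < e"
  using assms unfolding outer_def INF_less_iff by blast

lemma outer_space: "outer_measure_space (Pow (topspace X)) outer"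
  unfolding outer_measure_space_def
proof (intro conjI)
  show "positive (Pow (topspace X)) outer"
    unfolding positive_def using outer_open[of "{}"] by (simp add: open_mass_empty)
  show "increasing (Pow (topspace X)) outer"
    unfolding increasing_def using outer_mono by blast
  show "countably_subadditive (Pow (topspace X)) outer"
    unfolding countably_subadditive_def
  proof (intro allI impI)
    fix B :: "nat \<Rightarrow> 'a set"
    show "outer (\<Union>i. B i) \<le> (\<Sum>i. outer (B i))"
    proof (rule ennreal_le_epsilon)
      fix e :: real assume e: "e > 0" and fin: "(\<Sum>i. outer (B i)) < top_class.top"
      have *: "outer (B n) < outer (B n) + ennreal (e * (1/2)^Suc n)" for n
        using e fin by (auto simp add: less_top dest!: ennreal_suminf_lessD)
      have "\<exists>V. openin X V \<and> B n \<subseteq> V \<and> ennreal (open_mass V) < outer (B n) + ennreal (e * (1/2)^Suc n)" for n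
        by (rule outer_approx[OF *]) blast
      then obtain V where V: "\<And>n. openin X (V n)" "\<And>n. B n \<subseteq> V n"
        "\<And>n. ennreal (open_mass (V n)) < outer (B n) + ennreal (e * (1/2)^Suc n)" by metis
      have "outer (\<Union>i. B i) \<le> ennreal (open_mass (\<Union>i. V i))"
        using V(1,2) by (intro outer_le) (auto intro: openin_Union)
      also have "\<dots> \<le> (\<Sum>i. ennreal (open_mass (V i)))" by (rule open_mass_countable_UN[OF V(1)])
      also have "\<dots> \<le> (\<Sum>n. outer (B n) + ennreal (e * (1/2) ^ Suc n))"
        using V(3) by (intro suminf_le) (auto intro: less_imp_le)
      also have "... = (\<Sum>n. outer (B n)) + (\<Sum>n. ennreal e * ennreal ((1/2) ^ Suc n))"
        using e by (subst suminf_add[symmetric])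
          (auto simp del: ennreal_suminf_cmult simp add: ennreal_mult[symmetric])
      also have "\<dots> = (\<Sum>n. outer (B n)) + e"
        unfolding ennreal_suminf_cmult
        by (subst suminf_ennreal_eq[OF zero_le_power power_half_series]) auto
      finally show "outer (\<Union>i. B i) \<le> (\<Sum>i. outer (B i)) + ennreal e" .
    qed
  qed
qed

text \<open>A test function for \<open>W \<inter> U\<close> with support in a closed set \<open>K\<close>, and a test function for \<open>W - K\<close>, add up to
a test function for \<open>W\<close>; and \<open>W - U\<close> is contained in \<open>W - K\<close>.\<close>

lemma outer_open_split:
  assumes U: "openin X U" and W: "openin X W"
  shows "outer (W \<inter> U) + outer (W - U) \<le> ennreal (open_mass W)"
proof -
  have WU: "openin X (W \<inter> U)" using U W by blast
  have "outer (W - U) \<le> ennreal (open_mass W - open_mass (W \<inter> U))"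
  proof (rule ennreal_le_epsilon)
    fix e :: real assume "e > 0"
    then have e: "e / 3 > 0" by simp
    obtain f where f: "f \<in> test (W \<inter> U)" "open_mass (W \<inter> U) - e / 3 < L f" using open_mass_approx[OF e] by blast
    obtain f' K where K: "closedin X K" "K \<subseteq> W \<inter> U" "continuous_map X euclideanreal f'"
      "\<And>x. x \<in> topspace X \<Longrightarrow> 0 \<le> f' x \<and> f' x \<le> 1" "\<And>x. x \<in> topspace X \<Longrightarrow> x \<notin> K \<Longrightarrow> f' x = 0" "L f \<le> L f' + e / 3"
      using test_truncate[OF f(1) e] by metis
    have WK: "openin X (W - K)" using W K(1) by (rule openin_diff)
    obtain g where g: "g \<in> test (W - K)" "open_mass (W - K) - e / 3 < L g" using open_mass_approx[OF e] by blast
    have "(\<lambda>x. f' x + g x) \<in> test W"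
    proof (rule testI)
      show "continuous_map X euclideanreal (\<lambda>x. f' x + g x)" using K(3) testD(1)[OF g(1)] by (intro continuous_intros)
      fix x assume x: "x \<in> topspace X"
      show "0 \<le> f' x + g x" using K(4)[OF x] testD(2)[OF g(1) x] by simp
      show "f' x + g x \<le> 1"
        using K(4)[OF x] K(5)[OF x] testD(3,4)[OF g(1) x] by (cases "x \<in> K") auto
      show "f' x + g x = 0" if "x \<notin> W"
        using K(2) K(5)[OF x] testD(4)[OF g(1) x] that by auto
    qed
    from L_le_open_mass[OF this] have "L f' + L g \<le> open_mass W"
      using L_add[OF K(3) testD(1)[OF g(1)]] by simp
    then have "open_mass (W - K) \<le> open_mass W - open_mass (W \<inter> U) + e" using f g K(6) by linarith
    moreover have "outer (W - U) \<le> ennreal (open_mass (W - K))"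
      using K(2) by (intro outer_le[OF WK]) blast
    moreover have "open_mass (W \<inter> U) \<le> open_mass W" by (rule open_mass_mono) blast
    ultimately show "outer (W - U) \<le> ennreal (open_mass W - open_mass (W \<inter> U)) + ennreal e"
      using \<open>e > 0\<close> by (simp add: ennreal_plus[symmetric] del: ennreal_plus) (metis ennreal_leI order_trans)
  qed
  then have "outer (W \<inter> U) + outer (W - U) \<le> ennreal (open_mass (W \<inter> U)) + ennreal (open_mass W - open_mass (W \<inter> U))"
    unfolding outer_open[OF WU] by (rule add_left_mono)
  also have "\<dots> = ennreal (open_mass W)"
    using open_mass_nonneg open_mass_mono[of "W \<inter> U" W] by (subst ennreal_plus[symmetric]) auto
  finally show ?thesis .
qed

lemma open_in_lambda_system:
  assumes U: "openin X U"
  shows "U \<in> lambda_system (topspace X) (Pow (topspace X)) outer"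
proof -
  interpret algebra "topspace X" "Pow (topspace X)" by (rule algebra_Pow)
  have "outer (B \<inter> U) + outer (B - U) = outer B" if B: "B \<subseteq> topspace X" for B
  proof (rule antisym)
    show "outer (B \<inter> U) + outer (B - U) \<le> outer B"
      unfolding outer_def[of B]
    proof (rule INF_greatest)
      fix W assume "W \<in> {V. openin X V \<and> B \<subseteq> V}"
      then have W: "openin X W" "B \<subseteq> W" by auto
      have "outer (B \<inter> U) + outer (B - U) \<le> outer (W \<inter> U) + outer (W - U)"
        using W by (intro add_mono outer_mono) auto
      then show "outer (B \<inter> U) + outer (B - U) \<le> ennreal (open_mass W)"
        using outer_open_split[OF U W(1)] by (rule order_trans)
    qed
    have "positive (Pow (topspace X)) outer" "countably_subadditive (Pow (topspace X)) outer"
      using outer_space unfolding outer_measure_space_def by auto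
    then have "subadditive (Pow (topspace X)) outer" by (rule countably_subadditive_subadditive)
    then have "outer ((B \<inter> U) \<union> (B - U)) \<le> outer (B \<inter> U) + outer (B - U)"
      using B by (intro subadditiveD) auto
    then show "outer B \<le> outer (B \<inter> U) + outer (B - U)" by (simp add: Int_Diff_Un)
  qed
  then show ?thesis unfolding lambda_system_eq using openin_subset[OF U] by auto
qed

definition riesz :: "'a measure" where
  "riesz = measure_of (topspace X) {U. openin X U} outer"

lemma opens_Pow: "{U. openin X U} \<subseteq> Pow (topspace X)"
  using openin_subset by blast

lemma sets_riesz: "sets riesz = sigma_sets (topspace X) {U. openin X U}"
  and space_riesz: "space riesz = topspace X"
  unfolding riesz_def using opens_Pow by (auto simp: sets_measure_of space_measure_of)

lemma emeasure_riesz: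
  assumes "B \<in> sigma_sets (topspace X) {U. openin X U}"
  shows "emeasure riesz B = outer B"
proof -
  interpret sigma_algebra "topspace X" "Pow (topspace X)" by (rule sigma_algebra_Pow)
  have ms: "measure_space (topspace X) (lambda_system (topspace X) (Pow (topspace X)) outer) outer"
    by (rule caratheodory_lemma[OF outer_space])
  then have "sigma_algebra (topspace X) (lambda_system (topspace X) (Pow (topspace X)) outer)"
    unfolding measure_space_def by blast
  then have "sigma_sets (topspace X) {U. openin X U} \<subseteq> lambda_system (topspace X) (Pow (topspace X)) outer"
    using open_in_lambda_system by (intro sigma_algebra.sigma_sets_subset) auto
  then have "measure_space (topspace X) (sigma_sets (topspace X) {U. openin X U}) outer"
    by (rule measure_down[OF ms sigma_algebra_sigma_sets[OF opens_Pow]])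
  then show ?thesis
    using assms by (intro emeasure_measure_of[OF riesz_def opens_Pow]) (auto simp: measure_space_def sets_riesz)
qed

lemma open_sets_riesz: "openin X U \<Longrightarrow> U \<in> sets riesz"
  unfolding sets_riesz by auto

lemma emeasure_riesz_open: "openin X U \<Longrightarrow> emeasure riesz U = ennreal (open_mass U)"
  using emeasure_riesz[of U] outer_open by auto

lemma prob_riesz: "emeasure riesz (space riesz) = 1"
  unfolding space_riesz using emeasure_riesz_open[of "topspace X"] open_mass_topspace by simp

lemma measure_riesz_space: "measure riesz (space riesz) = 1"
  using prob_riesz by (simp add: measure_def)

lemma continuous_map_borel:
  assumes "continuous_map X euclideanreal f" "sets M = sigma_sets (topspace X) {U. openin X U}" "space M = topspace X"
  shows "f \<in> borel_measurable M"
proof (rule borel_measurableI)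
  fix S :: "real set" assume "open S"
  then have "openin X {x \<in> topspace X. f x \<in> S}" using openin_continuous_map_preimage[OF assms(1)] by simp
  moreover have "f -` S \<inter> space M = {x \<in> topspace X. f x \<in> S}" using assms(3) by auto
  ultimately show "f -` S \<inter> space M \<in> sets M" unfolding assms(2) by auto
qed

lemma clamp_sum: "0 \<le> y \<Longrightarrow> (\<Sum>i<n. min 1 (max 0 (y - real i))) = min y (real n)"
  by (induction n) (auto simp: min_def max_def)

text \<open>The graph of \<open>f\<close> is cut into horizontal layers \<open>s i\<close> of height \<open>1 / n\<close>. Rescaled to height one, each of
them is a test function for a superlevel set \<open>V i\<close>, and the indicators of these sets add up to a
function that exceeds \<open>n f\<close> by at most one.\<close>

lemma L_le_integral:
  assumes f: "continuous_map X euclideanreal f" "\<And>x. x \<in> topspace X \<Longrightarrow> 0 \<le> f x \<and> f x \<le> 1"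
  shows "L f \<le> (\<integral>x. f x \<partial>riesz)"
proof (rule field_le_epsilon)
  fix \<epsilon> :: real assume "\<epsilon> > 0"
  then obtain n :: nat where n: "n > 0" "1 / real n < \<epsilon>" using nat_approx_posE[of \<epsilon>] by (metis zero_less_Suc)
  interpret finite_measure riesz by (rule finite_measureI) (simp add: prob_riesz)
  define s where "s i x = min 1 (max 0 (real n * f x - real i))" for i :: nat and x
  define V where "V i = {x \<in> topspace X. f x \<in> {real i / real n<..}}" for i
  have Vo: "openin X (V i)" for i unfolding V_def by (rule openin_continuous_map_preimage[OF f(1)]) simp
  have ii: "integrable riesz (indicator (V i) :: 'a \<Rightarrow> real)" for i
    by (rule integrable_real_indicator) (use open_sets_riesz[OF Vo] emeasure_riesz_open[OF Vo] in auto)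
  have sc: "continuous_map X euclideanreal (s i)" for i unfolding s_def using f(1) by (intro continuous_intros) auto
  have st: "s i \<in> test (V i)" for i
    by (rule testI[OF sc]) (use n in \<open>auto simp: s_def V_def field_simps\<close>)
  have "real n * L f = L (\<lambda>x. real n * f x)" using L_scale[OF f(1)] by simp
  also have "\<dots> = L (\<lambda>x. \<Sum>i<n. s i x)"
  proof (rule L_cong)
    show "continuous_map X euclideanreal (\<lambda>x. real n * f x)" using f(1) by (intro continuous_intros) auto
    show "continuous_map X euclideanreal (\<lambda>x. \<Sum>i<n. s i x)" using sc by (intro continuous_map_sum) auto
    show "real n * f x = (\<Sum>i<n. s i x)" if "x \<in> topspace X" for x
      unfolding s_def using f(2)[OF that] by (subst clamp_sum) (auto simp: min_def intro: mult_left_le)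
  qed
  also have "\<dots> = (\<Sum>i<n. L (s i))" by (rule L_sum) (use sc in auto)
  also have "\<dots> \<le> (\<Sum>i<n. open_mass (V i))" by (intro sum_mono L_le_open_mass st)
  also have "\<dots> = (\<Sum>i<n. (\<integral>x. indicator (V i) x \<partial>riesz))"
    using emeasure_riesz_open[OF Vo] open_mass_nonneg open_sets_riesz[OF Vo]
    by (intro sum.cong) (auto simp: measure_def)
  also have "\<dots> = (\<integral>x. (\<Sum>i<n. indicator (V i) x) \<partial>riesz)"
    using ii by (subst Bochner_Integration.integral_sum) auto
  also have "\<dots> \<le> (\<integral>x. real n * f x + 1 \<partial>riesz)"
  proof (rule integral_mono)
    show "integrable riesz (\<lambda>x. \<Sum>i<n. indicator (V i) x :: real)"
      using ii by (intro Bochner_Integration.integrable_sum) auto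
    have "\<bar>real n * f x + 1\<bar> \<le> real n + 1" if "x \<in> topspace X" for x
    proof -
      have "0 \<le> real n * f x" "real n * f x \<le> real n" using f(2)[OF that] by (auto intro: mult_left_le)
      then show ?thesis by linarith
    qed
    then show "integrable riesz (\<lambda>x. real n * f x + 1)"
      using f by (intro integrable_const_bound[of _ "real n + 1"] borel_measurable_add borel_measurable_times
          continuous_map_borel sets_riesz space_riesz) (auto simp: space_riesz intro!: AE_I2)
    fix x assume "x \<in> space riesz"
    then have x: "x \<in> topspace X" by (simp add: space_riesz)
    have "(\<Sum>i<n. indicator (V i) x) \<le> (\<Sum>i<n. min 1 (max 0 (real n * f x + 1 - real i)))"
      using n f(2)[OF x] by (intro sum_mono) (auto simp: V_def indicator_def field_simps)
    also have "\<dots> \<le> real n * f x + 1" using f(2)[OF x] by (subst clamp_sum) auto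
    finally show "(\<Sum>i<n. indicator (V i) x) \<le> real n * f x + 1" .
  qed
  also have "\<dots> = real n * (\<integral>x. f x \<partial>riesz) + 1"
  proof -
    have "integrable riesz f"
      using f by (intro integrable_const_bound[of _ 1] continuous_map_borel sets_riesz space_riesz) (auto simp: space_riesz intro!: AE_I2)
    then show ?thesis by (simp add: measure_riesz_space)
  qed
  finally have "L f \<le> (\<integral>x. f x \<partial>riesz) + 1 / real n" using n by (simp add: field_simps)
  then show "L f \<le> (\<integral>x. f x \<partial>riesz) + \<epsilon>" using n by simp
qed

text \<open>The preceding inequality is applied to \<open>f\<close> and to \<open>- f\<close>, both of them rescaled and shifted into the
unit interval.\<close>

lemma riesz_integral:
  assumes f: "continuous_map X euclideanreal f" and B: "\<And>x. x \<in> topspace X \<Longrightarrow> \<bar>f x\<bar> \<le> B"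
  shows "(\<integral>x. f x \<partial>riesz) = L f"
proof -
  interpret finite_measure riesz by (rule finite_measureI) (simp add: prob_riesz)
  \<comment> \<open>A positive bound, by which one may divide.\<close>
  define C where "C = max B 1"
  have C: "C > 0" "\<And>x. x \<in> topspace X \<Longrightarrow> \<bar>f x\<bar> \<le> C" using B by (auto simp: C_def intro: max.coboundedI1)
  have i: "integrable riesz f"
    using f C by (intro integrable_const_bound[of _ C] continuous_map_borel sets_riesz space_riesz) (auto simp: space_riesz intro!: AE_I2)
  have le: "r * L f \<le> r * (\<integral>x. f x \<partial>riesz)" if r: "r \<in> {1 / (2 * C), - 1 / (2 * C)}" for r
  proof -
    have c: "continuous_map X euclideanreal (\<lambda>x. r * f x)" using f by (intro continuous_intros) auto
    have b: "0 \<le> r * f x + 1 / 2 \<and> r * f x + 1 / 2 \<le> 1" if "x \<in> topspace X" for x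
    proof -
      have "\<bar>r * f x\<bar> = \<bar>f x\<bar> / (2 * C)" using r C(1) by (auto simp: abs_mult)
      also have "\<dots> \<le> 1 / 2" using C(2)[OF that] C(1) by (simp add: field_simps)
      finally show ?thesis by linarith
    qed
    have "L (\<lambda>x. r * f x + 1 / 2) \<le> (\<integral>x. r * f x + 1 / 2 \<partial>riesz)"
      using c b by (intro L_le_integral continuous_map_add) auto
    moreover have "L (\<lambda>x. r * f x + 1 / 2) = r * L f + 1 / 2"
      using L_add[OF c, of "\<lambda>x. 1 / 2"] L_const L_scale[OF f] by simp
    moreover have "(\<integral>x. r * f x + 1 / 2 \<partial>riesz) = r * (\<integral>x. f x \<partial>riesz) + 1 / 2" using i by (simp add: measure_riesz_space)
    ultimately show ?thesis by simp
  qed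
  from le[of "1 / (2 * C)"] le[of "- 1 / (2 * C)"] C(1) show ?thesis by (simp add: field_simps)
qed

text \<open>Transport by \<open>T\<close> matches the test functions of an open set with those of its preimage. This bounds the
measure of the preimage of a Borel set by the measure of the set, and passing to complements in a
probability space gives the reverse bound.\<close>

lemma riesz_invariant:
  assumes T: "homeomorphic_map X X T" and inv: "\<And>f. continuous_map X euclideanreal f \<Longrightarrow> L (f \<circ> T) = L f"
  shows "invariant_borel_prob X T riesz"
proof -
  obtain S where S: "homeomorphic_maps X X T S" using T homeomorphic_map_maps by blast
  have cT: "continuous_map X X T" and cS: "continuous_map X X S"
    and ST: "\<And>x. x \<in> topspace X \<Longrightarrow> S (T x) = x" and TS: "\<And>x. x \<in> topspace X \<Longrightarrow> T (S x) = x"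
    using S unfolding homeomorphic_maps_def by auto
  have Tt: "\<And>x. x \<in> topspace X \<Longrightarrow> T x \<in> topspace X" and St: "\<And>x. x \<in> topspace X \<Longrightarrow> S x \<in> topspace X"
    using continuous_map_image_subset_topspace[OF cT] continuous_map_image_subset_topspace[OF cS] by blast+
  have pre: "openin X (T -` W \<inter> topspace X)" if "openin X W" for W
    using openin_continuous_map_preimage[OF cT that] by (simp add: vimage_def Int_def conj_commute)
  have c: "open_mass (T -` W \<inter> topspace X) \<le> open_mass W" if "openin X W" for W
  proof (rule open_mass_le)
    fix f assume f: "f \<in> test (T -` W \<inter> topspace X)"
    have fS: "f \<circ> S \<in> test W"
      using testD[OF f] St TS continuous_map_compose[OF cS testD(1)[OF f]] by (intro testI) auto
    have "L f = L ((f \<circ> S) \<circ> T)"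
      by (rule L_cong) (use testD(1)[OF f] continuous_map_compose[OF cT continuous_map_compose[OF cS testD(1)[OF f]]] ST in auto)
    also have "\<dots> = L (f \<circ> S)" by (rule inv[OF testD(1)[OF fS]])
    also have "\<dots> \<le> open_mass W" by (rule L_le_open_mass[OF fS])
    finally show "L f \<le> open_mass W" .
  qed
  interpret finite_measure riesz by (rule finite_measureI) (simp add: prob_riesz)
  have Tm: "T \<in> measurable riesz riesz"
  proof -
    have "T \<in> measurable riesz (sigma (topspace X) {U. openin X U})"
      by (rule measurable_sigma_sets[where \<Omega> = "topspace X" and A = "{U. openin X U}"])
        (use opens_Pow pre Tt in \<open>auto simp: sets_measure_of space_riesz sets_riesz\<close>)
    moreover have "sets (sigma (topspace X) {U. openin X U}) = sets riesz" using opens_Pow by (simp add: sets_measure_of sets_riesz)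
    ultimately show ?thesis using measurable_cong_sets[OF refl] by blast
  qed
  have le: "emeasure riesz (T -` B \<inter> topspace X) \<le> emeasure riesz B" if B: "B \<in> sets riesz" for B
  proof -
    have Bs: "B \<in> sigma_sets (topspace X) {U. openin X U}" using B sets_riesz by simp
    have Bt: "T -` B \<inter> topspace X \<in> sigma_sets (topspace X) {U. openin X U}"
      using measurable_sets[OF Tm B] unfolding sets_riesz space_riesz .
    show ?thesis
      unfolding emeasure_riesz[OF Bs] emeasure_riesz[OF Bt] outer_def[of B]
    proof (rule INF_greatest)
      fix W assume "W \<in> {V. openin X V \<and> B \<subseteq> V}"
      then have W: "openin X W" "B \<subseteq> W" by auto
      have "outer (T -` B \<inter> topspace X) \<le> ennreal (open_mass (T -` W \<inter> topspace X))"
        by (rule outer_le[OF pre[OF W(1)]]) (use W(2) in blast)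
      also have "\<dots> \<le> ennreal (open_mass W)" using c[OF W(1)] by (rule ennreal_leI)
      finally show "outer (T -` B \<inter> topspace X) \<le> ennreal (open_mass W)" .
    qed
  qed
  have "emeasure riesz (T -` B \<inter> topspace X) = emeasure riesz B" if B: "B \<in> sets riesz" for B
  proof -
    have Bt: "T -` B \<inter> topspace X \<in> sets riesz" using measurable_sets[OF Tm B] unfolding space_riesz .
    have cB: "space riesz - B \<in> sets riesz" using B by blast
    have "measure riesz (T -` B \<inter> topspace X) \<le> measure riesz B" using le[OF B] by (simp add: emeasure_eq_measure)
    moreover have "measure riesz (T -` (space riesz - B) \<inter> topspace X) \<le> measure riesz (space riesz - B)"
      using le[OF cB] by (simp add: emeasure_eq_measure)
    moreover have "T -` (space riesz - B) \<inter> topspace X = space riesz - (T -` B \<inter> topspace X)"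
      using Tt by (auto simp: space_riesz)
    ultimately have "measure riesz (T -` B \<inter> topspace X) = measure riesz B" using finite_measure_compl[OF B] finite_measure_compl[OF Bt] by simp
    then show ?thesis by (simp add: emeasure_eq_measure)
  qed
  then show ?thesis
    unfolding invariant_borel_prob_def using prob_riesz by (simp add: space_riesz sets_riesz[symmetric])
qed

end

section \<open>Unique ergodicity and uniform convergence of time averages\<close>

text \<open>The functions \<open>L k\<close> all lie in a product of compact intervals, which is compact by Tychonoff's
theorem, so they have a cluster point \<open>\<Lambda>\<close>.\<close>

lemma simultaneous_limit_filter:
  fixes L :: "nat \<Rightarrow> 'f \<Rightarrow> real"
  assumes B: "\<And>k f. \<bar>L k f\<bar> \<le> B f"
  obtains G \<Lambda> where "G \<noteq> bot" "G \<le> sequentially" "\<And>f. ((\<lambda>k. L k f) \<longlongrightarrow> \<Lambda> f) G"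
proof -
  let ?K = "Pi\<^sub>E UNIV (\<lambda>f. cball (0::real) (B f))"
  have "compactin (product_topology (\<lambda>f::'f. euclideanreal) UNIV) ?K"
    unfolding compactin_PiE by (auto simp: compactin_euclidean_iff)
  then have "compact ?K" unfolding euclidean_product_topology compactin_euclidean_iff .
  moreover have "eventually (\<lambda>\<phi>. \<phi> \<in> ?K) (filtermap L sequentially)"
    unfolding eventually_filtermap by (rule always_eventually) (use B in \<open>simp add: PiE_UNIV_domain\<close>)
  moreover have "filtermap L sequentially \<noteq> bot" by (simp add: filtermap_bot_iff)
  ultimately obtain \<Lambda> where \<Lambda>: "inf (nhds \<Lambda>) (filtermap L sequentially) \<noteq> bot"
    unfolding compact_filter by blast
  define G where "G = inf (filtercomap L (nhds \<Lambda>)) sequentially"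
  have "G \<noteq> bot"
  proof
    assume "G = bot"
    then have "eventually (\<lambda>x. False) G" by simp
    then obtain P Q where PQ: "eventually P (filtercomap L (nhds \<Lambda>))" "eventually Q sequentially" "\<And>k. \<not> (P k \<and> Q k)"
      unfolding G_def eventually_inf by blast
    obtain R where R: "eventually R (nhds \<Lambda>)" "\<And>k. R (L k) \<Longrightarrow> P k"
      using PQ(1) unfolding eventually_filtercomap by blast
    have "eventually (\<lambda>\<phi>. \<exists>k. \<phi> = L k \<and> Q k) (filtermap L sequentially)"
      unfolding eventually_filtermap using PQ(2) by eventually_elim blast
    then have "eventually (\<lambda>\<phi>. False) (inf (nhds \<Lambda>) (filtermap L sequentially))"
      unfolding eventually_inf using R PQ(3) by (intro exI[of _ R] exI[of _ "\<lambda>\<phi>. \<exists>k. \<phi> = L k \<and> Q k"]) blast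
    then show False using \<Lambda> by (simp add: eventually_False)
  qed
  moreover have "G \<le> sequentially" unfolding G_def by simp
  moreover have "((\<lambda>k. L k f) \<longlongrightarrow> \<Lambda> f) G" for f
  proof -
    have l: "filterlim L (nhds \<Lambda>) G"
      unfolding filterlim_def G_def
      by (metis filtermap_filtercomap filtermap_mono inf_le1 order_trans)
    show ?thesis
    proof (rule topological_tendstoI)
      fix S :: "real set" assume S: "open S" "\<Lambda> f \<in> S"
      have "continuous_on UNIV (\<lambda>\<phi>::'f \<Rightarrow> real. \<phi> f)" by (rule continuous_on_product_coordinates)
      then have "open ((\<lambda>\<phi>::'f \<Rightarrow> real. \<phi> f) -` S)" by (rule open_vimage[OF S(1)])
      then have "eventually (\<lambda>\<phi>. \<phi> f \<in> S) (nhds \<Lambda>)"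
        using S(2) unfolding eventually_nhds by (intro exI[of _ "(\<lambda>\<phi>. \<phi> f) -` S"]) auto
      then show "\<forall>\<^sub>F k in G. L k f \<in> S" using l unfolding filterlim_iff by blast
    qed
  qed
  ultimately show thesis by (rule that)
qed

lemma continuous_map_bounded:
  assumes "compact_space X" "continuous_map X euclideanreal f"
  shows "\<exists>B. \<forall>x\<in>topspace X. \<bar>f x\<bar> \<le> B"
proof -
  have "compact (f ` topspace X)"
    using image_compactin[OF _ assms(2)] assms(1) unfolding compact_space_def by auto
  then have "bounded (f ` topspace X)" by (rule compact_imp_bounded)
  then show ?thesis unfolding bounded_iff by auto
qed

text \<open>If the averages stayed away from zero along a sequence of times \<open>n k\<close> and starting points \<open>x k\<close>, then
a simultaneous limit \<open>\<Lambda>\<close> of the averages of all continuous functions would be a positive normalized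
functional. It is invariant because the averages of \<open>f \<circ> T\<close> and \<open>f\<close> differ only by two boundary terms.
By the Riesz representation it is an invariant probability measure, hence equal to \<open>M\<close>; but it does not
annihilate \<open>F\<close>.\<close>

lemma uniform_time_averages:
  assumes X: "compact_space X" "Hausdorff_space X" and T: "homeomorphic_map X X T"
    and unique: "\<exists>!M. invariant_borel_prob X T M"
    and M: "invariant_borel_prob X T M"
    and F: "continuous_map X euclideanreal F" "(\<integral>x. F x \<partial>M) = (0::real)" and e: "\<epsilon> > 0"
  shows "\<exists>N. \<forall>n\<ge>N. \<forall>x\<in>topspace X. \<bar>\<Sum>j<n. F ((T ^^ j) x)\<bar> \<le> \<epsilon> * real n"
proof (rule ccontr)
  assume "\<not> ?thesis"
  then have "\<forall>N. \<exists>n x. n \<ge> N \<and> x \<in> topspace X \<and> \<bar>\<Sum>j<n. F ((T ^^ j) x)\<bar> > \<epsilon> * real n"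
    by (meson not_le_imp_less)
  then obtain n x where n: "\<And>k. n k \<ge> k" and x: "\<And>k. x k \<in> topspace X"
    and big: "\<And>k. \<bar>\<Sum>j<n k. F ((T ^^ j) (x k))\<bar> > \<epsilon> * real (n k)" by metis
  have n0: "n k > 0" for k using big[of k] by (cases "n k") auto
  have cT: "continuous_map X X T" using T homeomorphic_imp_continuous_map by blast
  have Tx: "(T ^^ j) z \<in> topspace X" if "z \<in> topspace X" for j z
    using that continuous_map_image_subset_topspace[OF cT] by (induction j) auto
  let ?C = "\<lambda>f. continuous_map X euclideanreal f"
  \<comment> \<open>The value 0 at discontinuous functions makes the averages bounded in \<open>k\<close> for every argument.\<close>
  define L where "L k f = (if ?C f then (\<Sum>j<n k. f ((T ^^ j) (x k))) / real (n k) else 0)" for k and f :: "'a \<Rightarrow> real"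
  obtain B where B: "\<And>f z. ?C f \<Longrightarrow> z \<in> topspace X \<Longrightarrow> \<bar>f z\<bar> \<le> B f"
    using continuous_map_bounded[OF X(1)] by metis
  have L_le: "L k f \<le> b" if "?C f" "\<And>z. z \<in> topspace X \<Longrightarrow> f z \<le> b" for k f b
  proof -
    have "(\<Sum>j<n k. f ((T ^^ j) (x k))) \<le> (\<Sum>j<n k. b)" by (intro sum_mono that(2) Tx x)
    then show ?thesis using that(1) n0[of k] by (simp add: L_def field_simps)
  qed
  have L_minus: "L k (\<lambda>z. - f z) = - L k f" if "?C f" for k f
    using that by (simp add: L_def continuous_map_minus sum_negf)
  have Lb: "\<bar>L k f\<bar> \<le> (if ?C f then B f else 0)" for k f
  proof (cases "?C f")
    case True
    have "L k f \<le> B f" by (rule L_le[OF True]) (use B[OF True] in force)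
    moreover have "L k (\<lambda>z. - f z) \<le> B f"
      by (rule L_le) (use B[OF True] True in \<open>force simp: continuous_map_minus\<close>)+
    ultimately show ?thesis using True L_minus[OF True, of k] by (simp add: abs_le_iff)
  qed (simp add: L_def)
  obtain G \<Lambda> where G: "G \<noteq> bot" "G \<le> sequentially" and lim: "\<And>f. ((\<lambda>k. L k f) \<longlongrightarrow> \<Lambda> f) G"
    using simultaneous_limit_filter[of L, OF Lb] by metis
  interpret normalized_functional X \<Lambda>
  proof
    show "compact_space X" "Hausdorff_space X" by (fact X)+
    show "\<Lambda> (\<lambda>z. f z + g z) = \<Lambda> f + \<Lambda> g" if "?C f" "?C g" for f g
    proof (rule tendsto_unique[OF G(1) lim])
      have "L k (\<lambda>z. f z + g z) = L k f + L k g" for k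
        using that by (simp add: L_def continuous_map_add sum.distrib add_divide_distrib)
      then show "((\<lambda>k. L k (\<lambda>z. f z + g z)) \<longlongrightarrow> \<Lambda> f + \<Lambda> g) G" using tendsto_add[OF lim lim] by simp
    qed
    show "\<Lambda> (\<lambda>z. r * f z) = r * \<Lambda> f" if "?C f" for f r
    proof (rule tendsto_unique[OF G(1) lim])
      have "?C (\<lambda>z. r * f z)" using that by (intro continuous_intros) auto
      then have "L k (\<lambda>z. r * f z) = r * L k f" for k
        using that by (simp add: L_def sum_distrib_left)
      then show "((\<lambda>k. L k (\<lambda>z. r * f z)) \<longlongrightarrow> r * \<Lambda> f) G" using tendsto_mult_left[OF lim] by simp
    qed
    show "\<Lambda> f \<le> \<Lambda> g" if "?C f" "?C g" "\<And>z. z \<in> topspace X \<Longrightarrow> f z \<le> g z" for f g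
    proof (rule tendsto_le[OF G(1) lim lim])
      have "L k f \<le> L k g" for k
        using that Tx x by (auto simp: L_def intro!: divide_right_mono sum_mono)
      then show "\<forall>\<^sub>F k in G. L k f \<le> L k g" by simp
    qed
    show "\<Lambda> (\<lambda>z. 1) = 1"
    proof (rule tendsto_unique[OF G(1) lim])
      have "L k (\<lambda>z. 1) = 1" for k using n0[of k] by (simp add: L_def)
      then show "((\<lambda>k. L k (\<lambda>z. 1)) \<longlongrightarrow> 1) G" by simp
    qed
  qed
  have inv: "\<Lambda> (f \<circ> T) = \<Lambda> f" if f: "?C f" for f
  proof -
    have fT: "?C (f \<circ> T)" by (rule continuous_map_compose[OF cT f])
    have "norm (L k (f \<circ> T) - L k f) \<le> 2 * B f * inverse (real k)" if k: "k > 0" for k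
    proof -
      have "(\<Sum>j<n k. f (T ((T ^^ j) (x k)))) - (\<Sum>j<n k. f ((T ^^ j) (x k))) = f ((T ^^ n k) (x k)) - f (x k)"
        using sum_lessThan_telescope[of "\<lambda>j. f ((T ^^ j) (x k))" "n k"] by (simp add: sum_subtractf)
      then have "L k (f \<circ> T) - L k f = (f ((T ^^ n k) (x k)) - f (x k)) / real (n k)"
        using f fT by (simp add: L_def diff_divide_distrib[symmetric])
      moreover have b: "\<bar>f ((T ^^ n k) (x k)) - f (x k)\<bar> \<le> 2 * B f"
        using B[OF f Tx[OF x], of "n k" k] B[OF f x[of k]] by linarith
      moreover have "2 * B f / real (n k) \<le> 2 * B f / real k"
        using b n[of k] k by (intro divide_left_mono) auto
      ultimately show ?thesis
        using n0[of k] divide_right_mono[OF b, of "real (n k)"] by (simp add: abs_divide divide_inverse[of "2 * B f" "real k", symmetric])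
    qed
    then have "((\<lambda>k. L k (f \<circ> T) - L k f) \<longlongrightarrow> 0) sequentially"
      by (intro Lim_null_comparison[OF _ tendsto_mult_right_zero[OF lim_inverse_n]])
        (auto intro: eventually_mono[OF eventually_gt_at_top[of 0]])
    then have "((\<lambda>k. L k (f \<circ> T) - L k f) \<longlongrightarrow> 0) G" using G(2) by (rule filterlim_mono[OF _ order_refl])
    moreover have "((\<lambda>k. L k (f \<circ> T) - L k f) \<longlongrightarrow> \<Lambda> (f \<circ> T) - \<Lambda> f) G" by (rule tendsto_diff[OF lim lim])
    ultimately show ?thesis using tendsto_unique[OF G(1)] by fastforce
  qed
  have "invariant_borel_prob X T riesz" by (rule riesz_invariant[OF T inv])
  then have "riesz = M" using unique M by blast
  then have "\<Lambda> F = 0" using riesz_integral[OF F(1) B[OF F(1)]] F(2) by simp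
  moreover have "((\<lambda>k. \<bar>L k F\<bar>) \<longlongrightarrow> \<bar>\<Lambda> F\<bar>) G" by (rule tendsto_rabs[OF lim])
  moreover have "\<epsilon> \<le> \<bar>L k F\<bar>" for k
    using big[of k] n0[of k] F(1) by (simp add: L_def field_simps)
  ultimately have "\<epsilon> \<le> 0" using tendsto_lowerbound[OF _ _ G(1), of _ "\<bar>\<Lambda> F\<bar>" \<epsilon>] by fastforce
  then show False using e by simp
qed


section \<open>The circle\<close>

lemma periodic_int:
  assumes "\<And>t::real. f (t + 1) = f t"
  shows "f (t + of_int n) = f t"
proof (cases "n \<ge> 0")
  case True
  then show ?thesis using periodic_nat[where h = f, OF assms, of t "nat n"] by simp
next
  case False
  then show ?thesis using periodic_nat[where h = f, OF assms, of "t + of_int n" "nat (- n)"] by simp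
qed

lemma periodic_frac: "(\<And>t::real. f (t + 1) = f t) \<Longrightarrow> f (frac t) = f t"
  using periodic_int[where f = f, of t "- \<lfloor>t\<rfloor>"] by (simp add: frac_def)

lemma frac_frac_add: "frac (frac t + a) = frac (t + a :: real)"
proof -
  have "frac (s + 1 + a) = frac (s + a)" for s :: real
    using frac_1_eq[of "s + a"] by (simp only: add.assoc add.commute[of 1])
  then show ?thesis by (rule periodic_frac)
qed

lemma continuous_map_frac: "continuous_map euclidean circle_topology frac"
  using quotient_map_frac quotient_imp_continuous_map by blast

text \<open>The circle embeds continuously into the plane by the trigonometric functions.\<close>

lemma Hausdorff_circle: "Hausdorff_space circle_topology"
proof (rule Hausdorff_space_injective_preimage)
  let ?f = "\<lambda>t::real. (cos (2 * pi * t), sin (2 * pi * t))"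
  show "Hausdorff_space (euclidean :: (real \<times> real) topology)" by simp
  have "?f \<circ> frac = ?f"
    using periodic_frac[of ?f] by (auto simp: fun_eq_iff distrib_left)
  moreover have "continuous_on UNIV ?f" by (intro continuous_intros)
  ultimately have "continuous_map euclidean euclidean (?f \<circ> frac)" by simp
  then show "continuous_map circle_topology euclidean ?f"
    using continuous_compose_quotient_map[OF quotient_map_frac] by blast
  show "inj_on ?f (topspace circle_topology)"
  proof (rule inj_onI)
    fix s t assume st: "s \<in> topspace circle_topology" "t \<in> topspace circle_topology" "?f s = ?f t"
    then obtain n :: int where "2 * pi * s = 2 * pi * t + 2 * pi * n"
      using sin_cos_eq_iff[of "2 * pi * s" "2 * pi * t"] by auto
    then have "2 * pi * (s - t - n) = 0" by (simp add: algebra_simps)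
    then have n: "s - t = n" by simp
    have "\<bar>s - t\<bar> < 1" using st by (auto simp: topspace_circle_topology)
    then have "real_of_int \<bar>n\<bar> < real_of_int 1" unfolding n by simp
    then have "n = 0" unfolding of_int_less_iff by simp
    then show "s = t" using n by simp
  qed
qed

text \<open>After a translation the left-hand side is an integral over \<open>{a..<1 + a}\<close>, and by periodicity the part
beyond \<open>1\<close> may be moved back by one.\<close>

lemma nn_integral_circle_rotation:
  fixes g :: "real \<Rightarrow> ennreal"
  assumes g: "g \<in> borel_measurable borel" and per: "\<And>t. g (t + 1) = g t"
  shows "(\<integral>\<^sup>+t\<in>{0..<1}. g (t + \<alpha>) \<partial>lborel) = (\<integral>\<^sup>+t\<in>{0..<1}. g t \<partial>lborel)"
proof -
  define a where "a = frac \<alpha>"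
  have a: "0 \<le> a" "a < 1" by (auto simp: a_def frac_lt_1)
  have ga: "g (t + \<alpha>) = g (t + a)" for t
    using periodic_int[where f = g, OF per, of "t + a" "\<lfloor>\<alpha>\<rfloor>"] by (simp add: a_def frac_def)
  have tr: "(\<integral>\<^sup>+t. g t * indicator {u..<w} t \<partial>lborel) = (\<integral>\<^sup>+t. g (t + r) * indicator {u - r..<w - r} t \<partial>lborel)" for u w r :: real
  proof -
    have "(\<integral>\<^sup>+t. g t * indicator {u..<w} t \<partial>lborel) = (\<integral>\<^sup>+t. g (r + 1 * t) * indicator {u..<w} (r + 1 * t) \<partial>lborel)"
      using g by (subst nn_integral_real_affine[of _ 1 r]) auto
    also have "\<dots> = (\<integral>\<^sup>+t. g (t + r) * indicator {u - r..<w - r} t \<partial>lborel)"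
      by (rule nn_integral_cong) (auto simp: indicator_def add.commute)
    finally show ?thesis .
  qed
  have split: "(\<integral>\<^sup>+t. g t * indicator {u..<w} t \<partial>lborel) =
      (\<integral>\<^sup>+t. g t * indicator {u..<v} t \<partial>lborel) + (\<integral>\<^sup>+t. g t * indicator {v..<w} t \<partial>lborel)"
    if "u \<le> v" "v \<le> w" for u v w :: real
    using g that by (subst nn_integral_add[symmetric]) (auto intro!: nn_integral_cong simp: indicator_def)
  have "(\<integral>\<^sup>+t\<in>{0..<1}. g (t + \<alpha>) \<partial>lborel) = (\<integral>\<^sup>+t. g t * indicator {a..<1 + a} t \<partial>lborel)"
    using tr[of a "1 + a" a] by (simp add: ga)
  also have "\<dots> = (\<integral>\<^sup>+t. g t * indicator {a..<1} t \<partial>lborel) + (\<integral>\<^sup>+t. g t * indicator {1..<1 + a} t \<partial>lborel)"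
    by (rule split) (use a in auto)
  also have "(\<integral>\<^sup>+t. g t * indicator {1..<1 + a} t \<partial>lborel) = (\<integral>\<^sup>+t. g t * indicator {0..<a} t \<partial>lborel)"
    using tr[of 1 "1 + a" 1] by (simp add: per)
  also have "(\<integral>\<^sup>+t. g t * indicator {a..<1} t \<partial>lborel) + (\<integral>\<^sup>+t. g t * indicator {0..<a} t \<partial>lborel) =
      (\<integral>\<^sup>+t. g t * indicator {0..<1} t \<partial>lborel)"
    using split[of 0 a 1] a by (simp add: add.commute)
  finally show ?thesis .
qed

section \<open>The invariant measure of a skew product\<close>

context symplectic_manifold
begin

abbreviation circle_product :: "(real \<times> 'y) topology" where
  "circle_product \<equiv> prod_topology circle_topology euclidean"

lemma topspace_circle_product: "topspace circle_product = {0..<1} \<times> UNIV"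
  by (simp add: topspace_circle_topology)

lemma continuous_map_unroll: "continuous_map euclidean circle_product (\<lambda>(t, y :: 'y). (frac t, y))"
proof -
  have "continuous_map euclidean circle_topology (frac \<circ> (fst :: real \<times> 'y \<Rightarrow> real))"
    by (rule continuous_map_compose[OF _ continuous_map_frac]) (auto intro!: continuous_intros)
  then show ?thesis
    unfolding continuous_map_pairwise by (auto simp: o_def case_prod_unfold intro!: continuous_intros)
qed

lemma Hausdorff_circle_product: "Hausdorff_space circle_product"
proof -
  have "Hausdorff_space (euclidean :: 'y topology)"
    unfolding Hausdorff_space_def disjnt_def using hausdorff by (metis open_openin)
  then show ?thesis unfolding Hausdorff_space_prod_topology using Hausdorff_circle by blast
qed

text \<open>As a continuous map from a compact space onto a Hausdorff space, \<open>(t, y) \<mapsto> (frac t, y)\<close> restricts to a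
quotient map on the cylinder over the closed unit interval.\<close>

lemma continuous_map_circle_product:
  assumes \<Phi>: "continuous_on UNIV (\<lambda>(t, y :: 'y). \<Phi> t y :: real)" and per: "\<And>t. \<Phi> (t + 1) = \<Phi> t"
  shows "continuous_map circle_product euclideanreal (\<lambda>(t, y). \<Phi> t y)"
proof -
  let ?D = "{0..1 :: real} \<times> (UNIV :: 'y set)"
  let ?q = "\<lambda>(t, y :: 'y). (frac t, y)"
  have q: "continuous_map (top_of_set ?D) circle_product ?q"
    by (rule continuous_map_from_subtopology[OF continuous_map_unroll])
  have "compact ?D" using compact_manifold by (intro compact_Times) auto
  then have "compact_space (top_of_set ?D)" by (simp add: compact_space_subtopology)
  then have cl: "closed_map (top_of_set ?D) circle_product ?q"
    using continuous_imp_closed_map_gen[OF _ Hausdorff_imp_kc_space[OF Hausdorff_circle_product] q] by blast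
  have "?q ` topspace (top_of_set ?D) = topspace circle_product"
  proof -
    have "(t, y) \<in> ?q ` ?D" if "t \<in> {0..<1}" for t and y :: 'y
      using that by (intro image_eqI[of _ _ "(t, y)"]) (auto simp: frac_eq)
    then show ?thesis unfolding topspace_circle_product by (auto simp: frac_lt_1)
  qed
  then have qm: "quotient_map (top_of_set ?D) circle_product ?q"
    by (rule continuous_closed_imp_quotient_map[OF q cl])
  have "(\<lambda>(t, y). \<Phi> t y) \<circ> ?q = (\<lambda>(t, y). \<Phi> t y)"
    using periodic_frac[where f = \<Phi>, OF per] by (auto simp: fun_eq_iff)
  then have "continuous_map (top_of_set ?D) euclideanreal ((\<lambda>(t, y). \<Phi> t y) \<circ> ?q)"
    using continuous_on_subset[OF \<Phi>] by simp
  then show ?thesis using continuous_compose_quotient_map[OF qm] by blast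
qed

definition circle_lebesgue :: "real measure" where
  "circle_lebesgue = density lborel (indicator {0..<1})"

abbreviation product_measure :: "(real \<times> 'y) measure" where
  "product_measure \<equiv> circle_lebesgue \<Otimes>\<^sub>M vol"

lemma sets_circle_lebesgue: "sets circle_lebesgue = sets borel"
  unfolding circle_lebesgue_def by simp

lemma emeasure_circle_lebesgue: "emeasure circle_lebesgue UNIV = 1"
  unfolding circle_lebesgue_def by (subst emeasure_density) auto

lemma finite_circle_lebesgue: "finite_measure circle_lebesgue"
  by (rule finite_measureI) (use emeasure_circle_lebesgue sets_eq_imp_space_eq[OF sets_circle_lebesgue] in simp)

lemma nn_integral_circle_lebesgue:
  "f \<in> borel_measurable borel \<Longrightarrow> (\<integral>\<^sup>+t. f t \<partial>circle_lebesgue) = (\<integral>\<^sup>+t\<in>{0..<1}. f t \<partial>lborel)"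
  unfolding circle_lebesgue_def by (subst nn_integral_density) (auto simp: mult.commute)

lemma sets_product_measure: "sets product_measure = sets borel"
  using sets_pair_measure_cong[OF sets_circle_lebesgue sets_vol] borel_prod by metis

lemma space_product_measure: "space product_measure = UNIV"
  using sets_eq_imp_space_eq[OF sets_product_measure] by simp

definition circle_product_borel :: "(real \<times> 'y) measure" where
  "circle_product_borel = sigma (topspace circle_product) {U. openin circle_product U}"

text \<open>The normalized product measure is constructed on \<open>\<real> \<times> Y\<close>, where the Borel sets of the product are
available as a product of sigma-algebras, and then transported to the quotient.\<close>

definition circle_product_volume :: "(real \<times> 'y) measure" where
  "circle_product_volume = density (distr product_measure circle_product_borel (\<lambda>(t, y). (frac t, y)))
     (\<lambda>_. ennreal (inverse (measure vol UNIV)))"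

lemma opens_circle_product: "{U. openin circle_product U} \<subseteq> Pow (topspace circle_product)"
  using openin_subset by blast

lemma sets_circle_product_borel: "sets circle_product_borel = sigma_sets (topspace circle_product) {U. openin circle_product U}"
  unfolding circle_product_borel_def by (rule sets_measure_of[OF opens_circle_product])

lemma space_circle_product_borel: "space circle_product_borel = {0..<1} \<times> UNIV"
  unfolding circle_product_borel_def topspace_circle_product[symmetric]
  by (rule space_measure_of[OF opens_circle_product])

lemma open_circle_product_borel: "openin circle_product U \<Longrightarrow> U \<in> sets circle_product_borel"
  unfolding sets_circle_product_borel by auto

lemma measurable_into_circle_product:
  assumes "f \<in> space M \<rightarrow> {0..<1} \<times> UNIV"
    and "\<And>U. openin circle_product U \<Longrightarrow> f -` U \<inter> space M \<in> sets M"
  shows "f \<in> measurable M circle_product_borel"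
  using assms(2) assms(1)[folded topspace_circle_product]
  by (intro measurable_sigma_sets[OF sets_circle_product_borel opens_circle_product]) auto

lemma measurable_unroll: "(\<lambda>(t, y). (frac t, y)) \<in> measurable product_measure circle_product_borel"
proof (rule measurable_into_circle_product)
  show "(\<lambda>(t, y). (frac t, y)) -` U \<inter> space product_measure \<in> sets product_measure" if "openin circle_product U" for U
    using openin_continuous_map_preimage[OF continuous_map_unroll that]
    unfolding sets_product_measure space_product_measure by (simp add: vimage_def)
qed (auto simp: frac_lt_1)

lemma sets_circle_product_volume: "sets circle_product_volume = sets circle_product_borel"
  and space_circle_product_volume: "space circle_product_volume = {0..<1} \<times> UNIV"
  unfolding circle_product_volume_def by (simp_all add: space_circle_product_borel)

lemma emeasure_circle_product_volume:
  assumes B: "B \<in> sets circle_product_borel"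
  shows "emeasure circle_product_volume B =
     ennreal (inverse (measure vol UNIV)) * (\<integral>\<^sup>+t\<in>{0..<1}. emeasure vol {y. (frac t, y) \<in> B} \<partial>lborel)"
    and "(\<lambda>t. emeasure vol {y. (frac t, y) \<in> B}) \<in> borel_measurable borel"
proof -
  interpret finite_measure circle_lebesgue by (rule finite_circle_lebesgue)
  let ?B = "(\<lambda>(t, y). (frac t, y)) -` B \<inter> space product_measure"
  have Bm: "?B \<in> sets product_measure"
    by (rule measurable_sets[OF measurable_unroll B])
  have sl: "Pair t -` ?B = {y. (frac t, y) \<in> B}" for t unfolding space_product_measure by auto
  have m: "(\<lambda>t. emeasure vol {y. (frac t, y) \<in> B}) \<in> borel_measurable circle_lebesgue"
    using vol.measurable_emeasure_Pair[OF Bm] unfolding sl .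
  then show mb: "(\<lambda>t. emeasure vol {y. (frac t, y) \<in> B}) \<in> borel_measurable borel"
    using measurable_cong_sets[OF sets_circle_lebesgue refl] by blast
  have "emeasure product_measure ?B = (\<integral>\<^sup>+t. emeasure vol {y. (frac t, y) \<in> B} \<partial>circle_lebesgue)"
    unfolding vol.emeasure_pair_measure_alt[OF Bm] sl ..
  also have "\<dots> = (\<integral>\<^sup>+t\<in>{0..<1}. emeasure vol {y. (frac t, y) \<in> B} \<partial>lborel)"
    by (rule nn_integral_circle_lebesgue[OF mb])
  finally show "emeasure circle_product_volume B =
     ennreal (inverse (measure vol UNIV)) * (\<integral>\<^sup>+t\<in>{0..<1}. emeasure vol {y. (frac t, y) \<in> B} \<partial>lborel)"
    unfolding circle_product_volume_def using B
    by (subst emeasure_density_const) (simp_all add: emeasure_distr[OF measurable_unroll])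
qed

lemma emeasure_vol_vimage:
  assumes f: "symplectomorphism A \<Omega> f" and B: "B \<in> sets borel"
  shows "emeasure vol (f -` B) = emeasure vol B"
proof -
  have "f \<in> measurable vol borel"
    using continuous_borel[OF smooth_map_continuous[OF symplectomorphism_props(2)[OF f]]]
      measurable_cong_sets[OF sets_vol refl] by blast
  from emeasure_distr[OF this B] show ?thesis by (simp add: vol_invariant[OF f] space_vol)
qed

text \<open>By Fubini the measure of a set is the average over the circle of the volumes of its slices. The skew
product rotates the circle and acts on the slices by volume-preserving maps.\<close>

lemma skew_product_invariant:
  assumes h: "smooth_loop A \<Omega> h" and T: "homeomorphic_map circle_product circle_product (skew_product h \<alpha>)"
  shows "invariant_borel_prob circle_product (skew_product h \<alpha>) circle_product_volume"
proof -
  note hp = smooth_loop_props[OF h]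
  let ?T = "skew_product h \<alpha>"
  let ?S = "sets circle_product_borel"
  have top: "{0..<1} \<times> UNIV \<in> ?S" using sets.top[of circle_product_borel] unfolding space_circle_product_borel .
  have one: "emeasure circle_product_volume (space circle_product_volume) = 1"
  proof -
    have u: "{y :: 'y. (frac t, y) \<in> {0..<1} \<times> UNIV} = UNIV" for t by (auto simp: frac_lt_1)
    have w: "(\<integral>\<^sup>+t\<in>{0..<1::real}. emeasure vol UNIV \<partial>lborel) = emeasure vol UNIV"
      by (subst nn_integral_cmult_indicator) auto
    have "measure vol UNIV > 0" using vol_pos vol.emeasure_eq_measure[of UNIV] by simp
    then show ?thesis
      unfolding space_circle_product_volume emeasure_circle_product_volume(1)[OF top] u w
      by (simp add: vol.emeasure_eq_measure ennreal_mult'[symmetric])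
  qed
  have pre: "?T -` B \<inter> ({0..<1} \<times> UNIV) \<in> ?S" if "B \<in> ?S" for B
  proof -
    have cT: "continuous_map circle_product circle_product ?T" using T homeomorphic_imp_continuous_map by blast
    have "?T \<in> measurable circle_product_borel circle_product_borel"
    proof (rule measurable_into_circle_product)
      show "?T \<in> space circle_product_borel \<rightarrow> {0..<1} \<times> UNIV"
        by (auto simp: skew_product_def frac_lt_1)
      show "?T -` U \<inter> space circle_product_borel \<in> ?S" if "openin circle_product U" for U
      proof -
        have "openin circle_product {x \<in> topspace circle_product. ?T x \<in> U}"
          by (rule openin_continuous_map_preimage[OF cT that])
        moreover have "{x \<in> topspace circle_product. ?T x \<in> U} = ?T -` U \<inter> space circle_product_borel"
          unfolding topspace_circle_product space_circle_product_borel by blast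
        ultimately show ?thesis using open_circle_product_borel by metis
      qed
    qed
    from measurable_sets[OF this that] show ?thesis unfolding space_circle_product_borel .
  qed
  have "emeasure circle_product_volume (?T -` B \<inter> ({0..<1} \<times> UNIV)) = emeasure circle_product_volume B" if B: "B \<in> ?S" for B
  proof -
    let ?b = "\<lambda>t. emeasure vol {y. (frac t, y) \<in> B}"
    have slice: "{y. (frac t, y) \<in> B} \<in> sets borel" for t
    proof -
      have "(\<lambda>(t, y). (frac t, y)) -` B \<inter> space product_measure \<in> sets product_measure"
        by (rule measurable_sets[OF measurable_unroll B])
      from sets_Pair1[OF this, of t] show ?thesis unfolding space_product_measure sets_vol by (simp add: vimage_def)
    qed
    have "{y. (frac t, y) \<in> ?T -` B \<inter> ({0..<1} \<times> UNIV)} = h t -` {y. (frac (t + \<alpha>), y) \<in> B}" for t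
    proof -
      note frac_frac_add[of t \<alpha>]
      then show ?thesis
        using periodic_frac[where f = h, OF hp(5)]
        by (auto simp: skew_product_def frac_lt_1)
    qed
    then have "emeasure vol {y. (frac t, y) \<in> ?T -` B \<inter> ({0..<1} \<times> UNIV)} = ?b (t + \<alpha>)" for t
      using emeasure_vol_vimage[OF hp(2)[of t] slice[of "t + \<alpha>"]] by simp
    then have "emeasure circle_product_volume (?T -` B \<inter> ({0..<1} \<times> UNIV)) =
        ennreal (inverse (measure vol UNIV)) * (\<integral>\<^sup>+t\<in>{0..<1}. ?b (t + \<alpha>) \<partial>lborel)"
      unfolding emeasure_circle_product_volume(1)[OF pre[OF B]] by simp
    also have "(\<integral>\<^sup>+t\<in>{0..<1}. ?b (t + \<alpha>) \<partial>lborel) = (\<integral>\<^sup>+t\<in>{0..<1}. ?b t \<partial>lborel)"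
      by (rule nn_integral_circle_rotation[OF emeasure_circle_product_volume(2)[OF B]]) (simp add: frac_1_eq)
    finally show ?thesis unfolding emeasure_circle_product_volume(1)[OF B] .
  qed
  then show ?thesis
    unfolding invariant_borel_prob_def topspace_circle_product
    using one sets_circle_product_volume space_circle_product_volume sets_circle_product_borel[unfolded topspace_circle_product] by simp
qed

lemma integral_circle_product_zero:
  assumes \<Phi>: "continuous_on UNIV (\<lambda>(t, y :: 'y). \<Phi> t y :: real)" and per: "\<And>t. \<Phi> (t + 1) = \<Phi> t"
    and z: "\<And>t. (\<integral>y. \<Phi> t y \<partial>vol) = 0"
  shows "(\<integral>z. (\<lambda>(t, y). \<Phi> t y) z \<partial>circle_product_volume) = 0"
proof -
  interpret C: finite_measure circle_lebesgue by (rule finite_circle_lebesgue)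
  interpret P: pair_sigma_finite circle_lebesgue vol by unfold_locales
  interpret PF: finite_measure product_measure by (rule finite_measure_pair_measure[OF vol_finite finite_circle_lebesgue])
  let ?F = "\<lambda>(t, y). \<Phi> t y"
  have c: "continuous_map circle_product euclideanreal ?F" by (rule continuous_map_circle_product[OF \<Phi> per])
  have Fm: "?F \<in> borel_measurable circle_product_borel"
  proof (rule borel_measurableI)
    fix S :: "real set" assume "open S"
    then have "openin circle_product {x \<in> topspace circle_product. ?F x \<in> S}" using openin_continuous_map_preimage[OF c] by simp
    moreover have "{x \<in> topspace circle_product. ?F x \<in> S} = ?F -` S \<inter> space circle_product_borel"
      unfolding topspace_circle_product space_circle_product_borel by blast
    ultimately show "?F -` S \<inter> space circle_product_borel \<in> sets circle_product_borel"
      using open_circle_product_borel by metis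
  qed
  have e: "?F ((\<lambda>(t, y). (frac t, y)) z) = ?F z" for z
    using periodic_frac[where f = \<Phi>, OF per] by (cases z) auto
  have "bounded (?F ` ({0..1} \<times> UNIV))"
    by (intro compact_imp_bounded compact_continuous_image continuous_on_subset[OF \<Phi>] compact_Times compact_manifold) auto
  then obtain b where b: "\<And>z. z \<in> {0..1} \<times> UNIV \<Longrightarrow> \<bar>?F z\<bar> \<le> b" unfolding bounded_iff by auto
  have b': "\<bar>?F z\<bar> \<le> b" for z
    using b[of "(\<lambda>(t, y). (frac t, y)) z"] unfolding e by (auto simp: case_prod_unfold less_imp_le[OF frac_lt_1])
  have "?F \<in> borel_measurable borel" using \<Phi> by (rule borel_measurable_continuous_onI)
  then have Fp: "?F \<in> borel_measurable product_measure" using measurable_cong_sets[OF sets_product_measure refl] by blast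
  have i: "integrable product_measure ?F"
    by (rule PF.integrable_const_bound[of _ b]) (use b' Fp in \<open>auto intro!: AE_I2\<close>)
  have "(\<integral>z. ?F z \<partial>distr product_measure circle_product_borel (\<lambda>(t, y). (frac t, y))) =
      (\<integral>z. ?F z \<partial>product_measure)"
    by (subst integral_distr[OF measurable_unroll Fm]) (simp only: e)
  also have "\<dots> = (\<integral>t. (\<integral>y. \<Phi> t y \<partial>vol) \<partial>circle_lebesgue)"
    using P.integral_fst'[OF i] by simp
  also have "\<dots> = 0" by (simp add: z)
  finally show ?thesis
    unfolding circle_product_volume_def using Fm by (subst integral_density) auto
qed

lemma skew_product_iterate:
  assumes h: "\<And>t. h (t + 1) = h t"
  shows "(skew_product h \<alpha> ^^ j) (frac t, z) = (frac (t + real j * \<alpha>), skew_iterate h \<alpha> j t z)"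
proof (induction j)
  case (Suc j)
  let ?s = "t + real j * \<alpha>"
  note frac_frac_add[of ?s \<alpha>]
  then show ?case
    using Suc periodic_frac[where f = h, OF h, of ?s] by (simp add: skew_product_def algebra_simps)
qed simp

text \<open>The function \<open>\<Phi> t y = H t (h t y)\<close> has integral zero on every slice, because \<open>H t\<close> is normalized and \<open>h t\<close>
preserves the volume. Hence the unique invariant measure, which is the product measure, annihilates
it, and its time averages tend to zero uniformly.\<close>

lemma uniform_hamiltonian_averages:
  assumes h: "smooth_loop A \<Omega> h" and H: "normalized_generator h H"
    and se: "strictly_ergodic circle_product (skew_product h \<alpha>)" and e: "\<epsilon> > 0"
  shows "\<exists>N. \<forall>n\<ge>N. \<forall>t z.
    \<bar>\<Sum>j<n. H (t + real j * \<alpha>) (h (t + real j * \<alpha>) (skew_iterate h \<alpha> j t z))\<bar> \<le> \<epsilon> * real n"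
proof -
  note hp = smooth_loop_props[OF h]
  have gH: "generated_by A \<Omega> H h" and perH: "\<And>t. H (t + 1) = H t" and nH: "\<And>t. (\<integral>y. H t y \<partial>vol) = 0"
    using H unfolding normalized_generator_def by auto
  define \<Phi> where "\<Phi> t y = H t (h t y)" for t y
  have "continuous_on UNIV (\<lambda>z. (\<lambda>(t, y). H t y) (fst z, (\<lambda>(t, y). h t y) z))"
    by (intro continuous_on_compose2[OF smooth_functions_continuous[OF generated_by_smooth[OF gH]]]
        continuous_on_Pair continuous_on_fst continuous_on_id psmooth_continuous[OF hp(1)]) auto
  then have c: "continuous_on UNIV (\<lambda>(t, y). \<Phi> t y)" by (simp add: \<Phi>_def case_prod_unfold)
  have per: "\<Phi> (t + 1) = \<Phi> t" for t by (simp add: \<Phi>_def fun_eq_iff perH hp(5))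
  have z: "(\<integral>y. \<Phi> t y \<partial>vol) = 0" for t
    unfolding \<Phi>_def using integral_symplectomorphism[OF hp(2) generated_by_continuous[OF gH]] nH by simp
  have T: "homeomorphic_map circle_product circle_product (skew_product h \<alpha>)"
    and X: "compact_space circle_product" and u: "\<exists>!M. invariant_borel_prob circle_product (skew_product h \<alpha>) M"
    using se unfolding strictly_ergodic_def by auto
  obtain N where N: "\<And>n x. n \<ge> N \<Longrightarrow> x \<in> topspace circle_product \<Longrightarrow>
      \<bar>\<Sum>j<n. (\<lambda>(t, y). \<Phi> t y) ((skew_product h \<alpha> ^^ j) x)\<bar> \<le> \<epsilon> * real n"
    using uniform_time_averages[OF X Hausdorff_circle_product T u skew_product_invariant[OF h T]
        continuous_map_circle_product[OF c per] integral_circle_product_zero[OF c per z] e] by blast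
  have "\<bar>\<Sum>j<n. H (t + real j * \<alpha>) (h (t + real j * \<alpha>) (skew_iterate h \<alpha> j t z))\<bar> \<le> \<epsilon> * real n" if "n \<ge> N" for n t z
  proof -
    have "(\<lambda>(t, y). \<Phi> t y) ((skew_product h \<alpha> ^^ j) (frac t, z)) =
        H (t + real j * \<alpha>) (h (t + real j * \<alpha>) (skew_iterate h \<alpha> j t z))" for j
      unfolding skew_product_iterate[where h = h, OF hp(5)]
      using fun_cong[OF periodic_frac[where f = \<Phi>, OF per, of "t + real j * \<alpha>"], of "skew_iterate h \<alpha> j t z"]
      by (simp add: \<Phi>_def)
    moreover have "(frac t, z) \<in> topspace circle_product" by (simp add: topspace_circle_topology frac_lt_1)
    ultimately show ?thesis using N[OF that, of "(frac t, z)"] by simp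
  qed
  then show ?thesis by blast
qed

section \<open>The asymptotic norm\<close>

text \<open>The class \<open>\<gamma>\<close> to the power \<open>k\<close> has a short representative. If \<open>h\<close> has a normalized generator, this is the
iterated skew product, whose length is at most \<open>\<epsilon> k\<close> or equal to the default length. If \<open>h\<close> has none,
then it is \<open>t \<mapsto> h (k t)\<close>, which has none either and therefore the default length.\<close>

lemma hofer_norm_power_bounds:
  assumes \<gamma>: "\<gamma> \<in> carrier (Ham_pi1 A \<Omega>)" and h: "smooth_loop A \<Omega> h" and r: "represents (Ham_topology A \<Omega>) h \<gamma>"
    and se: "strictly_ergodic circle_product (skew_product h \<alpha>)" and e: "\<epsilon> > 0"
  shows "\<exists>N. \<forall>k\<ge>N. min 0 default_length \<le> hofer_norm A \<Omega> (\<gamma> [^]\<^bsub>Ham_pi1 A \<Omega>\<^esub> k) \<and>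
    hofer_norm A \<Omega> (\<gamma> [^]\<^bsub>Ham_pi1 A \<Omega>\<^esub> k) \<le> max (\<epsilon> * real k) default_length"
proof -
  have *: "min 0 default_length \<le> hofer_norm A \<Omega> \<beta> \<and> hofer_norm A \<Omega> \<beta> \<le> b"
    if l: "smooth_loop A \<Omega> l" "represents (Ham_topology A \<Omega>) l \<beta>" "hofer_length A \<Omega> l \<le> b" for l \<beta> b
  proof -
    let ?S = "{hofer_length A \<Omega> h | h. smooth_loop A \<Omega> h \<and> represents (Ham_topology A \<Omega>) h \<beta>}"
    have m: "hofer_length A \<Omega> l \<in> ?S" using l by blast
    have low: "min 0 default_length \<le> x" if "x \<in> ?S" for x using that hofer_length_lower by blast
    have "min 0 default_length \<le> Inf ?S" using m low by (intro cInf_greatest) auto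
    moreover have "Inf ?S \<le> hofer_length A \<Omega> l" using m low by (intro cInf_lower) (auto simp: bdd_below_def)
    ultimately show ?thesis unfolding hofer_norm_def using l(3) by linarith
  qed
  show ?thesis
  proof (cases "\<exists>H. normalized_generator h H")
    case True
    then obtain H where H: "normalized_generator h H" by blast
    obtain N where N: "\<And>n t z. n \<ge> N \<Longrightarrow>
      \<bar>\<Sum>j<n. H (t + real j * \<alpha>) (h (t + real j * \<alpha>) (skew_iterate h \<alpha> j t z))\<bar> \<le> \<epsilon> * real n"
      using uniform_hamiltonian_averages[OF h H se e] by blast
    show ?thesis
    proof (intro exI[of _ N] allI impI)
      fix k assume "k \<ge> N"
      then have "hofer_length A \<Omega> (skew_iterate h \<alpha> k) \<le> max (\<epsilon> * real k) default_length"
        by (intro hofer_length_skew_iterate[OF h H] N)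
      from *[OF smooth_loop_skew_iterate[OF h] represents_skew_iterate[OF \<gamma> h r] this]
      show "min 0 default_length \<le> hofer_norm A \<Omega> (\<gamma> [^]\<^bsub>Ham_pi1 A \<Omega>\<^esub> k) \<and>
        hofer_norm A \<Omega> (\<gamma> [^]\<^bsub>Ham_pi1 A \<Omega>\<^esub> k) \<le> max (\<epsilon> * real k) default_length" .
    qed
  next
    case False
    have len: "hofer_length A \<Omega> (\<lambda>t. h (real k * t)) \<le> max (\<epsilon> * real k) default_length" if "k \<ge> 1" for k
    proof -
      have "\<nexists>K. normalized_generator (\<lambda>t. h (real k * t)) K"
        using normalized_generator_slow_down[OF h, of k] False that by auto
      then show ?thesis using hofer_length_default by simp
    qed
    show ?thesis
      using *[OF smooth_loop_speed[OF h] represents_speed[OF \<gamma> h r] len] by blast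
  qed
qed

lemma scaled_power_norm_tendsto:
  assumes \<gamma>: "\<gamma> \<in> carrier (Ham_pi1 A \<Omega>)" and h: "smooth_loop A \<Omega> h" and r: "represents (Ham_topology A \<Omega>) h \<gamma>"
    and se: "strictly_ergodic circle_product (skew_product h \<alpha>)"
  shows "scaled_power_norm A \<Omega> \<gamma> \<longlonglongrightarrow> 0"
proof (rule LIMSEQ_I)
  fix \<epsilon> :: real assume e: "\<epsilon> > 0"
  obtain N where N: "\<And>k. k \<ge> N \<Longrightarrow> min 0 default_length \<le> hofer_norm A \<Omega> (\<gamma> [^]\<^bsub>Ham_pi1 A \<Omega>\<^esub> k) \<and>
    hofer_norm A \<Omega> (\<gamma> [^]\<^bsub>Ham_pi1 A \<Omega>\<^esub> k) \<le> max (\<epsilon> / 2 * real k) default_length"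
    using hofer_norm_power_bounds[OF \<gamma> h r se, of "\<epsilon> / 2"] e by auto
  obtain M :: nat where M: "\<bar>default_length\<bar> / (\<epsilon> / 2) < real M" using reals_Archimedean2 by blast
  show "\<exists>n0. \<forall>k\<ge>n0. norm (scaled_power_norm A \<Omega> \<gamma> k - 0) < \<epsilon>"
  proof (intro exI[of _ "max N (max M 1)"] allI impI)
    fix k assume k: "k \<ge> max N (max M 1)"
    have "\<bar>default_length\<bar> < \<epsilon> / 2 * real M" using M e by (simp add: field_simps)
    also have "\<dots> \<le> \<epsilon> / 2 * real k" using k e by (intro mult_left_mono) auto
    finally have "\<bar>hofer_norm A \<Omega> (\<gamma> [^]\<^bsub>Ham_pi1 A \<Omega>\<^esub> k)\<bar> \<le> \<epsilon> / 2 * real k"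
      using N[of k] k by auto
    moreover have "\<epsilon> / 2 * real k < \<epsilon> * real k" using k e by simp
    ultimately show "norm (scaled_power_norm A \<Omega> \<gamma> k - 0) < \<epsilon>"
      using k unfolding scaled_power_norm_def by (simp add: pos_divide_less_eq)
  qed
qed

end

theorem theorem1p3:
  fixes A :: "('y::{t2_space,second_countable_topology}, 'n::{finite,wellorder}) chart set"
    and \<Omega> :: "('y, 'n) two_form"
    and h :: "real \<Rightarrow> 'y \<Rightarrow> 'y"
    and \<gamma> :: "(real \<Rightarrow> 'y \<Rightarrow> 'y) set"
  assumes "closed_connected_symplectic_manifold A \<Omega>"
    and "\<gamma> \<in> carrier (Ham_pi1 A \<Omega>)"
    and "smooth_loop A \<Omega> h"
    and "strictly_ergodic_loop h"
    and "represents (Ham_topology A \<Omega>) h \<gamma>"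
  shows "convergent (scaled_power_norm A \<Omega> \<gamma>) \<and> asymptotic_hofer_norm A \<Omega> \<gamma> = 0"
proof -
  interpret symplectic_manifold A \<Omega> by unfold_locales (rule assms(1))
  obtain \<alpha> where "strictly_ergodic (prod_topology circle_topology euclidean) (skew_product h \<alpha>)"
    using assms(4) unfolding strictly_ergodic_loop_def by blast
  from scaled_power_norm_tendsto[OF assms(2,3,5) this]
  show ?thesis unfolding asymptotic_hofer_norm_def using limI convergentI by blast
qed


end
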